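(* Let $X=(x_1,\ldots,x_N)$ with $x_n\in\mathbb{R}^D$, let $K\in\mathbb{N}$, and let $p_{nk}\in[0,1]$ with $\sum_{k=1}^K p_{nk}=1$ for every $n$. Let $z_1,\ldots,z_N$ be independent random vectors, where $z_n=(z_{n1},\ldots,z_{nK})\in\{0,1\}^K$ has exactly one entry equal to $1$ and $\Pr(z_{nk}=1)=p_{nk}$. For each $k$ define $r_k=\sum_{n}p_{nk}$, $w_k^{EM}=r_k/N$, $w_k^{SEM}=\frac1N\sum_n z_{nk}$, \[\mu_k^{EM}=\frac{\sum_{n=1}^N p_{nk}x_n}{\sum_{n=1}^N p_{nk}},\qquad \mu_k^{SEM}=\frac{\sum_{n=1}^N z_{nk}x_n}{\sum_{n=1}^N z_{nk}},\] for $d=1,\ldots,D$ the spread $\Delta_d=\max_n (x_n)_d-\min_n (x_n)_d$, and \[\tau_{kd}=\sqrt{\sum_{n=1}^N p_{nk}(1-p_{nk})\left(x_n-\mu_k^{EM}\right)_d^2}.\] Fix $k\in\{1,\ldots,K\}$ and let $E_w$ be the event that $\left|w_k^{SEM}-w_k^{EM}\right|\leq\lambda_w w_k^{EM}$, where $0<\lambda_w<1$. Then for every $i\in\{1,\ldots,D\}$ and $0<\delta<1$, \[\Pr\left(\left|\left(\mu_k^{SEM}-\mu_k^{EM}\right)_i\right|\leq\frac{\lambda_\mu}{1-\lambda_w}\cdot\frac{\tau_{ki}}{r_k}\ \middle|\ E_w\right)\geq 1-\delta,\] where \[\lambda_\mu=\begin{cases}\sqrt{2e\ln(2/\delta)}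 & \text{if } \frac{\tau_{ki}}{\Delta_i}\geq\frac1e\sqrt{2e\ln(2/\delta)},\\[1ex] \frac{2\Delta_i}{\tau_{ki}}\ln(2/\delta) & \text{otherwise.}\end{cases}\]
   Context: This describes one update step of EM versus stochastic EM (SEM) for a Gaussian mixture with $K$ components in $\mathbb{R}^D$: $p_{nk}=p(z_{nk}=1\mid X,\theta)$ are the posterior responsibilities under the current parameters $\theta$; EM uses them as soft weights in the mean update $\mu_k^{EM}$, while SEM samples a hard assignment $z$ from them (independently for each data point) and uses it in $\mu_k^{SEM}$. $(v)_i$ denotes the $i$-th coordinate of a vector $v$. *)

theory Defs
  imports "HOL-Analysis.Analysis" "HOL-Probability.Probability"
begin

text \<open>Data points are indexed 1..N, components 1..K; vectors in R^D are real^'d.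
  A realization of the hard assignments z_1..z_N is encoded by c :: nat => nat,
  where c n is the (unique) index k with z_nk = 1.\<close>

definition zind :: "(nat \<Rightarrow> nat) \<Rightarrow> nat \<Rightarrow> nat \<Rightarrow> real" where
  "zind c n k = (if c n = k then 1 else 0)"

definition r_k :: "nat \<Rightarrow> (nat \<Rightarrow> nat \<Rightarrow> real) \<Rightarrow> nat \<Rightarrow> real" where
  "r_k N p k = (\<Sum>n=1..N. p n k)"

definition w_EM :: "nat \<Rightarrow> (nat \<Rightarrow> nat \<Rightarrow> real) \<Rightarrow> nat \<Rightarrow> real" where
  "w_EM N p k = r_k N p k / real N"

definition w_SEM :: "nat \<Rightarrow> (nat \<Rightarrow> nat) \<Rightarrow> nat \<Rightarrow> real" where
  "w_SEM N c k = (\<Sum>n=1..N. zind c n k) / real N"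

definition mu_EM :: "nat \<Rightarrow> (nat \<Rightarrow> real^'d) \<Rightarrow> (nat \<Rightarrow> nat \<Rightarrow> real) \<Rightarrow> nat \<Rightarrow> real^'d" where
  "mu_EM N x p k = (\<Sum>n=1..N. p n k *\<^sub>R x n) /\<^sub>R (\<Sum>n=1..N. p n k)"

definition mu_SEM :: "nat \<Rightarrow> (nat \<Rightarrow> real^'d) \<Rightarrow> (nat \<Rightarrow> nat) \<Rightarrow> nat \<Rightarrow> real^'d" where
  "mu_SEM N x c k = (\<Sum>n=1..N. zind c n k *\<^sub>R x n) /\<^sub>R (\<Sum>n=1..N. zind c n k)"

definition spread :: "nat \<Rightarrow> (nat \<Rightarrow> real^'d) \<Rightarrow> 'd \<Rightarrow> real" where
  "spread N x d = Max ((\<lambda>n. x n $ d) ` {1..N}) - Min ((\<lambda>n. x n $ d) ` {1..N})"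

definition tau :: "nat \<Rightarrow> (nat \<Rightarrow> real^'d) \<Rightarrow> (nat \<Rightarrow> nat \<Rightarrow> real) \<Rightarrow> nat \<Rightarrow> 'd \<Rightarrow> real" where
  "tau N x p k d = sqrt (\<Sum>n=1..N. p n k * (1 - p n k) * ((x n - mu_EM N x p k) $ d)\<^sup>2)"

definition lambda_mu :: "real \<Rightarrow> real \<Rightarrow> real \<Rightarrow> real" where
  "lambda_mu t sp \<delta> =
     (if t / sp \<ge> (1 / exp 1) * sqrt (2 * exp 1 * ln (2 / \<delta>))
      then sqrt (2 * exp 1 * ln (2 / \<delta>))
      else (2 * sp / t) * ln (2 / \<delta>))"

end

theory Submission
  imports Defs
begin

text \<open>For fixed \<open>k\<close> the indicators \<open>z\<^sub>n\<^sub>k\<close> are independent Bernoulli trials. With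
  \<open>y\<^sub>n = (x\<^sub>n - \<mu>\<^sub>k)\<^sub>i\<close>, where \<open>\<mu>\<^sub>k\<close> is the EM mean, one has \<open>\<Sum> p\<^sub>n y\<^sub>n = 0\<close>, so the error of the SEM mean is
  \<open>S / W\<close> with \<open>S = \<Sum> (z\<^sub>n - p\<^sub>n) y\<^sub>n\<close> and \<open>W = \<Sum> z\<^sub>n\<close>, and \<open>W \<ge> (1 - \<lambda>\<^sub>w) r\<^sub>k\<close> on the conditioning event.
  Both branches of \<open>\<lambda>\<^sub>\<mu>\<close> become, after scaling, the claim that \<open>\<bar>y\<^sub>n\<bar> \<le> 1\<close> and \<open>Var S \<le> 2 L / e\<close> imply
  \<open>P (\<bar>S\<bar> > 2 L, \<bar>W - E W\<bar> \<le> h) \<le> 2 exp (- L) P (\<bar>W - E W\<bar> \<le> h)\<close> with \<open>L = ln (2 / \<delta>)\<close>.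

  An unconditional tail bound for \<open>S\<close> suffices only if the window \<open>\<bar>W - E W\<bar> \<le> h\<close> has large probability.
  Otherwise the bound holds atom by atom. Log-concavity of the law of \<open>W\<close> makes the covariances
  of the trials on \<open>{W = m}\<close> nonpositive off the diagonal, so Gershgorin's theorem bounds the second moment of \<open>S\<close> there by
  \<open>K Var S P (W = m)\<close> with \<open>K\<close> slightly above 2; a window of small probability forces \<open>Var W\<close> to be large,
  which controls \<open>K\<close>. This serves for small \<open>L\<close>; for large \<open>L\<close> exponential tilting
  and a Fourier bound on the atoms of the tilted law replace the second moment.\<close>

section \<open>Independent Bernoulli trials\<close>

text \<open>Both branches of \<open>lambda_mu\<close> are one statement:
  \<open>lambda_mu * tau = 2 L D\<close>, where \<open>D\<close> is the larger of the spread and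
  \<open>tau * sqrt (e / (2 L))\<close>, the least scale meeting both normalised hypotheses. The
  obstacle is \<open>\<delta>\<close> near 1, where almost no slack is left. At
  \<open>L = ln 2\<close> and \<open>Var S = 2 L / e\<close> Chebyshev gives
  \<open>1 / (2 e ln 2)\<close>, about 0.2653, against a target equal to the probability of the
  window. So the unconditional route needs a window of mass at least 25/94, and the second moment on
  an atom may exceed the unconditional one by a factor of at most \<open>2 e ln 2\<close>, about
  3.77; 94/25 serves for both. The same trade-off at larger \<open>L\<close> yields the other pairs
  of thresholds. Mass and variance are linked through the largest atom. It is at least
  \<open>1 / sqrt (1 + 12 v)\<close> with \<open>v = Var W\<close>, and an atom at distance
  \<open>t\<close> from the mean falls short of it by a proportion of at most about
  \<open>t\<^sup>2 / (2 v)\<close>. A window of small mass therefore contradicts a small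
  \<open>v\<close>; the resulting cubic inequality in \<open>v\<close> also has solutions at small
  \<open>v\<close>, which is why each use starts from a weaker bound obtained otherwise.\<close>

text \<open>A subset of \<open>I\<close> stands for the set of successes, so \<open>ber_ex\<close> is the expectation over independent trials.\<close>

definition ber_wt :: "('a \<Rightarrow> real) \<Rightarrow> 'a set \<Rightarrow> 'a set \<Rightarrow> real" where
  "ber_wt p I A = (\<Prod>n\<in>A. p n) * (\<Prod>n\<in>I - A. 1 - p n)"

definition ber_ex :: "('a \<Rightarrow> real) \<Rightarrow> 'a set \<Rightarrow> ('a set \<Rightarrow> real) \<Rightarrow> real" where
  "ber_ex p I F = (\<Sum>A\<in>Pow I. ber_wt p I A * F A)"

lemma ber_ex_empty [simp]: "ber_ex p {} F = F {}"
  by (simp add: ber_ex_def ber_wt_def)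

lemma ber_ex_insert:
  assumes "finite I" "n \<notin> I"
  shows "ber_ex p (insert n I) F = p n * ber_ex p I (\<lambda>A. F (insert n A)) + (1 - p n) * ber_ex p I F"
proof -
  have fin: "finite A" if "A \<in> Pow I" for A using that assms(1) finite_subset by auto
  have inj: "inj_on (insert n) (Pow I)"
    using assms(2) by (auto simp: inj_on_def)
  have disj: "Pow I \<inter> insert n ` Pow I = {}" using assms(2) by auto
  have w1: "ber_wt p (insert n I) (insert n A) = p n * ber_wt p I A" if "A \<in> Pow I" for A
  proof -
    have "n \<notin> A" "insert n I - insert n A = I - A" using that assms(2) by auto
    then show ?thesis using fin[OF that] by (simp add: ber_wt_def mult.assoc)
  qed
  have w2: "ber_wt p (insert n I) A = (1 - p n) * ber_wt p I A" if "A \<in> Pow I" for A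
  proof -
    have "insert n I - A = insert n (I - A)" using that assms(2) by auto
    then show ?thesis using assms by (simp add: ber_wt_def mult.left_commute)
  qed
  have "ber_ex p (insert n I) F = (\<Sum>A\<in>Pow I. ber_wt p (insert n I) A * F A)
        + (\<Sum>A\<in>insert n ` Pow I. ber_wt p (insert n I) A * F A)"
    unfolding ber_ex_def Pow_insert
    by (rule sum.union_disjoint) (use assms disj in auto)
  also have "(\<Sum>A\<in>insert n ` Pow I. ber_wt p (insert n I) A * F A)
       = (\<Sum>A\<in>Pow I. ber_wt p (insert n I) (insert n A) * F (insert n A))"
    by (subst sum.reindex[OF inj]) simp
  also have "\<dots> = p n * ber_ex p I (\<lambda>A. F (insert n A))"
    unfolding ber_ex_def sum_distrib_left
    by (rule sum.cong) (use w1 in auto)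
  also have "(\<Sum>A\<in>Pow I. ber_wt p (insert n I) A * F A) = (1 - p n) * ber_ex p I F"
    unfolding ber_ex_def sum_distrib_left
    by (rule sum.cong) (use w2 in auto)
  finally show ?thesis by simp
qed

lemma ber_ex_remove:
  assumes "finite I" "n \<in> I"
  shows "ber_ex p I F = p n * ber_ex p (I - {n}) (\<lambda>A. F (insert n A)) + (1 - p n) * ber_ex p (I - {n}) F"
  using ber_ex_insert[of "I - {n}" n p F] assms by (simp add: insert_absorb)

lemma ber_ex_cong: "(\<And>A. A \<subseteq> I \<Longrightarrow> F A = G A) \<Longrightarrow> ber_ex p I F = ber_ex p I G"
  unfolding ber_ex_def by (rule sum.cong) auto

lemma ber_ex_add: "ber_ex p I (\<lambda>A. F A + G A) = ber_ex p I F + ber_ex p I G"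
  unfolding ber_ex_def by (simp add: sum.distrib distrib_left)

lemma ber_ex_diff: "ber_ex p I (\<lambda>A. F A - G A) = ber_ex p I F - ber_ex p I G"
  unfolding ber_ex_def by (simp add: sum_subtractf right_diff_distrib)

lemma ber_ex_cmult: "ber_ex p I (\<lambda>A. c * F A) = c * ber_ex p I F"
  unfolding ber_ex_def by (simp add: sum_distrib_left mult.left_commute)

lemma ber_ex_mult_right: "ber_ex p I (\<lambda>A. F A * c) = ber_ex p I F * c"
  using ber_ex_cmult[of p I c F] by (simp add: mult.commute)

lemma ber_ex_sum: "ber_ex p I (\<lambda>A. \<Sum>k\<in>J. F k A) = (\<Sum>k\<in>J. ber_ex p I (F k))"
  unfolding ber_ex_def sum_distrib_left by (rule sum.swap)

lemma ber_ex_const [simp]: "finite I \<Longrightarrow> ber_ex p I (\<lambda>A. c) = c"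
proof (induction I rule: finite_induct)
  case (insert n I)
  then show ?case by (simp add: ber_ex_insert algebra_simps)
qed simp

lemma ber_wt_nonneg: "(\<And>n. n \<in> I \<Longrightarrow> 0 \<le> p n \<and> p n \<le> 1) \<Longrightarrow> A \<subseteq> I \<Longrightarrow> 0 \<le> ber_wt p I A"
  unfolding ber_wt_def by (intro mult_nonneg_nonneg prod_nonneg) auto

lemma ber_ex_mono:
  assumes "\<And>n. n \<in> I \<Longrightarrow> 0 \<le> p n \<and> p n \<le> 1" "\<And>A. A \<subseteq> I \<Longrightarrow> F A \<le> G A"
  shows "ber_ex p I F \<le> ber_ex p I G"
  unfolding ber_ex_def by (intro sum_mono mult_left_mono ber_wt_nonneg) (use assms in auto)

lemma ber_ex_nonneg:
  assumes "\<And>n. n \<in> I \<Longrightarrow> 0 \<le> p n \<and> p n \<le> 1" "\<And>A. A \<subseteq> I \<Longrightarrow> 0 \<le> F A"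
  shows "0 \<le> ber_ex p I F"
  unfolding ber_ex_def by (intro sum_nonneg mult_nonneg_nonneg ber_wt_nonneg) (use assms in auto)

text \<open>Independence in the form needed for exponential moments: \<open>exp (s * S)\<close>
  splits into one factor per success and one per failure.\<close>

lemma ber_ex_prod:
  assumes "finite I"
  shows "ber_ex p I (\<lambda>A. (\<Prod>n\<in>A. g n) * (\<Prod>n\<in>I - A. h n)) = (\<Prod>n\<in>I. p n * g n + (1 - p n) * h n)"
  using assms
proof (induction I rule: finite_induct)
  case (insert n I)
  have 1: "ber_ex p I (\<lambda>A. prod g (insert n A) * prod h (insert n I - insert n A))
     = g n * (\<Prod>n\<in>I. p n * g n + (1 - p n) * h n)"
  proof -
    have "ber_ex p I (\<lambda>A. prod g (insert n A) * prod h (insert n I - insert n A))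
      = ber_ex p I (\<lambda>A. g n * (prod g A * prod h (I - A)))"
    proof (rule ber_ex_cong)
      fix A assume A: "A \<subseteq> I"
      then have "n \<notin> A" "finite A" "insert n I - insert n A = I - A"
        using insert.hyps finite_subset by auto
      then show "prod g (insert n A) * prod h (insert n I - insert n A) = g n * (prod g A * prod h (I - A))"
        by simp
    qed
    then show ?thesis using insert.IH by (simp add: ber_ex_cmult)
  qed
  have 2: "ber_ex p I (\<lambda>A. prod g A * prod h (insert n I - A))
     = h n * (\<Prod>n\<in>I. p n * g n + (1 - p n) * h n)"
  proof -
    have "ber_ex p I (\<lambda>A. prod g A * prod h (insert n I - A))
      = ber_ex p I (\<lambda>A. h n * (prod g A * prod h (I - A)))"
    proof (rule ber_ex_cong)
      fix A assume A: "A \<subseteq> I"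
      then have "n \<notin> I - A" "finite (I - A)" "insert n I - A = insert n (I - A)"
        using insert.hyps finite_subset by auto
      then show "prod g A * prod h (insert n I - A) = h n * (prod g A * prod h (I - A))"
        by simp
    qed
    then show ?thesis using insert.IH by (simp add: ber_ex_cmult)
  qed
  have "ber_ex p (insert n I) (\<lambda>A. prod g A * prod h (insert n I - A))
     = p n * (g n * (\<Prod>n\<in>I. p n * g n + (1 - p n) * h n)) + (1 - p n) * (h n * (\<Prod>n\<in>I. p n * g n + (1 - p n) * h n))"
    by (subst ber_ex_insert[OF insert.hyps]) (simp only: 1 2)
  also have "\<dots> = (p n * g n + (1 - p n) * h n) * (\<Prod>n\<in>I. p n * g n + (1 - p n) * h n)"
    by (simp add: algebra_simps)
  finally show ?case using insert.hyps by simp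
qed simp

definition ind :: "'a set \<Rightarrow> 'a \<Rightarrow> real" where "ind A n = (if n \<in> A then 1 else 0)"

text \<open>Integration by parts in one coordinate: conditioning on trial \<open>n\<close> leaves
  the mean increment of \<open>F\<close>, weighted by the variance of the trial. Stein's identity
  and the covariance formulas are sums or iterates of it.\<close>

lemma ber_ex_center:
  assumes "finite I" "n \<in> I"
  shows "ber_ex p I (\<lambda>A. (ind A n - p n) * F A)
     = p n * (1 - p n) * (ber_ex p (I - {n}) (\<lambda>A. F (insert n A)) - ber_ex p (I - {n}) F)"
proof -
  have 1: "ber_ex p (I - {n}) (\<lambda>A. (ind (insert n A) n - p n) * F (insert n A))
     = (1 - p n) * ber_ex p (I - {n}) (\<lambda>A. F (insert n A))"
    by (simp add: ind_def ber_ex_cmult)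
  have 2: "ber_ex p (I - {n}) (\<lambda>A. (ind A n - p n) * F A) = ber_ex p (I - {n}) (\<lambda>A. (- p n) * F A)"
    by (rule ber_ex_cong) (auto simp: ind_def)
  have "ber_ex p I (\<lambda>A. (ind A n - p n) * F A)
     = p n * ((1 - p n) * ber_ex p (I - {n}) (\<lambda>A. F (insert n A)))
       + (1 - p n) * (- p n * ber_ex p (I - {n}) F)"
    by (subst ber_ex_remove[OF assms]) (simp only: 1 2 ber_ex_cmult)
  then show ?thesis by (simp add: algebra_simps)
qed

text \<open>Exchanges successes and failures; estimates on one side of the mean are carried to the
  other side by it.\<close>

lemma ber_ex_compl:
  assumes "finite I"
  shows "ber_ex (\<lambda>n. 1 - p n) I F = ber_ex p I (\<lambda>A. F (I - A))"
proof -
  have bij: "bij_betw (\<lambda>A. I - A) (Pow I) (Pow I)"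
    by (rule bij_betwI[where g="\<lambda>A. I - A"]) auto
  have "ber_ex (\<lambda>n. 1 - p n) I F = (\<Sum>A\<in>Pow I. ber_wt (\<lambda>n. 1 - p n) I (I - A) * F (I - A))"
    unfolding ber_ex_def by (rule sum.reindex_bij_betw[OF bij, symmetric])
  also have "\<dots> = ber_ex p I (\<lambda>A. F (I - A))"
    unfolding ber_ex_def
  proof (rule sum.cong)
    fix A assume "A \<in> Pow I"
    then have "I - (I - A) = A" by auto
    then show "ber_wt (\<lambda>n. 1 - p n) I (I - A) * F (I - A) = ber_wt p I A * F (I - A)"
      by (simp add: ber_wt_def mult.commute)
  qed simp
  finally show ?thesis .
qed

text \<open>Integer arguments make atoms outside the range equal to 0, so the recursion over trials
  and shifts by 1 or 2 need no boundary cases.\<close>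

definition pbin :: "('a \<Rightarrow> real) \<Rightarrow> 'a set \<Rightarrow> int \<Rightarrow> real" where
  "pbin p I k = ber_ex p I (\<lambda>A. of_bool (int (card A) = k))"

lemma pbin_remove:
  assumes "finite I" "n \<in> I"
  shows "pbin p I k = p n * pbin p (I - {n}) (k - 1) + (1 - p n) * pbin p (I - {n}) k"
proof -
  have "ber_ex p (I - {n}) (\<lambda>A. of_bool (int (card (insert n A)) = k)) = pbin p (I - {n}) (k - 1)"
    unfolding pbin_def
  proof (rule ber_ex_cong)
    fix A assume "A \<subseteq> I - {n}"
    then have "finite A" "n \<notin> A" using assms finite_subset[of A I] by auto
    then show "of_bool (int (card (insert n A)) = k) = (of_bool (int (card A) = k - 1) :: real)"
      by auto
  qed
  then show ?thesis unfolding pbin_def by (subst ber_ex_remove[OF assms]) simp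
qed

lemma pbin_insert:
  assumes "finite I" "n \<notin> I"
  shows "pbin p (insert n I) k = p n * pbin p I (k - 1) + (1 - p n) * pbin p I k"
  using pbin_remove[of "insert n I" n p k] assms by simp

lemma pbin_nonneg: "(\<And>n. n \<in> I \<Longrightarrow> 0 \<le> p n \<and> p n \<le> 1) \<Longrightarrow> 0 \<le> pbin p I k"
  unfolding pbin_def by (rule ber_ex_nonneg) auto

text \<open>Two indices are needed for the induction: a new trial mixes neighbouring atoms in each
  factor, and the mixed products compare atoms at unequal indices.\<close>

lemma pbin_log_concave_gen:
  assumes "finite I" "\<And>n. n \<in> I \<Longrightarrow> 0 \<le> p n \<and> p n \<le> 1" "k \<le> l"
  shows "pbin p I (k - 1) * pbin p I (l + 1) \<le> pbin p I k * pbin p I l"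
  using assms
proof (induction I arbitrary: k l rule: finite_induct)
  case empty
  then show ?case by (auto simp: pbin_def)
next
  case (insert n I)
  have p: "0 \<le> p n" "0 \<le> 1 - p n" using insert.prems by auto
  have IH: "pbin p I (k - 1) * pbin p I (l + 1) \<le> pbin p I k * pbin p I l" if "k \<le> l" for k l
    using insert.IH insert.prems(1) that by auto
  define a where "a = pbin p I"
  have lc: "a (k - 1) * a (l + 1) \<le> a k * a l" if "k \<le> l" for k l using IH that by (simp add: a_def)
  have c1: "a (k - 1) * a (l + 1) \<le> a k * a l" using lc insert.prems by simp
  have c2: "a (k - 2) * a l \<le> a (k - 1) * a (l - 1)" using lc[of "k-1" "l-1"] insert.prems by simp
  \<comment> \<open>Both indices move inward by two: two applications of \<open>lc\<close>. If
    \<open>k = l\<close>, the first one already gives the claim with its factors swapped.\<close>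
  have c3: "a (k - 2) * a (l + 1) \<le> a k * a (l - 1)"
  proof (cases "k = l")
    case True
    then show ?thesis using lc[of "k-1" l] by (simp add: mult.commute)
  next
    case False
    then have "k \<le> l - 1" using insert.prems by simp
    then have "a (k - 1) * a l \<le> a k * a (l - 1)" using lc[of k "l-1"] by simp
    moreover have "a (k - 2) * a (l + 1) \<le> a (k - 1) * a l" using lc[of "k-1" l] insert.prems by simp
    ultimately show ?thesis by linarith
  qed
  have "pbin p (insert n I) (k - 1) * pbin p (insert n I) (l + 1)
     = (1 - p n) * (1 - p n) * (a (k - 1) * a (l + 1)) + p n * p n * (a (k - 2) * a l)
       + p n * (1 - p n) * (a (k - 1) * a l) + p n * (1 - p n) * (a (k - 2) * a (l + 1))"
    using insert.hyps by (simp add: pbin_insert a_def algebra_simps)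
  also have "\<dots> \<le> (1 - p n) * (1 - p n) * (a k * a l) + p n * p n * (a (k - 1) * a (l - 1))
       + p n * (1 - p n) * (a (k - 1) * a l) + p n * (1 - p n) * (a k * a (l - 1))"
    by (intro add_mono mult_left_mono c1 c2 c3 order_refl mult_nonneg_nonneg p)
  also have "\<dots> = pbin p (insert n I) k * pbin p (insert n I) l"
    using insert.hyps by (simp add: pbin_insert a_def algebra_simps)
  finally show ?case .
qed

lemma pbin_log_concave:
  assumes "finite I" "\<And>n. n \<in> I \<Longrightarrow> 0 \<le> p n \<and> p n \<le> 1"
  shows "pbin p I (k - 1) * pbin p I (k + 1) \<le> (pbin p I k)\<^sup>2"
  using pbin_log_concave_gen[OF assms order_refl] by (simp add: power2_eq_square)

section \<open>Stein's identity and the atoms of the number of successes\<close>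

definition bmu :: "('a \<Rightarrow> real) \<Rightarrow> 'a set \<Rightarrow> real" where "bmu p I = (\<Sum>n\<in>I. p n)"
definition bvar :: "('a \<Rightarrow> real) \<Rightarrow> 'a set \<Rightarrow> real" where "bvar p I = (\<Sum>n\<in>I. p n * (1 - p n))"

lemma sum_ind: "finite I \<Longrightarrow> A \<subseteq> I \<Longrightarrow> (\<Sum>n\<in>I. ind A n) = real (card A)"
  unfolding ind_def by (simp add: sum.If_cases Int_absorb1)

text \<open>The strict bounds make every \<open>vn n\<close>, every atom in the range and every
  tilting normaliser positive. Deterministic trials are split off at the end by
  \<open>ber_ex_nondegenerate\<close>.\<close>

locale bernoulli_family =
  fixes I :: "'a set" and p :: "'a \<Rightarrow> real"
  assumes fin: "finite I" and p01: "n \<in> I \<Longrightarrow> 0 < p n \<and> p n < 1"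
begin

text \<open>\<open>q n\<close> is the law of the number of successes when trial \<open>n\<close> is left out.\<close>

abbreviation "a \<equiv> pbin p I"
abbreviation "\<mu> \<equiv> bmu p I"
abbreviation "v \<equiv> bvar p I"
abbreviation "ex \<equiv> ber_ex p I"
abbreviation "q n k \<equiv> pbin p (I - {n}) k"
abbreviation "vn n \<equiv> p n * (1 - p n)"

lemma p01': "n \<in> I \<Longrightarrow> 0 \<le> p n \<and> p n \<le> 1"
  using p01 by fastforce

lemma vn_pos: "n \<in> I \<Longrightarrow> 0 < vn n"
  using p01 by simp

lemma v_nonneg: "0 \<le> v"
  unfolding bvar_def by (rule sum_nonneg) (use vn_pos in force)

lemma sub_family: "bernoulli_family (I - {n}) p"
  by unfold_locales (use fin p01 in auto)

lemma a_nonneg: "0 \<le> a k" by (rule pbin_nonneg) (use p01' in auto)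
lemma q_nonneg: "0 \<le> q n k" by (rule pbin_nonneg) (use p01' in auto)

lemma ex_mono: "(\<And>A. A \<subseteq> I \<Longrightarrow> F A \<le> G A) \<Longrightarrow> ex F \<le> ex G"
  by (rule ber_ex_mono) (use p01' in auto)

lemma card_W: "A \<subseteq> I \<Longrightarrow> (\<Sum>n\<in>I. ind A n - p n) = real (card A) - \<mu>"
  by (simp add: sum_subtractf sum_ind fin bmu_def)

lemma stein:
  "ex (\<lambda>A. (real (card A) - \<mu>) * F A)
     = (\<Sum>n\<in>I. vn n * (ber_ex p (I - {n}) (\<lambda>A. F (insert n A)) - ber_ex p (I - {n}) F))"
proof -
  have "ex (\<lambda>A. (real (card A) - \<mu>) * F A) = ex (\<lambda>A. \<Sum>n\<in>I. (ind A n - p n) * F A)"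
    by (rule ber_ex_cong) (simp add: card_W[symmetric] sum_distrib_right)
  also have "\<dots> = (\<Sum>n\<in>I. ex (\<lambda>A. (ind A n - p n) * F A))"
    by (rule ber_ex_sum)
  also have "\<dots> = (\<Sum>n\<in>I. vn n * (ber_ex p (I - {n}) (\<lambda>A. F (insert n A)) - ber_ex p (I - {n}) F))"
    by (rule sum.cong) (simp_all add: ber_ex_center fin)
  finally show ?thesis .
qed

lemma card_insert_sub: "A \<subseteq> I - {n} \<Longrightarrow> card (insert n A) = Suc (card A)"
  using fin finite_subset[of A I] by (subst card_insert_disjoint) auto

text \<open>Discrete counterpart of \<open>v * f' = - (x - \<mu>) * f\<close> for a Gaussian density
  \<open>f\<close>, except that the differences are those of the leave-one-out laws and not of
  \<open>a\<close> itself.\<close>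

lemma stein_pbin: "(of_int k - \<mu>) * a k = (\<Sum>n\<in>I. vn n * (q n (k - 1) - q n k))"
proof -
  have "(of_int k - \<mu>) * a k = ex (\<lambda>A. (real (card A) - \<mu>) * of_bool (int (card A) = k))"
    unfolding pbin_def ber_ex_cmult[symmetric] by (rule ber_ex_cong) auto
  also have "\<dots> = (\<Sum>n\<in>I. vn n * (q n (k - 1) - q n k))"
    unfolding stein pbin_def
  proof (rule sum.cong)
    fix n assume "n \<in> I"
    have "ber_ex p (I - {n}) (\<lambda>A. of_bool (int (card (insert n A)) = k))
      = ber_ex p (I - {n}) (\<lambda>A. of_bool (int (card A) = k - 1))"
      by (rule ber_ex_cong) (auto simp: card_insert_sub)
    then show "vn n * (ber_ex p (I - {n}) (\<lambda>A. of_bool (int (card (insert n A)) = k))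
         - ber_ex p (I - {n}) (\<lambda>A. of_bool (int (card A) = k)))
      = vn n * (ber_ex p (I - {n}) (\<lambda>A. of_bool (int (card A) = k - 1))
         - ber_ex p (I - {n}) (\<lambda>A. of_bool (int (card A) = k)))" by simp
  qed simp
  finally show ?thesis .
qed

lemma ex_card_centered: "ex (\<lambda>A. real (card A) - \<mu>) = 0"
  using stein[of "\<lambda>_. 1"] fin by simp

lemma ex_card_var: "ex (\<lambda>A. (real (card A) - \<mu>)\<^sup>2) = v"
proof -
  have "ex (\<lambda>A. (real (card A) - \<mu>)\<^sup>2) = ex (\<lambda>A. (real (card A) - \<mu>) * (real (card A) - \<mu>))"
    by (simp add: power2_eq_square)
  also have "\<dots> = (\<Sum>n\<in>I. vn n)"
    unfolding stein
  proof (rule sum.cong)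
    fix n assume "n \<in> I"
    have "ber_ex p (I - {n}) (\<lambda>A. real (card (insert n A)) - \<mu>)
      = ber_ex p (I - {n}) (\<lambda>A. (real (card A) - \<mu>) + 1)"
      by (rule ber_ex_cong) (auto simp: card_insert_sub)
    then show "vn n * (ber_ex p (I - {n}) (\<lambda>A. real (card (insert n A)) - \<mu>)
        - ber_ex p (I - {n}) (\<lambda>A. real (card A) - \<mu>)) = vn n"
      using fin by (simp add: ber_ex_add)
  qed simp
  finally show ?thesis by (simp add: bvar_def)
qed

lemma a_split: "n \<in> I \<Longrightarrow> a k = p n * q n (k - 1) + (1 - p n) * q n k"
  by (rule pbin_remove[OF fin])

lemma q_lc: "q n (k - 1) * q n (k + 1) \<le> (q n k)\<^sup>2"
  by (rule pbin_log_concave) (use fin p01' in auto)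

text \<open>After splitting \<open>a\<close> over trial \<open>n\<close>, the difference of the two
  sides is \<open>p n\<close> times the log-concavity defect of the leave-one-out law.\<close>

lemma ratio_bound:
  assumes "n \<in> I"
  shows "q n k * a (k - 1) \<le> q n (k - 1) * a k"
proof -
  have "q n (k - 1) * a k - q n k * a (k - 1) = p n * ((q n (k - 1))\<^sup>2 - q n (k - 2) * q n k)"
    by (simp add: a_split[OF assms] algebra_simps power2_eq_square)
  moreover have "q n (k - 2) * q n k \<le> (q n (k - 1))\<^sup>2"
    using q_lc[of n "k - 1"] by simp
  ultimately have "0 \<le> q n (k - 1) * a k - q n k * a (k - 1)"
    using p01'[OF assms] by simp
  then show ?thesis by simp
qed

lemma a_zero: "k < 0 \<or> int (card I) < k \<Longrightarrow> a k = 0"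
proof -
  assume *: "k < 0 \<or> int (card I) < k"
  have "a k = ex (\<lambda>A. 0)" unfolding pbin_def
  proof (rule ber_ex_cong)
    fix A assume "A \<subseteq> I"
    then have "card A \<le> card I" using card_mono[OF fin] by blast
    then show "(of_bool (int (card A) = k) :: real) = 0" using * by auto
  qed
  then show ?thesis using fin by simp
qed

lemma a_pos: assumes "0 \<le> k" "k \<le> int (card I)" shows "0 < a k"
proof -
  have "nat k \<le> card I" using assms by simp
  then obtain B where B: "B \<subseteq> I" "card B = nat k"
    using obtain_subset_with_card_n by metis
  have wt: "0 < ber_wt p I B" unfolding ber_wt_def
    by (intro mult_pos_pos prod_pos) (use B p01 in auto)
  have "ber_wt p I B * of_bool (int (card B) = k) \<le> a k" unfolding pbin_def ber_ex_def
    by (rule member_le_sum) (use B fin ber_wt_nonneg[of I p] p01' in auto)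
  with wt B assms show ?thesis by simp
qed

lemma one_minus_var: "v \<le> real (card I) - \<mu>"
proof -
  have "v \<le> (\<Sum>n\<in>I. 1 - p n)" unfolding bvar_def
  proof (rule sum_mono)
    fix n assume "n \<in> I"
    then show "vn n \<le> 1 - p n" using mult_right_mono[of "p n" 1 "1 - p n"] p01'[of n] by simp
  qed
  then show ?thesis by (simp add: sum_subtractf bmu_def)
qed

text \<open>Stein's identity with leave-one-out differences replaced by those of \<open>a\<close>:
  beyond the mean the relative drop from one atom to the next is at most
  \<open>(k - \<mu>) / v\<close>, as for a Gaussian.\<close>

lemma decay_right: "v * (a (k - 1) - a k) \<le> max 0 (of_int k - \<mu>) * a (k - 1)"
proof (cases "a (k - 1) \<le> a k")
  case True
  then have "v * (a (k - 1) - a k) \<le> 0" by (intro mult_nonneg_nonpos v_nonneg) auto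
  also have "0 \<le> max 0 (of_int k - \<mu>) * a (k - 1)" by (intro mult_nonneg_nonneg a_nonneg) auto
  finally show ?thesis .
next
  case False
  show ?thesis
  proof (cases "a k = 0")
    case True
    \<comment> \<open>A drop to 0 occurs only just past the last atom, where
      \<open>one_minus_var\<close> supplies the bound.\<close>
    have "0 \<le> k - 1" "k - 1 \<le> int (card I)" using False True a_zero[of "k-1"] by force+
    then have "k = int (card I) + 1" using a_pos[of k] True by force
    then have "v \<le> of_int k - \<mu>" using one_minus_var by simp
    then show ?thesis using True a_nonneg[of "k-1"] by (simp add: mult_right_mono)
  next
    case ak: False
    then have ap: "0 < a k" using a_nonneg[of k] by linarith
    \<comment> \<open>On a descent \<open>a k\<close> is a convex combination of
      \<open>q n (k - 1)\<close> and a smaller number, so \<open>a k \<le> q n (k - 1)\<close>; then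
      \<open>ratio_bound\<close> compares the relative drops of \<open>a\<close> and
      \<open>q n\<close>.\<close>
    have xy: "(a (k - 1) - a k) * (vn n * a k) \<le> a (k - 1) * (vn n * (q n (k - 1) - q n k))" if n: "n \<in> I" for n
    proof -
      have r: "q n k * a (k - 1) \<le> q n (k - 1) * a k" by (rule ratio_bound[OF n])
      have "q n k * a k \<le> q n k * a (k - 1)"
        using False q_nonneg by (simp add: mult_left_mono)
      with r have "q n k * a k \<le> q n (k - 1) * a k" by linarith
      then have le: "q n k \<le> q n (k - 1)" using ap by simp
      have "a k \<le> q n (k - 1)" unfolding a_split[OF n, of k]
        using p01'[OF n] le by (intro convex_bound_le) auto
      then have "(a (k - 1) - a k) * a k \<le> (a (k - 1) - a k) * q n (k - 1)"
        using False by (intro mult_left_mono) auto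
      also have "\<dots> \<le> a (k - 1) * (q n (k - 1) - q n k)"
        using r by (simp add: algebra_simps)
      finally have "vn n * ((a (k - 1) - a k) * a k) \<le> vn n * (a (k - 1) * (q n (k - 1) - q n k))"
        using vn_pos[OF n] by (intro mult_left_mono) auto
      then show ?thesis by (simp add: mult_ac)
    qed
    have "(a (k - 1) - a k) * (v * a k) = (\<Sum>n\<in>I. (a (k - 1) - a k) * (vn n * a k))"
      by (simp add: bvar_def sum_distrib_left sum_distrib_right)
    also have "\<dots> \<le> (\<Sum>n\<in>I. a (k - 1) * (vn n * (q n (k - 1) - q n k)))"
      by (rule sum_mono) (rule xy)
    also have "\<dots> = a (k - 1) * ((of_int k - \<mu>) * a k)"
      by (simp add: stein_pbin sum_distrib_left)
    finally have "(v * (a (k - 1) - a k)) * a k \<le> ((of_int k - \<mu>) * a (k - 1)) * a k"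
      by (simp add: mult_ac)
    then have "v * (a (k - 1) - a k) \<le> (of_int k - \<mu>) * a (k - 1)"
      using ap by (simp only: mult_le_cancel_right_pos)
    also have "\<dots> \<le> max 0 (of_int k - \<mu>) * a (k - 1)"
      using a_nonneg by (intro mult_right_mono) auto
    finally show ?thesis .
  qed
qed

end

section \<open>Reflection of successes into failures, and bounds for the largest atom\<close>

lemma pbin_compl:
  assumes "finite I"
  shows "pbin (\<lambda>n. 1 - p n) I k = pbin p I (int (card I) - k)"
  unfolding pbin_def ber_ex_compl[OF assms]
proof (rule ber_ex_cong)
  fix A assume A: "A \<subseteq> I"
  have "card (I - A) = card I - card A" "card A \<le> card I"
    using A assms card_Diff_subset finite_subset card_mono by metis+
  then show "(of_bool (int (card (I - A)) = k) :: real) = of_bool (int (card A) = int (card I) - k)"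
    by auto
qed

context bernoulli_family begin

lemma compl_family: "bernoulli_family I (\<lambda>n. 1 - p n)"
  by unfold_locales (use fin p01 in auto)

lemma compl_var: "bvar (\<lambda>n. 1 - p n) I = v"
  by (simp add: bvar_def mult.commute)

lemma compl_mu: "bmu (\<lambda>n. 1 - p n) I = real (card I) - \<mu>"
  by (simp add: bmu_def sum_subtractf)

lemma decay_left: "v * (a k - a (k - 1)) \<le> max 0 (\<mu> - of_int k + 1) * a k"
  using bernoulli_family.decay_right[OF compl_family, of "int (card I) - k + 1"]
  by (simp add: pbin_compl[OF fin] compl_var compl_mu algebra_simps)

lemma sum_pbin_ex:
  "(\<Sum>k\<in>{0..int (card I)}. a k * g k) = ex (\<lambda>A. g (int (card A)))"
proof -
  have "(\<Sum>k\<in>{0..int (card I)}. a k * g k)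
    = ex (\<lambda>A. \<Sum>k\<in>{0..int (card I)}. of_bool (int (card A) = k) * g k)"
    unfolding ber_ex_sum pbin_def by (simp add: ber_ex_mult_right)
  also have "\<dots> = ex (\<lambda>A. g (int (card A)))"
  proof (rule ber_ex_cong)
    fix A assume "A \<subseteq> I"
    then have "card A \<le> card I" using fin card_mono by auto
    then show "(\<Sum>k\<in>{0..int (card I)}. of_bool (int (card A) = k) * g k) = g (int (card A))"
      by (subst sum.remove[of _ "int (card A)"]) auto
  qed
  finally show ?thesis .
qed

lemma ex_max_pbin: obtains M where "\<And>k. a k \<le> a M" "0 < a M"
proof -
  have "\<exists>M\<in>{0..int (card I)}. \<forall>k\<in>{0..int (card I)}. a k \<le> a M"
    using Max_in[of "a ` {0..int (card I)}"] Max_ge[of "a ` {0..int (card I)}"] by fastforce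
  then obtain M where M: "M \<in> {0..int (card I)}" "\<forall>k\<in>{0..int (card I)}. a k \<le> a M" by blast
  have p: "0 < a M" using M a_pos by auto
  have "a k \<le> a M" for k
    using M p a_zero[of k] by (cases "k \<in> {0..int (card I)}") (auto simp: not_le)
  with p that show ?thesis by blast
qed

end

text \<open>Antiderivative, vanishing at 0, of the positive part of
  \<open>c\<^sup>2 - x\<^sup>2\<close>.\<close>

definition bump_int :: "real \<Rightarrow> real \<Rightarrow> real" where
  "bump_int c x = (let y = max (- c) (min c x) in c\<^sup>2 * y - y ^ 3 / 3)"

lemma bump_int_bounds:
  assumes "0 \<le> c"
  shows "bump_int c x \<le> 2 * c ^ 3 / 3" "- (2 * c ^ 3 / 3) \<le> bump_int c x"
proof -
  define y where "y = max (- c) (min c x)"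
  have y: "-c \<le> y" "y \<le> c" using assms by (auto simp: y_def)
  have "0 \<le> (c - y)\<^sup>2 * (2 * c + y)" using y assms by (intro mult_nonneg_nonneg) auto
  then have 1: "c\<^sup>2 * y - y ^ 3 / 3 \<le> 2 * c ^ 3 / 3" by (simp add: algebra_simps power2_eq_square power3_eq_cube)
  have "0 \<le> (c + y)\<^sup>2 * (2 * c - y)" using y assms by (intro mult_nonneg_nonneg) auto
  then have 2: "- (2 * c ^ 3 / 3) \<le> c\<^sup>2 * y - y ^ 3 / 3" by (simp add: algebra_simps power2_eq_square power3_eq_cube)
  show "bump_int c x \<le> 2 * c ^ 3 / 3" "- (2 * c ^ 3 / 3) \<le> bump_int c x"
    using 1 2 by (simp_all add: bump_int_def Let_def y_def[symmetric])
qed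

lemma bump_int_mono:
  assumes "0 \<le> c" "x \<le> x'"
  shows "bump_int c x \<le> bump_int c x'"
proof -
  define y where "y = max (- c) (min c x)"
  define y' where "y' = max (- c) (min c x')"
  have y: "-c \<le> y" "y \<le> y'" "y' \<le> c" using assms by (auto simp: y_def y'_def)
  have "y\<^sup>2 \<le> c\<^sup>2" "y'\<^sup>2 \<le> c\<^sup>2" using y by (auto simp: abs_le_square_iff[symmetric])
  moreover have "2 * (y * y') \<le> y\<^sup>2 + y'\<^sup>2" using sum_squares_bound[of y y'] by simp
  ultimately have "0 \<le> (y' - y) * (3 * c\<^sup>2 - (y\<^sup>2 + y * y' + y'\<^sup>2))" using y by (intro mult_nonneg_nonneg) auto
  then have "c\<^sup>2 * y - y ^ 3 / 3 \<le> c\<^sup>2 * y' - y' ^ 3 / 3"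
    by (simp add: algebra_simps power2_eq_square power3_eq_cube)
  then show ?thesis by (simp add: bump_int_def Let_def y_def y'_def)
qed

text \<open>Integrated form of \<open>u \<le> max 0 u\<close> for
  \<open>u = c\<^sup>2 - x\<^sup>2\<close>. Outside \<open>[-c, c]\<close> the gap \<open>g\<close>
  is a square times a linear factor of constant sign, so its monotonicity is read off without
  differentiation.\<close>

lemma bump_int_minus_mono:
  assumes "0 \<le> c" "x \<le> x'"
  shows "c\<^sup>2 * x' - x' ^ 3 / 3 - (c\<^sup>2 * x - x ^ 3 / 3) \<le> bump_int c x' - bump_int c x"
proof -
  define g where "g = (\<lambda>x. bump_int c x - (c\<^sup>2 * x - x ^ 3 / 3))"
  have mid: "g x = 0" if "-c \<le> x" "x \<le> c" for x using that by (simp add: g_def bump_int_def Let_def)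
  have hi: "g x = (x - c)\<^sup>2 * (x + 2 * c) / 3" if "c \<le> x" for x
  proof -
    have "g x = c\<^sup>2 * c - c ^ 3 / 3 - (c\<^sup>2 * x - x ^ 3 / 3)"
      using that assms by (simp add: g_def bump_int_def Let_def)
    then show ?thesis by (simp add: field_simps power2_eq_square power3_eq_cube)
  qed
  have lo: "g x = - ((x + c)\<^sup>2 * (2 * c - x) / 3)" if "x \<le> - c" for x
  proof -
    have "g x = c\<^sup>2 * (- c) - (- c) ^ 3 / 3 - (c\<^sup>2 * x - x ^ 3 / 3)"
      using that assms by (simp add: g_def bump_int_def Let_def)
    then show ?thesis by (simp add: field_simps power2_eq_square power3_eq_cube)
  qed
  have him: "g x \<le> g x'" if "c \<le> x" "x \<le> x'" for x x'
    using that assms unfolding hi[OF that(1)] hi[OF order_trans[OF that]]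
    by (intro divide_right_mono mult_mono power_mono) auto
  have lom: "g x \<le> g x'" if "x' \<le> - c" "x \<le> x'" for x x'
  proof -
    have "(x' + c)\<^sup>2 \<le> (x + c)\<^sup>2" using that by (subst abs_le_square_iff[symmetric]) simp
    then have "(x' + c)\<^sup>2 * (2 * c - x') \<le> (x + c)\<^sup>2 * (2 * c - x)"
      using that assms by (intro mult_mono) auto
    then show ?thesis using lo[OF that(1)] lo[of x] that by simp
  qed
  have mono: "g x \<le> g x'"
  proof -
    have c1: "g x \<le> g (max (-c) (min c x))" if "x \<le> c" 
    proof -
      have "max (-c) (min c x) = (if x \<le> -c then -c else x)" using that assms by auto
      then show ?thesis using lom[of "-c" x] by simp
    qed
    have c2: "g (max (-c) (min c x')) \<le> g x'" if "-c \<le> x'"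
    proof -
      have "max (-c) (min c x') = (if c \<le> x' then c else x')" using that assms by auto
      then show ?thesis using him[of c x'] by simp
    qed
    consider "c \<le> x" | "x' \<le> -c" | "x \<le> c" "-c \<le> x'" using assms by linarith
    then show ?thesis
    proof cases
      case 1 then show ?thesis using him assms by blast
    next
      case 2 then show ?thesis using lom assms by blast
    next
      case 3
      have "g (max (-c) (min c x)) = 0" "g (max (-c) (min c x')) = 0" using assms by (auto intro!: mid)
      then show ?thesis using c1 c2 3 by simp
    qed
  qed
  then show ?thesis by (simp add: g_def)
qed

context bernoulli_family begin

text \<open>Spread each atom uniformly over a unit interval: among densities bounded by \<open>h\<close> the uniform one has least variance.\<close>

lemma max_atom_lower:
  assumes h: "\<And>k. a k \<le> h" "0 < h"
  shows "1 \<le> h\<^sup>2 * (1 + 12 * v)"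
proof -
  \<comment> \<open>Half-width of the uniform density of height \<open>h\<close>.\<close>
  define c where "c = 1 / (2 * h)"
  have c: "0 < c" "h * c = 1 / 2" using h by (simp_all add: c_def)
  define \<Phi> where "\<Phi> = bump_int c"
  define N where "N = card I"
  \<comment> \<open>The left factor is the integral of \<open>c\<^sup>2 - x\<^sup>2\<close> over the
    unit cell around \<open>k - \<mu>\<close>; 1/12 is the variance of the uniform law on that cell.
    The positive part allows \<open>a k\<close> to be replaced by \<open>h\<close>, and the right
    sides telescope.\<close>
  have cell: "a k * (c\<^sup>2 - 1 / 12 - (of_int k - \<mu>)\<^sup>2) \<le> h * (\<Phi> (of_int k - \<mu> + 1 / 2) - \<Phi> (of_int k - \<mu> - 1 / 2))" for k
  proof -
    define x where "x = of_int k - \<mu>"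
    have "c\<^sup>2 * (x + 1/2) - (x + 1/2) ^ 3 / 3 - (c\<^sup>2 * (x - 1/2) - (x - 1/2) ^ 3 / 3) = c\<^sup>2 - 1 / 12 - x\<^sup>2"
      by (simp add: field_simps power2_eq_square power3_eq_cube)
    then have "c\<^sup>2 - 1 / 12 - x\<^sup>2 \<le> \<Phi> (x + 1/2) - \<Phi> (x - 1/2)"
      using bump_int_minus_mono[of c "x - 1/2" "x + 1/2"] c by (simp add: \<Phi>_def)
    then have "a k * (c\<^sup>2 - 1 / 12 - x\<^sup>2) \<le> a k * (\<Phi> (x + 1/2) - \<Phi> (x - 1/2))"
      using a_nonneg by (intro mult_left_mono)
    also have "\<dots> \<le> h * (\<Phi> (x + 1/2) - \<Phi> (x - 1/2))"
      using h c bump_int_mono[of c "x - 1/2" "x + 1/2"] by (intro mult_right_mono) (auto simp: \<Phi>_def)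
    finally show ?thesis by (simp add: x_def)
  qed
  have tele: "(\<Sum>k\<in>{0..int n}. \<Phi> (of_int k - \<mu> + 1 / 2) - \<Phi> (of_int k - \<mu> - 1 / 2))
     = \<Phi> (real n - \<mu> + 1 / 2) - \<Phi> (- \<mu> - 1 / 2)" for n
  proof (induction n)
    case (Suc n)
    have "{0..int (Suc n)} = insert (int (Suc n)) {0..int n}" by auto
    then show ?case using Suc by (simp add: algebra_simps)
  qed simp
  have "c\<^sup>2 - 1 / 12 - v = ex (\<lambda>A. (c\<^sup>2 - 1 / 12) - (real (card A) - \<mu>)\<^sup>2)"
    using fin by (simp add: ber_ex_diff ex_card_var)
  also have "\<dots> = (\<Sum>k\<in>{0..int N}. a k * (c\<^sup>2 - 1 / 12 - (of_int k - \<mu>)\<^sup>2))"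
    unfolding N_def sum_pbin_ex by simp
  also have "\<dots> \<le> (\<Sum>k\<in>{0..int N}. h * (\<Phi> (of_int k - \<mu> + 1 / 2) - \<Phi> (of_int k - \<mu> - 1 / 2)))"
    by (rule sum_mono) (rule cell)
  also have "\<dots> = h * (\<Phi> (real N - \<mu> + 1 / 2) - \<Phi> (- \<mu> - 1 / 2))"
    by (simp only: sum_distrib_left[symmetric] tele)
  also have "\<dots> \<le> h * (4 * c ^ 3 / 3)"
    using bump_int_bounds(1)[of c "real N - \<mu> + 1 / 2"] bump_int_bounds(2)[of c "- \<mu> - 1 / 2"] h c
    by (intro mult_left_mono) (auto simp: \<Phi>_def)
  also have "\<dots> = (h * c) * (4 * c\<^sup>2 / 3)" by (simp add: power3_eq_cube power2_eq_square)
  also have "\<dots> = 2 * c\<^sup>2 / 3" unfolding c(2) by simp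
  finally have "4 * c\<^sup>2 \<le> 12 * v + 1" by simp
  then have "h\<^sup>2 * (4 * c\<^sup>2) \<le> h\<^sup>2 * (1 + 12 * v)" by (intro mult_left_mono) auto
  moreover have "h\<^sup>2 * (4 * c\<^sup>2) = (2 * (h * c))\<^sup>2" by (simp add: power_mult_distrib)
  moreover have "2 * (h * c) = 1" using c(2) by linarith
  ultimately show ?thesis by simp
qed

text \<open>\<open>l\<close> is the loss accumulated since the mode, in units of
  \<open>h / v\<close>. Each further loss is estimated relative to \<open>h\<close> rather than to
  the current atom, so that losses add instead of multiplying.\<close>

lemma step_right:
  assumes "0 < v" "\<And>k. a k \<le> h" "h * (1 - l / v) \<le> a (k - 1)" "\<mu> \<le> of_int k"
  shows "h * (1 - (l + (of_int k - \<mu>)) / v) \<le> a k"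
proof -
  have "v * a (k - 1) \<le> v * a k + (of_int k - \<mu>) * a (k - 1)"
    using decay_right[of k] assms(4) by (simp add: algebra_simps)
  also have "(of_int k - \<mu>) * a (k - 1) \<le> (of_int k - \<mu>) * h"
    using assms by (intro mult_left_mono) auto
  finally have 1: "a (k - 1) \<le> a k + (of_int k - \<mu>) * h / v"
    using assms(1) by (simp add: field_simps)
  have 2: "h * (1 - (l + (of_int k - \<mu>)) / v) = h * (1 - l / v) - (of_int k - \<mu>) * h / v"
    using assms(1) by (simp add: field_simps)
  show ?thesis unfolding 2 diff_le_eq by (rule order_trans[OF assms(3) 1])
qed

lemma step_left:
  assumes "0 < v" "\<And>k. a k \<le> h" "h * (1 - l / v) \<le> a k" "of_int k - 1 \<le> \<mu>"
  shows "h * (1 - (l + (\<mu> - of_int k + 1)) / v) \<le> a (k - 1)"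
proof -
  have "v * a k \<le> v * a (k - 1) + (\<mu> - of_int k + 1) * a k"
    using decay_left[of k] assms(4) by (simp add: algebra_simps)
  also have "(\<mu> - of_int k + 1) * a k \<le> (\<mu> - of_int k + 1) * h"
    using assms by (intro mult_left_mono) auto
  finally have 1: "a k \<le> a (k - 1) + (\<mu> - of_int k + 1) * h / v"
    using assms(1) by (simp add: field_simps)
  have 2: "h * (1 - (l + (\<mu> - of_int k + 1)) / v) = h * (1 - l / v) - (\<mu> - of_int k + 1) * h / v"
    using assms(1) by (simp add: field_simps)
  show ?thesis unfolding 2 diff_le_eq by (rule order_trans[OF assms(3) 1])
qed

lemma decreasing_right: assumes "0 < v" "\<mu> \<le> of_int k" "k \<le> l" shows "a l \<le> a k"
  using assms(3)
proof (induction l rule: int_ge_induct)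
  case (step l)
  have "v * (a (l + 1) - a l) \<le> 0"
  proof -
    have "max 0 (\<mu> - of_int (l + 1) + 1) = 0" using assms(2) step.hyps by linarith
    then show ?thesis using decay_left[of "l + 1"] by simp
  qed
  then have "a (l + 1) \<le> a l" using assms(1) by (simp add: mult_le_0_iff)
  with step show ?case by linarith
qed simp

lemma increasing_left: assumes "0 < v" "of_int k \<le> \<mu>" "l \<le> k" shows "a l \<le> a k"
  using assms(3)
proof (induction l rule: int_le_induct)
  case (step l)
  have "v * (a (l - 1) - a l) \<le> 0"
  proof -
    have "max 0 (of_int l - \<mu>) = 0" using assms(2) step.hyps by linarith
    then show ?thesis using decay_right[of l] by simp
  qed
  then have "a (l - 1) \<le> a l" using assms(1) by (simp add: mult_le_0_iff)
  with step show ?case by linarith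
qed simp

text \<open>The loss is the sum of the distances \<open>j - frac \<mu>\<close> for j = 1, ..., i.
  For the base case, a mode at or left of the floor makes the floor atom maximal, and one step
  follows; a mode to its right makes the next atom maximal.\<close>

lemma near_mode_right:
  assumes "0 < v" "\<And>k. a k \<le> a M" "i \<ge> 1"
  shows "a M * (1 - (real i * (real i + 1) / 2 - real i * frac \<mu>) / v) \<le> a (\<lfloor>\<mu>\<rfloor> + int i)"
  using assms(3)
proof (induction i rule: nat_induct_at_least)
  case base
  show ?case
  proof (cases "M \<le> \<lfloor>\<mu>\<rfloor>")
    case True
    have "a M \<le> a \<lfloor>\<mu>\<rfloor>" using increasing_left[OF assms(1) _ True] by simp
    then have "a M * (1 - 0 / v) \<le> a (\<lfloor>\<mu>\<rfloor> + 1 - 1)" by simp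
    moreover have "\<mu> \<le> of_int (\<lfloor>\<mu>\<rfloor> + 1)" by linarith
    ultimately have "a M * (1 - (0 + (of_int (\<lfloor>\<mu>\<rfloor> + 1) - \<mu>)) / v) \<le> a (\<lfloor>\<mu>\<rfloor> + 1)"
      by (rule step_right[OF assms(1,2)])
    then show ?thesis by (simp add: frac_def algebra_simps)
  next
    case False
    then have "a M \<le> a (\<lfloor>\<mu>\<rfloor> + 1)" by (intro decreasing_right[OF assms(1)]) linarith+
    moreover have "a M * (1 - (1 - frac \<mu>) / v) \<le> a M * 1"
      using assms(1) frac_lt_1[of \<mu>] a_nonneg[of M] by (intro mult_left_mono) auto
    ultimately show ?thesis by (simp add: algebra_simps)
  qed
next
  case (Suc i)
  have "a M * (1 - (real i * (real i + 1) / 2 - real i * frac \<mu>) / v) \<le> a (\<lfloor>\<mu>\<rfloor> + int (Suc i) - 1)"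
    using Suc.IH by simp
  moreover have "\<mu> \<le> of_int (\<lfloor>\<mu>\<rfloor> + int (Suc i))" by linarith
  ultimately have "a M * (1 - (real i * (real i + 1) / 2 - real i * frac \<mu> + (of_int (\<lfloor>\<mu>\<rfloor> + int (Suc i)) - \<mu>)) / v)
    \<le> a (\<lfloor>\<mu>\<rfloor> + int (Suc i))" by (rule step_right[OF assms(1,2)])
  moreover have "real i * (real i + 1) / 2 - real i * frac \<mu> + (of_int (\<lfloor>\<mu>\<rfloor> + int (Suc i)) - \<mu>)
    = real (Suc i) * (real (Suc i) + 1) / 2 - real (Suc i) * frac \<mu>"
    by (simp add: frac_def field_simps)
  ultimately show ?case by metis
qed

text \<open>Here the distances \<open>j + frac \<mu>\<close> for j = 0, ..., i are summed; their
  fractional parts cancel against those on the right in \<open>window_mass\<close>.\<close>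

lemma near_mode_left:
  assumes "0 < v" "\<And>k. a k \<le> a M"
  shows "a M * (1 - (real i * (real i + 1) / 2 + (real i + 1) * frac \<mu>) / v) \<le> a (\<lfloor>\<mu>\<rfloor> - int i)"
proof (induction i)
  case 0
  show ?case
  proof (cases "M \<le> \<lfloor>\<mu>\<rfloor>")
    case True
    have "a M \<le> a \<lfloor>\<mu>\<rfloor>" using increasing_left[OF assms(1) _ True] by simp
    moreover have "a M * (1 - frac \<mu> / v) \<le> a M * 1"
      using assms(1) frac_ge_0[of \<mu>] a_nonneg[of M] by (intro mult_left_mono) auto
    ultimately show ?thesis by simp
  next
    case False
    then have "a M \<le> a (\<lfloor>\<mu>\<rfloor> + 1)" by (intro decreasing_right[OF assms(1)]) linarith+
    then have "a M * (1 - 0 / v) \<le> a (\<lfloor>\<mu>\<rfloor> + 1)" by simp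
    from step_left[OF assms(1,2) this] show ?thesis by (simp add: frac_def)
  qed
next
  case (Suc i)
  have "of_int (\<lfloor>\<mu>\<rfloor> - int i) - 1 \<le> \<mu>" by linarith
  from step_left[OF assms(1,2) Suc.IH this]
  have "a M * (1 - (real i * (real i + 1) / 2 + (real i + 1) * frac \<mu> + (\<mu> - of_int (\<lfloor>\<mu>\<rfloor> - int i) + 1)) / v)
    \<le> a (\<lfloor>\<mu>\<rfloor> - int (Suc i))" by (simp add: diff_diff_eq add.commute[of _ 1])
  moreover have "real i * (real i + 1) / 2 + (real i + 1) * frac \<mu> + (\<mu> - of_int (\<lfloor>\<mu>\<rfloor> - int i) + 1)
    = real (Suc i) * (real (Suc i) + 1) / 2 + (real (Suc i) + 1) * frac \<mu>"
    by (simp add: frac_def field_simps)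
  ultimately show ?case by metis
qed

section \<open>Second moments on a level set of the number of successes\<close>

text \<open>Neither this nor \<open>atom_cov\<close> is divided by \<open>a m\<close>, and both are
  centred at the unconditional \<open>p n\<close>. Hence the conditional covariance is \<open>(a m *
  atom_cov m n j - atom_mean m n * atom_mean m j) / (a m)\<^sup>2\<close>.\<close>

definition atom_mean :: "int \<Rightarrow> 'a \<Rightarrow> real" where
  "atom_mean m n = ex (\<lambda>A. (ind A n - p n) * of_bool (int (card A) = m))"

definition atom_cov :: "int \<Rightarrow> 'a \<Rightarrow> 'a \<Rightarrow> real" where
  "atom_cov m n j = ex (\<lambda>A. (ind A n - p n) * ((ind A j - p j) * of_bool (int (card A) = m)))"

definition centred_sum :: "('a \<Rightarrow> real) \<Rightarrow> 'a set \<Rightarrow> real" where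
  "centred_sum y A = (\<Sum>n\<in>I. (ind A n - p n) * y n)"

lemma ex_center:
  "n \<in> I \<Longrightarrow> ex (\<lambda>A. (ind A n - p n) * F A)
     = vn n * (ber_ex p (I - {n}) (\<lambda>A. F (insert n A)) - ber_ex p (I - {n}) F)"
  by (rule ber_ex_center[OF fin])

lemma pbin_shift:
  assumes "n \<in> I"
  shows "ber_ex p (I - {n}) (\<lambda>A. of_bool (int (card (insert n A)) = m)) = q n (m - 1)"
  unfolding pbin_def by (rule ber_ex_cong) (auto simp: card_insert_sub)

lemma atom_mean_eq: "n \<in> I \<Longrightarrow> atom_mean m n = vn n * (q n (m - 1) - q n m)"
  unfolding atom_mean_def by (simp add: ex_center pbin_shift) (simp add: pbin_def)

lemma sum_atom_mean: "(\<Sum>n\<in>I. atom_mean m n) = (of_int m - \<mu>) * a m"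
  by (simp add: stein_pbin atom_mean_eq)

lemma sum_atom_cov: assumes "n \<in> I" shows "(\<Sum>j\<in>I. atom_cov m n j) = (of_int m - \<mu>) * atom_mean m n"
proof -
  have "(\<Sum>j\<in>I. atom_cov m n j) = ex (\<lambda>A. \<Sum>j\<in>I. (ind A n - p n) * ((ind A j - p j) * of_bool (int (card A) = m)))"
    unfolding atom_cov_def ber_ex_sum ..
  also have "\<dots> = ex (\<lambda>A. (of_int m - \<mu>) * ((ind A n - p n) * of_bool (int (card A) = m)))"
  proof (rule ber_ex_cong)
    fix A assume A: "A \<subseteq> I"
    have "(\<Sum>j\<in>I. (ind A n - p n) * ((ind A j - p j) * of_bool (int (card A) = m)))
      = (ind A n - p n) * (of_bool (int (card A) = m) * (\<Sum>j\<in>I. ind A j - p j))"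
      by (simp add: sum_distrib_left mult_ac)
    also have "\<dots> = (of_int m - \<mu>) * ((ind A n - p n) * of_bool (int (card A) = m))"
      unfolding card_W[OF A] by auto
    finally show "(\<Sum>j\<in>I. (ind A n - p n) * ((ind A j - p j) * of_bool (int (card A) = m)))
      = (of_int m - \<mu>) * ((ind A n - p n) * of_bool (int (card A) = m))" .
  qed
  also have "\<dots> = (of_int m - \<mu>) * atom_mean m n" unfolding atom_mean_def ber_ex_cmult ..
  finally show ?thesis .
qed

lemma atom_cov_diag: assumes "n \<in> I" shows "atom_cov m n n = vn n * ((1 - p n) * q n (m - 1) + p n * q n m)"
proof -
  have 1: "ber_ex p (I - {n}) (\<lambda>A. (ind (insert n A) n - p n) * of_bool (int (card (insert n A)) = m))
    = (1 - p n) * q n (m - 1)"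
    using pbin_shift[OF assms, of m] by (simp add: ind_def ber_ex_cmult)
  have 2: "ber_ex p (I - {n}) (\<lambda>A. (ind A n - p n) * of_bool (int (card A) = m)) = - p n * q n m"
    unfolding pbin_def ber_ex_cmult[symmetric] by (rule ber_ex_cong) (auto simp: ind_def)
  show ?thesis unfolding atom_cov_def ex_center[OF assms] 1 2 by simp
qed

text \<open>Everything about a pair of trials is expressed by three neighbouring atoms of the law
  \<open>Q\<close> of the remaining trials; comparing two trials becomes algebra plus log-concavity
  of \<open>Q\<close>.\<close>

lemma atom_cov_off:
  assumes "n \<in> I" "j \<in> I" "n \<noteq> j"
  defines "Q \<equiv> pbin p (I - {n} - {j})"
  shows "atom_cov m n j = vn n * vn j * (Q (m - 2) - 2 * Q (m - 1) + Q m)"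
    and "atom_mean m n = vn n * (p j * Q (m - 2) + (1 - p j) * Q (m - 1) - (p j * Q (m - 1) + (1 - p j) * Q m))"
    and "atom_mean m j = vn j * (p n * Q (m - 2) + (1 - p n) * Q (m - 1) - (p n * Q (m - 1) + (1 - p n) * Q m))"
    and "a m = p n * (p j * Q (m - 2) + (1 - p j) * Q (m - 1)) + (1 - p n) * (p j * Q (m - 1) + (1 - p j) * Q m)"
proof -
  have qn: "q n k = p j * Q (k - 1) + (1 - p j) * Q k" for k
    unfolding Q_def by (rule pbin_remove) (use assms fin in auto)
  have sw: "I - {n} - {j} = I - {j} - {n}" by auto
  have qj: "q j k = p n * Q (k - 1) + (1 - p n) * Q k" for k
    unfolding Q_def sw by (rule pbin_remove) (use assms fin in auto)
  show "atom_mean m n = vn n * (p j * Q (m - 2) + (1 - p j) * Q (m - 1) - (p j * Q (m - 1) + (1 - p j) * Q m))"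
    using assms by (simp add: atom_mean_eq qn)
  show "atom_mean m j = vn j * (p n * Q (m - 2) + (1 - p n) * Q (m - 1) - (p n * Q (m - 1) + (1 - p n) * Q m))"
    using assms by (simp add: atom_mean_eq qj)
  show "a m = p n * (p j * Q (m - 2) + (1 - p j) * Q (m - 1)) + (1 - p n) * (p j * Q (m - 1) + (1 - p j) * Q m)"
    using assms by (simp add: a_split qn)
  interpret N: bernoulli_family "I - {n}" p by (rule sub_family)
  have jn: "j \<in> I - {n}" using assms by auto
  have zj: "ind (insert n A) j = ind A j" for A using assms by (simp add: ind_def)
  have 1: "ber_ex p (I - {n}) (\<lambda>A. (ind (insert n A) j - p j) * of_bool (int (card (insert n A)) = m))
    = N.atom_mean (m - 1) j"
    unfolding N.atom_mean_def zj by (rule ber_ex_cong) (auto simp: card_insert_sub)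
  have 2: "ber_ex p (I - {n}) (\<lambda>A. (ind A j - p j) * of_bool (int (card A) = m)) = N.atom_mean m j"
    unfolding N.atom_mean_def ..
  show "atom_cov m n j = vn n * vn j * (Q (m - 2) - 2 * Q (m - 1) + Q m)"
    unfolding atom_cov_def ex_center[OF assms(1)] 1 2
    by (simp add: N.atom_mean_eq[OF jn] Q_def[symmetric] algebra_simps)
qed

text \<open>The gap is exactly \<open>vn n * vn j * ((Q (m - 1))\<^sup>2 - Q (m - 2) * Q m)\<close>,
  with \<open>Q\<close> the law of the remaining trials.\<close>

lemma neg_corr:
  assumes "n \<in> I" "j \<in> I" "n \<noteq> j"
  shows "a m * atom_cov m n j \<le> atom_mean m n * atom_mean m j"
proof -
  define Q where "Q = pbin p (I - {n} - {j})"
  note off = atom_cov_off[OF assms, of m, folded Q_def]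
  have "Q (m - 1 - 1) * Q (m - 1 + 1) \<le> (Q (m - 1))\<^sup>2"
    unfolding Q_def by (rule pbin_log_concave) (use fin p01' in auto)
  then have "0 \<le> vn n * vn j * ((Q (m - 1))\<^sup>2 - Q (m - 2) * Q m)"
    using p01'[OF assms(1)] p01'[OF assms(2)] by (intro mult_nonneg_nonneg) auto
  also have "\<dots> = atom_mean m n * atom_mean m j - a m * atom_cov m n j"
    unfolding off by (simp add: algebra_simps power2_eq_square)
  finally show ?thesis by simp
qed

text \<open>Written through \<open>Q\<close>, both means have the same form with \<open>p n\<close>
  and \<open>p j\<close> interchanged, so the difference collapses to a second difference of
  \<open>Q\<close>, which is the mixed moment.\<close>

lemma atom_mean_exchange:
  assumes "n \<in> I" "j \<in> I" "n \<noteq> j"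
  shows "vn j * atom_mean m n - vn n * atom_mean m j = - (p n - p j) * atom_cov m n j"
proof -
  define Q where "Q = pbin p (I - {n} - {j})"
  note off = atom_cov_off[OF assms, of m, folded Q_def]
  show ?thesis unfolding off by (simp add: algebra_simps)
qed

text \<open>Conditionally on the atom, the mean of trial \<open>n\<close> moves by
  \<open>vn n * del m n\<close> and its variance becomes \<open>vn n * kap m n\<close>; see
  \<open>q_del\<close>.\<close>

definition del :: "int \<Rightarrow> 'a \<Rightarrow> real" where "del m n = (q n (m - 1) - q n m) / a m"
definition kap :: "int \<Rightarrow> 'a \<Rightarrow> real" where
  "kap m n = 1 + (1 - 2 * p n) * del m n - vn n * (del m n)\<^sup>2"

lemma q_del:
  assumes "n \<in> I" "0 < a m"
  shows "q n (m - 1) = a m * (1 + (1 - p n) * del m n)" "q n m = a m * (1 - p n * del m n)"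
    "atom_mean m n = a m * vn n * del m n" "a m * atom_cov m n n - (atom_mean m n)\<^sup>2 = (a m)\<^sup>2 * vn n * kap m n"
proof -
  have d: "a m * del m n = q n (m - 1) - q n m" using assms by (simp add: del_def)
  show 1: "q n (m - 1) = a m * (1 + (1 - p n) * del m n)" "q n m = a m * (1 - p n * del m n)"
  proof -
    have "q n (m - 1) = a m + (1 - p n) * (q n (m - 1) - q n m)" "q n m = a m - p n * (q n (m - 1) - q n m)"
      using a_split[OF assms(1), of m] by (simp_all add: algebra_simps)
    then show "q n (m - 1) = a m * (1 + (1 - p n) * del m n)" "q n m = a m * (1 - p n * del m n)"
      unfolding d[symmetric] by (simp_all add: algebra_simps)
  qed
  show b: "atom_mean m n = a m * vn n * del m n" using d assms by (simp add: atom_mean_eq mult_ac)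
  show "a m * atom_cov m n n - (atom_mean m n)\<^sup>2 = (a m)\<^sup>2 * vn n * kap m n"
    unfolding b atom_cov_diag[OF assms(1)] 1 kap_def by (simp add: algebra_simps power2_eq_square)
qed

lemma sum_del: assumes "0 < a m" shows "(\<Sum>n\<in>I. vn n * del m n) = of_int m - \<mu>"
proof -
  have "a m * (\<Sum>n\<in>I. vn n * del m n) = (\<Sum>n\<in>I. atom_mean m n)"
    unfolding sum_distrib_left by (rule sum.cong) (use q_del(3) assms in \<open>auto simp: mult_ac\<close>)
  then show ?thesis using assms sum_atom_mean[of m] by simp
qed

text \<open>Off-diagonal conditional covariances are nonpositive and rows sum to zero, so Gershgorin's
  circle theorem bounds the conditional quadratic form by twice its diagonal.\<close>

lemma second_moment:
  assumes "0 < a m" and k: "\<And>n. n \<in> I \<Longrightarrow> kap m n \<le> k"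
    and s: "(\<Sum>n\<in>I. vn n * (del m n)\<^sup>2) \<le> s"
  shows "ex (\<lambda>A. (centred_sum y A)\<^sup>2 * of_bool (int (card A) = m)) \<le> (2 * k + s) * (\<Sum>n\<in>I. vn n * (y n)\<^sup>2) * a m"
proof -
  define V where "V = (\<Sum>n\<in>I. vn n * (y n)\<^sup>2)"
  have V: "0 \<le> V" unfolding V_def by (intro sum_nonneg mult_nonneg_nonneg) (use p01' in auto)
  define X where "X = ex (\<lambda>A. (centred_sum y A)\<^sup>2 * of_bool (int (card A) = m))"
  have X: "X = (\<Sum>n\<in>I. \<Sum>j\<in>I. y n * y j * atom_cov m n j)"
  proof -
    have "X = ex (\<lambda>A. \<Sum>n\<in>I. \<Sum>j\<in>I. y n * y j * ((ind A n - p n) * ((ind A j - p j) * of_bool (int (card A) = m))))"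
      unfolding X_def
    proof (rule ber_ex_cong)
      fix A assume "A \<subseteq> I"
      show "(centred_sum y A)\<^sup>2 * of_bool (int (card A) = m)
        = (\<Sum>n\<in>I. \<Sum>j\<in>I. y n * y j * ((ind A n - p n) * ((ind A j - p j) * of_bool (int (card A) = m))))"
        unfolding centred_sum_def power2_eq_square unfolding sum_product unfolding sum_distrib_right
        by (intro sum.cong refl) (simp add: mult_ac)
    qed
    then show ?thesis unfolding atom_cov_def by (simp add: ber_ex_sum ber_ex_cmult)
  qed
  \<comment> \<open>Negated conditional covariance times \<open>(a m)\<^sup>2\<close>. The number of
    successes is fixed on the atom, so each full row sums to zero and the off-diagonal entries add
    up to the diagonal variance.\<close>
  define c where "c = (\<lambda>n j. atom_mean m n * atom_mean m j - a m * atom_cov m n j)"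
  have c_nonneg: "0 \<le> c n j" if "n \<in> I" "j \<in> I" "n \<noteq> j" for n j
    using neg_corr[OF that, of m] by (simp add: c_def)
  have c_sym: "c n j = c j n" for n j by (simp add: c_def atom_cov_def mult_ac)
  have c_row: "(\<Sum>j\<in>I - {n}. c n j) = (a m)\<^sup>2 * vn n * kap m n" if n: "n \<in> I" for n
  proof -
    have "(\<Sum>j\<in>I. c n j) = atom_mean m n * (\<Sum>j\<in>I. atom_mean m j) - a m * (\<Sum>j\<in>I. atom_cov m n j)"
      by (simp add: c_def sum_subtractf sum_distrib_left)
    also have "\<dots> = 0" by (simp add: sum_atom_mean sum_atom_cov[OF n])
    finally have "(\<Sum>j\<in>I - {n}. c n j) = - c n n"
      using sum.remove[OF fin n, of "c n"] by simp
    then show ?thesis using q_del(4)[OF n assms(1)] by (simp add: c_def power2_eq_square)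
  qed
  have "a m * X = (\<Sum>n\<in>I. \<Sum>j\<in>I. y n * y j * (atom_mean m n * atom_mean m j - c n j))"
    unfolding X c_def by (simp add: sum_distrib_left mult_ac)
  also have "\<dots> = (\<Sum>n\<in>I. y n * atom_mean m n)\<^sup>2 - (\<Sum>n\<in>I. \<Sum>j\<in>I. y n * y j * c n j)"
    by (simp add: power2_eq_square sum_product right_diff_distrib sum_subtractf mult_ac)
  finally have aX: "a m * X = (\<Sum>n\<in>I. y n * atom_mean m n)\<^sup>2 - (\<Sum>n\<in>I. \<Sum>j\<in>I. y n * y j * c n j)" .
  \<comment> \<open>The squared conditional mean of the sum, by Cauchy-Schwarz with weights
    \<open>vn n\<close>; it is the origin of the summand \<open>s\<close> next to
    \<open>2 * k\<close>.\<close>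
  have bias: "(\<Sum>n\<in>I. y n * atom_mean m n)\<^sup>2 \<le> (a m)\<^sup>2 * (s * V)"
  proof -
    have "(\<Sum>n\<in>I. y n * atom_mean m n) = a m * (\<Sum>n\<in>I. (sqrt (vn n) * del m n) * (sqrt (vn n) * y n))"
      unfolding sum_distrib_left
    proof (rule sum.cong)
      fix n assume n: "n \<in> I"
      have "sqrt (vn n) * sqrt (vn n) = vn n" using vn_pos[OF n] by simp
      then show "y n * atom_mean m n = a m * (sqrt (vn n) * del m n * (sqrt (vn n) * y n))"
        using q_del(3)[OF n assms(1)] by (simp add: mult_ac)
    qed simp
    moreover have "(\<Sum>n\<in>I. (sqrt (vn n) * del m n) * (sqrt (vn n) * y n))\<^sup>2
      \<le> (\<Sum>n\<in>I. (sqrt (vn n) * del m n)\<^sup>2) * (\<Sum>n\<in>I. (sqrt (vn n) * y n)\<^sup>2)"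
      by (rule Cauchy_Schwarz_ineq_sum)
    moreover have "(\<Sum>n\<in>I. (sqrt (vn n) * f n)\<^sup>2) = (\<Sum>n\<in>I. vn n * (f n)\<^sup>2)" for f
      by (rule sum.cong) (use vn_pos in \<open>auto simp: power_mult_distrib less_imp_le\<close>)
    ultimately have "(\<Sum>n\<in>I. y n * atom_mean m n)\<^sup>2 \<le> (a m)\<^sup>2 * ((\<Sum>n\<in>I. vn n * (del m n)\<^sup>2) * V)"
      by (simp add: power_mult_distrib V_def mult_left_mono)
    also have "\<dots> \<le> (a m)\<^sup>2 * (s * V)" using s V by (intro mult_left_mono mult_right_mono) auto
    finally show ?thesis .
  qed
  have cov: "- (\<Sum>n\<in>I. \<Sum>j\<in>I. y n * y j * c n j) \<le> 2 * (\<Sum>n\<in>I. (y n)\<^sup>2 * ((a m)\<^sup>2 * vn n * kap m n))"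
  proof -
    have "- (\<Sum>n\<in>I. \<Sum>j\<in>I. y n * y j * c n j)
       = (\<Sum>n\<in>I. - ((y n)\<^sup>2 * c n n) + (\<Sum>j\<in>I - {n}. - (y n * y j) * c n j))"
      unfolding sum_negf[symmetric]
      by (rule sum.cong) (simp_all add: sum.remove[OF fin] sum_negf power2_eq_square)
    also have "\<dots> \<le> (\<Sum>n\<in>I. (y n)\<^sup>2 * ((a m)\<^sup>2 * vn n * kap m n) + (\<Sum>j\<in>I - {n}. ((y n)\<^sup>2 + (y j)\<^sup>2) / 2 * c n j))"
    proof (intro sum_mono add_mono)
      fix n assume n: "n \<in> I"
      have "- c n n = (a m)\<^sup>2 * vn n * kap m n"
        using q_del(4)[OF n assms(1)] by (simp add: c_def power2_eq_square)
      then show "- ((y n)\<^sup>2 * c n n) \<le> (y n)\<^sup>2 * ((a m)\<^sup>2 * vn n * kap m n)"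
        by (metis mult_minus_right order_refl)
    next
      fix n j assume "n \<in> I" "j \<in> I - {n}"
      then have "0 \<le> c n j" using c_nonneg by auto
      moreover have "- (y n * y j) \<le> ((y n)\<^sup>2 + (y j)\<^sup>2) / 2"
        using zero_le_power2[of "y n + y j"] by (simp add: power2_sum)
      ultimately show "- (y n * y j) * c n j \<le> ((y n)\<^sup>2 + (y j)\<^sup>2) / 2 * c n j"
        by (rule mult_right_mono[rotated])
    qed
    also have "\<dots> = 2 * (\<Sum>n\<in>I. (y n)\<^sup>2 * ((a m)\<^sup>2 * vn n * kap m n))"
    proof -
      have e: "(\<Sum>n\<in>I. \<Sum>j\<in>I - {n}. g n j) = (\<Sum>n\<in>I. \<Sum>j\<in>I. if n = j then 0 else g n j)" for g :: "'a \<Rightarrow> 'a \<Rightarrow> real"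
      proof (rule sum.cong)
        fix n assume n: "n \<in> I"
        have "(\<Sum>j\<in>I. if n = j then 0 else g n j) = (\<Sum>j\<in>I - {n}. if n = j then 0 else g n j)"
          using sum.remove[OF fin n, of "\<lambda>j. if n = j then 0 else g n j"] by simp
        also have "\<dots> = (\<Sum>j\<in>I - {n}. g n j)" by (rule sum.cong) auto
        finally show "(\<Sum>j\<in>I - {n}. g n j) = (\<Sum>j\<in>I. if n = j then 0 else g n j)" ..
      qed simp
      have 1: "(\<Sum>n\<in>I. \<Sum>j\<in>I - {n}. (y n)\<^sup>2 / 2 * c n j) = (\<Sum>n\<in>I. (y n)\<^sup>2 * ((a m)\<^sup>2 * vn n * kap m n)) / 2"
        unfolding sum_distrib_left[symmetric] sum_divide_distrib
        by (rule sum.cong) (simp_all add: c_row)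
      have 2: "(\<Sum>n\<in>I. \<Sum>j\<in>I - {n}. (y j)\<^sup>2 / 2 * c n j) = (\<Sum>n\<in>I. \<Sum>j\<in>I - {n}. (y n)\<^sup>2 / 2 * c n j)"
        unfolding e by (subst sum.swap) (intro sum.cong refl, simp add: c_sym)
      have "(\<Sum>n\<in>I. \<Sum>j\<in>I - {n}. ((y n)\<^sup>2 + (y j)\<^sup>2) / 2 * c n j)
        = (\<Sum>n\<in>I. \<Sum>j\<in>I - {n}. (y n)\<^sup>2 / 2 * c n j) + (\<Sum>n\<in>I. \<Sum>j\<in>I - {n}. (y j)\<^sup>2 / 2 * c n j)"
        by (simp add: sum.distrib[symmetric] add_divide_distrib distrib_right)
      then show ?thesis unfolding sum.distrib 2 1 by simp
    qed
    finally show ?thesis .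
  qed
  have "(\<Sum>n\<in>I. (y n)\<^sup>2 * ((a m)\<^sup>2 * vn n * kap m n)) \<le> (\<Sum>n\<in>I. (a m)\<^sup>2 * k * (vn n * (y n)\<^sup>2))"
  proof (rule sum_mono)
    fix n assume n: "n \<in> I"
    have "((a m)\<^sup>2 * vn n * (y n)\<^sup>2) * kap m n \<le> ((a m)\<^sup>2 * vn n * (y n)\<^sup>2) * k"
      using k[OF n] vn_pos[OF n] by (intro mult_left_mono) auto
    then show "(y n)\<^sup>2 * ((a m)\<^sup>2 * vn n * kap m n) \<le> (a m)\<^sup>2 * k * (vn n * (y n)\<^sup>2)"
      by (simp add: mult_ac)
  qed
  also have "\<dots> = (a m)\<^sup>2 * k * V" by (simp add: V_def sum_distrib_left)
  finally have diag: "(\<Sum>n\<in>I. (y n)\<^sup>2 * ((a m)\<^sup>2 * vn n * kap m n)) \<le> (a m)\<^sup>2 * k * V" .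
  have "a m * X \<le> (a m)\<^sup>2 * (s * V) + 2 * ((a m)\<^sup>2 * k * V)"
    using aX bias cov diag by linarith
  also have "\<dots> = a m * ((2 * k + s) * V * a m)"
    by (simp add: algebra_simps power2_eq_square)
  finally have "a m * X \<le> a m * ((2 * k + s) * V * a m)" .
  then show ?thesis using assms(1) by (simp add: X_def V_def)
qed

end

section \<open>Conditional shifts of single trials, bounded through the decay of atoms\<close>

lemma quarter_bound: "(x::real) * (1 - x) \<le> 1 / 4"
  using zero_le_power2[of "x - 1/2"] by (simp add: power2_eq_square algebra_simps)

context bernoulli_family begin

lemma sub_var: "n \<in> I \<Longrightarrow> bvar p (I - {n}) = v - vn n"
  by (simp add: bvar_def sum_diff1 fin)

lemma sub_mu: "n \<in> I \<Longrightarrow> bmu p (I - {n}) = \<mu> - p n"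
  by (simp add: bmu_def sum_diff1 fin)

text \<open>\<open>decay_right\<close> for the family without trial \<open>n\<close>, whose atoms at
  \<open>m - 1\<close> and \<open>m\<close> are affine in \<open>del m n\<close>.\<close>

lemma del_upper:
  assumes n: "n \<in> I" and am: "0 < a m" and t: "\<mu> \<le> of_int m"
  shows "del m n * (v - (1 - p n) * (of_int m - \<mu> + 2 * p n)) \<le> of_int m - \<mu> + p n"
proof -
  interpret N: bernoulli_family "I - {n}" p by (rule sub_family)
  have "N.v * (N.a (m - 1) - N.a m) \<le> max 0 (of_int m - N.\<mu>) * N.a (m - 1)"
    by (rule N.decay_right)
  then have "a m * ((v - vn n) * del m n) \<le> a m * ((of_int m - \<mu> + p n) * (1 + (1 - p n) * del m n))"
    using t p01'[OF n] unfolding sub_var[OF n] sub_mu[OF n] q_del[OF n am] by (simp add: algebra_simps)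
  then have "(v - vn n) * del m n \<le> (of_int m - \<mu> + p n) * (1 + (1 - p n) * del m n)"
    using am by simp
  then show ?thesis by (simp add: algebra_simps)
qed

text \<open>The same with \<open>decay_left\<close>, whose right side vanishes once \<open>m\<close>
  is at least 1 beyond the leave-one-out mean; negative shifts occur only for atoms closer than
  that.\<close>

lemma del_lower_aux:
  assumes n: "n \<in> I" and am: "0 < a m" and neg: "del m n < 0" and v: "1 / 4 < v"
  shows "of_int m - \<mu> + p n < 1"
    "- del m n * (v - p n * (2 - 2 * p n - (of_int m - \<mu>))) \<le> 1 - p n - (of_int m - \<mu>)"
proof -
  interpret N: bernoulli_family "I - {n}" p by (rule sub_family)
  have "N.v * (N.a m - N.a (m - 1)) \<le> max 0 (N.\<mu> - of_int m + 1) * N.a m"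
    by (rule N.decay_left)
  then have "a m * ((v - vn n) * - del m n) \<le> a m * (max 0 (1 - p n - (of_int m - \<mu>)) * (1 - p n * del m n))"
    unfolding sub_var[OF n] sub_mu[OF n] q_del[OF n am] by (simp add: algebra_simps)
  then have *: "(v - vn n) * - del m n \<le> max 0 (1 - p n - (of_int m - \<mu>)) * (1 - p n * del m n)"
    using am by (metis mult_le_cancel_left_pos)
  have pos: "0 < (v - vn n) * - del m n"
    using v quarter_bound[of "p n"] neg by (intro mult_pos_pos) auto
  show l: "of_int m - \<mu> + p n < 1"
  proof (rule ccontr)
    assume "\<not> of_int m - \<mu> + p n < 1"
    then have "max 0 (1 - p n - (of_int m - \<mu>)) = 0" by simp
    then show False using * pos by simp
  qed
  then show "- del m n * (v - p n * (2 - 2 * p n - (of_int m - \<mu>))) \<le> 1 - p n - (of_int m - \<mu>)"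
    using * by (simp add: max_def algebra_simps split: if_splits)
qed

text \<open>Makes the preceding bound uniform in \<open>p n\<close>; \<open>2 \<le> v\<close> pays
  for the correction in its denominator.\<close>

lemma del_lower:
  assumes n: "n \<in> I" and am: "0 < a m" and t: "\<mu> \<le> of_int m" and v: "2 \<le> v"
  shows "- del m n \<le> max 0 (1 - (of_int m - \<mu>)) / v"
proof (cases "del m n < 0")
  case False
  then have "- del m n \<le> 0" by simp
  also have "0 \<le> max 0 (1 - (of_int m - \<mu>)) / v" using v by simp
  finally show ?thesis .
next
  case True
  define t where "t = of_int m - \<mu>"
  define e where "e = - del m n"
  have p: "0 < p n" "p n < 1" using p01[OF n] by auto
  have "1 / 4 < v" using v by simp
  note aux = del_lower_aux[OF n am True this, folded t_def e_def]
  have t0: "0 \<le> t" using assms(3) by (simp add: t_def)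
  have e: "0 < e" using True by (simp add: e_def)
  have w: "0 < v - p n * (2 - 2 * p n - t)"
  proof -
    have "p n * (2 - 2 * p n - t) \<le> 1 * 2" using p t0 aux(1) by (intro mult_mono) auto
    moreover have "p n * (2 - 2 * p n - t) < 2" 
    proof -
      have "p n * (2 - 2 * p n - t) \<le> p n * 2" using p t0 by (intro mult_left_mono) auto
      then show ?thesis using p by linarith
    qed
    ultimately show ?thesis using v by simp
  qed
  have "(1 - t) * (2 - 2 * p n - t) \<le> 1 * 2" using p t0 aux(1) by (intro mult_mono) auto
  then have "(1 - t) * (2 - 2 * p n - t) \<le> v" using v by simp
  then have "p n * ((1 - t) * (2 - 2 * p n - t)) \<le> p n * v" using p by (intro mult_left_mono) auto
  then have "(1 - p n - t) * v \<le> (1 - t) * (v - p n * (2 - 2 * p n - t))"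
    by (simp add: algebra_simps)
  moreover have "e * (v - p n * (2 - 2 * p n - t)) * v \<le> (1 - p n - t) * v"
    using aux(2) v by (intro mult_right_mono) auto
  ultimately have "(e * v) * (v - p n * (2 - 2 * p n - t)) \<le> (1 - t) * (v - p n * (2 - 2 * p n - t))"
    by (simp add: mult_ac)
  then have "e * v \<le> 1 - t" using w by (simp only: mult_le_cancel_right_pos)
  then have "e \<le> (1 - t) / v" using v by (simp add: field_simps)
  also have "\<dots> \<le> max 0 (1 - t) / v" using v by (intro divide_right_mono) auto
  finally show ?thesis by (simp add: e_def t_def)
qed

text \<open>\<open>x\<close> stands for \<open>p n\<close>. The hypotheses say that \<open>c\<close>
  bounds all shifts \<open>del m n\<close> from above and \<open>1 + k\<close> all variance factors
  \<open>kap m n\<close>; \<open>- d\<close> is the lower bound of \<open>del_lower\<close>.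
  \<open>k2\<close> covers a negative shift of a trial with \<open>p n > 1/2\<close>.\<close>

lemma second_moment_decay:
  assumes am: "0 < a m" and v: "2 \<le> v" and t: "t = of_int m - \<mu>" "0 \<le> t"
    and pos: "\<And>x. 0 \<le> x \<Longrightarrow> x \<le> 1 \<Longrightarrow> (1 - x) * (t + 2 * x) < v"
    and c: "\<And>x. 0 \<le> x \<Longrightarrow> x \<le> 1 \<Longrightarrow> t + x \<le> c * (v - (1 - x) * (t + 2 * x))"
    and k: "\<And>x. 0 \<le> x \<Longrightarrow> x \<le> 1 / 2 \<Longrightarrow> (1 - 2 * x) * (t + x) \<le> k * (v - (1 - x) * (t + 2 * x))"
    and k2: "1 \<le> 8 * k * (v - 1 / 2)"
    and d: "d = max 0 (1 - t) / v"
  shows "ex (\<lambda>A. (centred_sum y A)\<^sup>2 * of_bool (int (card A) = m))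
     \<le> (2 * (1 + k) + ((c - d) * t + c * d * v)) * (\<Sum>n\<in>I. vn n * (y n)\<^sup>2) * a m"
proof (rule second_moment[OF am])
  have k0: "0 \<le> k"
  proof (rule ccontr)
    assume "\<not> 0 \<le> k"
    then have "8 * k * (v - 1 / 2) \<le> 0" using v by (intro mult_nonpos_nonneg[of "8 * k"]) linarith+
    with k2 show False by simp
  qed
  have up: "del m n \<le> c" and lo: "- d \<le> del m n" and "kap m n \<le> 1 + k" if n: "n \<in> I" for n
  proof -
    define x where "x = p n"
    have x: "0 < x" "x < 1" using p01[OF n] by (auto simp: x_def)
    define w where "w = v - (1 - x) * (t + 2 * x)"
    have w: "0 < w" using pos[of x] x by (simp add: w_def)
    have u: "del m n * w \<le> t + x"
      using del_upper[OF n am] t by (simp add: w_def x_def)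
    then have "del m n * w \<le> c * w" using c[of x] x by (simp add: w_def)
    then show "del m n \<le> c" using w by simp
    show l: "- d \<le> del m n" using del_lower[OF n am _ v] t d by simp
    have kap_le: "kap m n \<le> 1 + (1 - 2 * x) * del m n"
      using x by (simp add: kap_def x_def)
    have "(1 - 2 * x) * del m n \<le> k"
    proof (cases "x \<le> 1 / 2")
      case True
      have "((1 - 2 * x) * del m n) * w \<le> (1 - 2 * x) * (t + x)"
        using mult_left_mono[OF u, of "1 - 2 * x"] True by (simp add: mult.assoc)
      also have "\<dots> \<le> k * w" using k[of x] True x by (simp add: w_def)
      finally show ?thesis using w by simp
    next
      case False
      show ?thesis
      proof (cases "del m n < 0")
        case neg: True
        have "1 / 4 < v" using v by simp
        note aux = del_lower_aux[OF n am neg this, folded t(1) x_def]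
        define w' where "w' = v - x * (2 - 2 * x - t)"
        have "x * (2 - 2 * x - t) \<le> 2 * (x * (1 - x))" using x t by (simp add: algebra_simps)
        then have w': "v - 1 / 2 \<le> w'" using quarter_bound[of x] by (simp add: w'_def)
        have "((2 * x - 1) * - del m n) * w' \<le> (2 * x - 1) * (1 - x - t)"
          using mult_left_mono[OF aux(2), of "2 * x - 1"] False by (simp add: mult.assoc w'_def)
        also have "\<dots> \<le> (2 * x - 1) * (1 - x)" using False t by (intro mult_left_mono) auto
        \<comment> \<open>Maximum at \<open>x = 3/4\<close>.\<close>
        also have "\<dots> \<le> 1 / 8"
          using zero_le_power2[of "x - 3/4"] by (simp add: power2_eq_square algebra_simps)
        also have "\<dots> \<le> k * (v - 1 / 2)" using k2 by simp
        also have "\<dots> \<le> k * w'" using w' k0 by (intro mult_left_mono)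
        finally have "(2 * x - 1) * - del m n \<le> k" by (rule mult_right_le_imp_le) (use w' v in linarith)
        then show ?thesis by (simp add: algebra_simps)
      next
        case False2: False
        then have "(1 - 2 * x) * del m n \<le> 0" using False by (intro mult_nonpos_nonneg) auto
        then show ?thesis using k0 by simp
      qed
    qed
    with kap_le show "kap m n \<le> 1 + k" by simp
  qed
  then show "\<And>n. n \<in> I \<Longrightarrow> kap m n \<le> 1 + k" by blast
  \<comment> \<open>Bhatia-Davis inequality: values in \<open>[-d, c]\<close> with known weighted
    mean have a bounded second moment.\<close>
  have "(\<Sum>n\<in>I. vn n * (del m n)\<^sup>2) \<le> (\<Sum>n\<in>I. (c - d) * (vn n * del m n) + c * d * vn n)"
  proof (rule sum_mono)
    fix n assume n: "n \<in> I"
    have "0 \<le> (c - del m n) * (del m n + d)" using up[OF n] lo[OF n] by (intro mult_nonneg_nonneg) auto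
    then have "(del m n)\<^sup>2 \<le> (c - d) * del m n + c * d" by (simp add: algebra_simps power2_eq_square)
    then have "vn n * (del m n)\<^sup>2 \<le> vn n * ((c - d) * del m n + c * d)"
      using vn_pos[OF n] by (intro mult_left_mono) auto
    then show "vn n * (del m n)\<^sup>2 \<le> (c - d) * (vn n * del m n) + c * d * vn n"
      by (simp add: algebra_simps)
  qed
  also have "\<dots> = (c - d) * t + c * d * v"
    using sum_del[OF am] by (simp add: sum.distrib sum_distrib_left[symmetric] bvar_def t)
  finally show "(\<Sum>n\<in>I. vn n * (del m n)\<^sup>2) \<le> (c - d) * t + c * d * v" .
qed


text \<open>For small \<open>v\<close> the decay bounds are too weak. Summing
  \<open>atom_mean_exchange\<close> over \<open>j\<close> gives an exact identity whose right side
  is the sum of \<open>(p n - p j) * c j\<close>, where the \<open>c j\<close> are negated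
  conditional covariances: nonnegative, with total \<open>vn n * kap m n\<close>. As
  \<open>p n - p j\<close> lies in \<open>[p n - 1, p n]\<close>, both bounds follow.\<close>

lemma del_exchange:
  assumes n: "n \<in> I" and am: "0 < a m"
  defines "D \<equiv> v - (\<Sum>j\<in>I. p j * (vn j * del m j))"
  shows "of_int m - \<mu> - (1 - p n) * kap m n \<le> del m n * (D + p n * (of_int m - \<mu>))"
    "del m n * (D + p n * (of_int m - \<mu>)) \<le> of_int m - \<mu> + p n * kap m n"
proof -
  define t where "t = of_int m - \<mu>"
  define c where "c = (\<lambda>j. del m n * vn n * (del m j * vn j) - atom_cov m n j / a m)"
  have c: "c j * (a m)\<^sup>2 = atom_mean m n * atom_mean m j - a m * atom_cov m n j" if "j \<in> I" for j
    using am by (simp add: c_def q_del(3)[OF n am] q_del(3)[OF that am] power2_eq_square algebra_simps)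
  have c0: "0 \<le> c j" if "j \<in> I - {n}" for j
  proof -
    have "0 \<le> c j * (a m)\<^sup>2" using neg_corr[OF n, of j m] c[of j] that by auto
    then show ?thesis using am by (simp add: zero_le_mult_iff)
  qed
  have sum_b: "(\<Sum>j\<in>I. vn j * del m j) = t" using sum_del[OF am] by (simp add: t_def)
  have sM: "(\<Sum>j\<in>I. atom_cov m n j / a m) = t * (vn n * del m n)"
    unfolding sum_divide_distrib[symmetric] sum_atom_cov[OF n] t_def[symmetric] q_del(3)[OF n am]
    using am by simp
  have cnn: "c n = - (vn n * kap m n)"
  proof -
    have "c n * (a m)\<^sup>2 = - (vn n * kap m n) * (a m)\<^sup>2"
      using c[OF n] q_del(4)[OF n am] by (simp add: power2_eq_square mult_ac)
    moreover have "(a m)\<^sup>2 \<noteq> 0" using am by simp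
    ultimately show ?thesis using mult_right_cancel by blast
  qed
  have sc: "(\<Sum>j\<in>I - {n}. c j) = vn n * kap m n"
  proof -
    have "(\<Sum>j\<in>I. c j) = del m n * vn n * t - t * (vn n * del m n)"
      unfolding c_def sum_subtractf sM by (simp add: sum_b[symmetric] sum_distrib_left mult_ac)
    then show ?thesis using sum.remove[OF fin n, of c] cnn by (simp add: mult_ac)
  qed
  have ex: "vn n * vn j * (del m n - del m j) = (p n - p j) * c j - (p n - p j) * (del m n * vn n * (del m j * vn j))"
    if j: "j \<in> I - {n}" for j
  proof -
    have jI: "j \<in> I" "n \<noteq> j" using j by auto
    have *: "a m * (vn n * vn j * (del m n - del m j)) = - (p n - p j) * atom_cov m n j"
      using atom_mean_exchange[OF n jI, of m] jI(1) by (simp add: q_del(3)[OF n am] q_del(3)[OF _ am] algebra_simps)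
    have "vn n * vn j * (del m n - del m j) = a m * (vn n * vn j * (del m n - del m j)) / a m"
      using am by simp
    then have "vn n * vn j * (del m n - del m j) = - (p n - p j) * (atom_cov m n j / a m)"
      unfolding * by simp
    moreover have "X = - e * r \<Longrightarrow> X = e * (w - r) - e * w" for X e w r :: real by (simp add: algebra_simps)
    ultimately show ?thesis unfolding c_def by blast
  qed
  have "vn n * (v * del m n - t) = (\<Sum>j\<in>I. vn n * vn j * (del m n - del m j))"
    by (simp add: bvar_def sum_b[symmetric] sum_distrib_left sum_distrib_right right_diff_distrib sum_subtractf mult_ac)
  also have "\<dots> = (\<Sum>j\<in>I - {n}. vn n * vn j * (del m n - del m j))"
    by (simp add: sum.remove[OF fin n])
  also have "\<dots> = (\<Sum>j\<in>I - {n}. (p n - p j) * c j) - (\<Sum>j\<in>I - {n}. (p n - p j) * (del m n * vn n * (del m j * vn j)))"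
    unfolding sum_subtractf[symmetric] by (rule sum.cong) (use ex in auto)
  also have "(\<Sum>j\<in>I - {n}. (p n - p j) * (del m n * vn n * (del m j * vn j)))
      = (\<Sum>j\<in>I. (p n - p j) * (del m n * vn n * (del m j * vn j)))"
    by (simp add: sum.remove[OF fin n])
  also have "\<dots> = vn n * (del m n * (p n * t - (\<Sum>j\<in>I. p j * (vn j * del m j))))"
  proof -
    have "(\<Sum>j\<in>I. (p n - p j) * (del m n * vn n * (del m j * vn j)))
      = (\<Sum>j\<in>I. (vn n * del m n * p n) * (vn j * del m j) - (vn n * del m n) * (p j * (vn j * del m j)))"
      by (rule sum.cong) (simp_all add: algebra_simps)
    also have "\<dots> = (vn n * del m n * p n) * t - (vn n * del m n) * (\<Sum>j\<in>I. p j * (vn j * del m j))"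
      unfolding sum_subtractf sum_b[symmetric] sum_distrib_left ..
    also have "\<dots> = vn n * (del m n * (p n * t - (\<Sum>j\<in>I. p j * (vn j * del m j))))"
      unfolding right_diff_distrib by (simp only: mult_ac)
    finally show ?thesis .
  qed
  finally have "vn n * (v * del m n - t) = (\<Sum>j\<in>I - {n}. (p n - p j) * c j)
    - vn n * (del m n * (p n * t - (\<Sum>j\<in>I. p j * (vn j * del m j))))" .
  moreover have "X * (v * e - t) = C - X * (e * (p n * t - B)) \<Longrightarrow> X * (e * (v - B + p n * t) - t) = C" for X e B C :: real
    by (simp add: algebra_simps)
  ultimately have key: "vn n * (del m n * (D + p n * t) - t) = (\<Sum>j\<in>I - {n}. (p n - p j) * c j)"
    unfolding D_def by blast
  have "(\<Sum>j\<in>I - {n}. (p n - p j) * c j) \<le> (\<Sum>j\<in>I - {n}. p n * c j)"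
    by (intro sum_mono mult_right_mono c0) (use p01' in auto)
  also have "\<dots> = vn n * (p n * kap m n)" by (simp add: sum_distrib_left[symmetric] sc)
  finally have "vn n * (del m n * (D + p n * t) - t) \<le> vn n * (p n * kap m n)"
    unfolding key .
  then have "del m n * (D + p n * t) - t \<le> p n * kap m n"
    by (rule mult_left_le_imp_le[OF _ vn_pos[OF n]])
  then show "del m n * (D + p n * (of_int m - \<mu>)) \<le> of_int m - \<mu> + p n * kap m n"
    by (simp add: t_def)
  have "vn n * (- (1 - p n) * kap m n) = - (1 - p n) * (\<Sum>j\<in>I - {n}. c j)"
    unfolding sc by (simp add: mult_ac)
  also have "\<dots> = (\<Sum>j\<in>I - {n}. - (1 - p n) * c j)" by (rule sum_distrib_left)
  also have "\<dots> \<le> (\<Sum>j\<in>I - {n}. (p n - p j) * c j)"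
    by (intro sum_mono mult_right_mono c0) (use p01' in auto)
  finally have "vn n * (- (1 - p n) * kap m n) \<le> vn n * (del m n * (D + p n * t) - t)"
    unfolding key .
  then have "- (1 - p n) * kap m n \<le> del m n * (D + p n * t) - t"
    by (rule mult_left_le_imp_le[OF _ vn_pos[OF n]])
  then have "t - (1 - p n) * kap m n \<le> del m n * (D + p n * t)" by linarith
  then show "of_int m - \<mu> - (1 - p n) * kap m n \<le> del m n * (D + p n * (of_int m - \<mu>))"
    unfolding t_def .
qed

text \<open>A small atom near the mean forces \<open>D\<close> to be large: Stein's identity expresses the first
  absolute moment through \<open>D\<close>, and little mass can sit on the atom and its left neighbour.\<close>

lemma atom_mass_bound:
  assumes am: "0 < a m" and t: "t = of_int m - \<mu>" "0 \<le> t" "t < 1"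
  defines "D \<equiv> v - (\<Sum>j\<in>I. p j * (vn j * del m j))"
  shows "0 < D \<Longrightarrow> 1 \<le> a m * (1 + (D + t + 1 + t / D) / (2 - t) + D / (1 + t))"
    and "1 \<le> a m * (1 + D / (1 - t) + t / (1 - t) + D / (1 + t))"
    and "0 \<le> D"
proof -
  \<comment> \<open>Since \<open>0 \<le> t < 1\<close>, this is the mean of the positive part of the
    centred count, hence also that of the negative part.\<close>
  define U where "U = ex (\<lambda>A. (real (card A) - \<mu>) * of_bool (m \<le> int (card A)))"
  define F where "F = ex (\<lambda>A. of_bool (int (card A) < m))"
  define G where "G = ex (\<lambda>A. of_bool (m < int (card A)))"
  have FG: "F + a m + G = 1"
  proof -
    have "F + a m + G = ex (\<lambda>A. of_bool (int (card A) < m) + of_bool (int (card A) = m) + of_bool (m < int (card A)))"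
      by (simp add: F_def G_def pbin_def ber_ex_add)
    also have "\<dots> = ex (\<lambda>A. 1)" by (rule ber_ex_cong) auto
    finally show ?thesis using fin by simp
  qed
  have U1: "t * a m + (1 + t) * G \<le> U"
  proof -
    have "t * a m + (1 + t) * G = ex (\<lambda>A. t * of_bool (int (card A) = m) + (1 + t) * of_bool (m < int (card A)))"
      by (simp add: G_def pbin_def ber_ex_add ber_ex_cmult)
    also have "\<dots> \<le> U" unfolding U_def
    proof (rule ex_mono)
      fix A
      show "t * of_bool (int (card A) = m) + (1 + t) * of_bool (m < int (card A))
        \<le> (real (card A) - \<mu>) * of_bool (m \<le> int (card A))"
      proof (cases "m < int (card A)")
        case True
        then have "of_int m + 1 \<le> real (card A)" by linarith
        then show ?thesis using True t by simp
      qed (use t in auto)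
    qed
    finally show ?thesis .
  qed
  have Uneg: "U = ex (\<lambda>A. (\<mu> - real (card A)) * of_bool (int (card A) < m))"
  proof -
    have "U - ex (\<lambda>A. (\<mu> - real (card A)) * of_bool (int (card A) < m)) = ex (\<lambda>A. real (card A) - \<mu>)"
      unfolding U_def ber_ex_diff[symmetric] by (rule ber_ex_cong) auto
    then show ?thesis by (simp add: ex_card_centered)
  qed
  \<comment> \<open>Below \<open>m\<close> every value has distance at least \<open>2 - t\<close>
    from the mean except \<open>m - 1\<close>, which falls short of it by 1.\<close>
  have U2: "(2 - t) * F - a (m - 1) \<le> U"
  proof -
    have "(2 - t) * F - a (m - 1) = ex (\<lambda>A. (2 - t) * of_bool (int (card A) < m) - of_bool (int (card A) = m - 1))"
      by (simp add: F_def pbin_def ber_ex_diff ber_ex_cmult)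
    also have "\<dots> \<le> U" unfolding Uneg
    proof (rule ex_mono)
      fix A
      show "(2 - t) * of_bool (int (card A) < m) - of_bool (int (card A) = m - 1)
        \<le> (\<mu> - real (card A)) * of_bool (int (card A) < m)"
      proof (cases "int (card A) < m - 1")
        case True
        then have "real (card A) \<le> of_int m - 2" by linarith
        then show ?thesis using True t by simp
      qed (use t in \<open>auto simp: of_bool_def\<close>)
    qed
    finally show ?thesis .
  qed
  have U3: "(1 - t) * F \<le> U"
  proof -
    have "(1 - t) * F = ex (\<lambda>A. (1 - t) * of_bool (int (card A) < m))"
      by (simp add: F_def ber_ex_cmult)
    also have "\<dots> \<le> U" unfolding Uneg
    proof (rule ex_mono)
      fix A
      show "(1 - t) * of_bool (int (card A) < m) \<le> (\<mu> - real (card A)) * of_bool (int (card A) < m)"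
      proof (cases "int (card A) < m")
        case True
        then have "real (card A) \<le> of_int m - 1" by linarith
        then show ?thesis using True t by simp
      qed simp
    qed
    finally show ?thesis .
  qed
  \<comment> \<open>Stein's identity for the indicator of \<open>m < W\<close>, \<open>W\<close> the
    number of successes: trial \<open>n\<close> changes it exactly when the others have
    \<open>m\<close> successes.\<close>
  have DU: "a m * D = U - t * a m"
  proof -
    have "U - t * a m = ex (\<lambda>A. (real (card A) - \<mu>) * of_bool (m < int (card A)))"
      unfolding U_def pbin_def ber_ex_cmult[symmetric] ber_ex_diff[symmetric]
      by (rule ber_ex_cong) (use t in \<open>auto simp: of_bool_def\<close>)
    also have "\<dots> = (\<Sum>n\<in>I. vn n * q n m)"
      unfolding stein
    proof (rule sum.cong)
      fix n assume "n \<in> I"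
      have "ber_ex p (I - {n}) (\<lambda>A. of_bool (m < int (card (insert n A)))) - ber_ex p (I - {n}) (\<lambda>A. of_bool (m < int (card A)))
        = q n m"
        unfolding pbin_def ber_ex_diff[symmetric] by (rule ber_ex_cong) (auto simp: card_insert_sub)
      then show "vn n * (ber_ex p (I - {n}) (\<lambda>A. of_bool (m < int (card (insert n A)))) - ber_ex p (I - {n}) (\<lambda>A. of_bool (m < int (card A))))
        = vn n * q n m" by simp
    qed simp
    also have "\<dots> = (\<Sum>n\<in>I. a m * (vn n - p n * (vn n * del m n)))"
      by (rule sum.cong) (simp_all add: q_del(2)[OF _ am] algebra_simps)
    also have "\<dots> = a m * D"
      by (simp add: D_def bvar_def sum_distrib_left[symmetric] sum_subtractf)
    finally show ?thesis ..
  qed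
  have nonneg: "0 \<le> F" "0 \<le> G"
    unfolding F_def G_def by (rule ber_ex_nonneg; use p01' in auto)+
  show D0: "0 \<le> D"
  proof -
    have "0 \<le> (1 + t) * G" using nonneg t by simp
    then have "0 \<le> a m * D" using U1 DU by linarith
    then show ?thesis using am by (simp add: zero_le_mult_iff)
  qed
  have "(1 + t) * G \<le> a m * D" using U1 DU by linarith
  then have Gle: "G \<le> a m * D / (1 + t)" using t(2) by (simp add: pos_le_divide_eq mult.commute)
  have "(1 - t) * F \<le> a m * D + t * a m" using U3 DU by linarith
  then have "F \<le> (a m * D + t * a m) / (1 - t)" using t(3) by (simp add: pos_le_divide_eq mult.commute)
  with Gle FG have "1 \<le> a m + (a m * D + t * a m) / (1 - t) + a m * D / (1 + t)" by linarith
  then show "1 \<le> a m * (1 + D / (1 - t) + t / (1 - t) + D / (1 + t))"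
    by (simp add: algebra_simps add_divide_distrib)
  assume D: "0 < D"
  \<comment> \<open>\<open>ratio_bound\<close> averaged with weights \<open>vn n\<close>; Stein's
    identity evaluates the difference of the two sums as \<open>t * a m\<close>.\<close>
  have am1: "a (m - 1) \<le> a m * (1 + t / D)"
  proof -
    have "a (m - 1) * (a m * D) = (\<Sum>n\<in>I. vn n * (q n m * a (m - 1)))"
    proof -
      have "a m * D = (\<Sum>n\<in>I. vn n * q n m)"
        unfolding D_def bvar_def sum_subtractf[symmetric] sum_distrib_left
        by (rule sum.cong) (simp_all add: q_del(2)[OF _ am] algebra_simps)
      then show ?thesis by (simp add: sum_distrib_left mult_ac)
    qed
    also have "\<dots> \<le> (\<Sum>n\<in>I. vn n * (q n (m - 1) * a m))"
      by (intro sum_mono mult_left_mono ratio_bound) (use p01' in auto)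
    also have "\<dots> = a m * ((\<Sum>n\<in>I. vn n * (q n (m - 1) - q n m)) + (\<Sum>n\<in>I. vn n * q n m))"
      by (simp add: sum.distrib[symmetric] sum_distrib_left algebra_simps)
    also have "(\<Sum>n\<in>I. vn n * q n m) = a m * D"
      unfolding D_def bvar_def sum_subtractf[symmetric] sum_distrib_left
      by (rule sum.cong) (simp_all add: q_del(2)[OF _ am] algebra_simps)
    also have "(\<Sum>n\<in>I. vn n * (q n (m - 1) - q n m)) = t * a m"
      using stein_pbin[of m] t by simp
    finally have "a m * (a (m - 1) * D) \<le> a m * (a m * (t + D))" by (simp add: algebra_simps)
    then have "a (m - 1) * D \<le> a m * (t + D)" using am by simp
    then show ?thesis using D by (simp add: field_simps)
  qed
  have "F \<le> (a m * D + t * a m + a m * (1 + t / D)) / (2 - t)"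
  proof -
    have "(2 - t) * F \<le> a m * D + t * a m + a m * (1 + t / D)" using U2 DU am1 by linarith
    then show ?thesis using t(3) by (simp add: pos_le_divide_eq mult.commute)
  qed
  with Gle FG have "1 \<le> a m + (a m * D + t * a m + a m * (1 + t / D)) / (2 - t) + a m * D / (1 + t)" by linarith
  also have "\<dots> = a m * (1 + (D + t + 1 + t / D) / (2 - t) + D / (1 + t))"
  proof -
    have "a m * D + t * a m + a m * (1 + t / D) = a m * (D + t + 1 + t / D)" by (simp add: algebra_simps)
    then show ?thesis by (simp add: distrib_left)
  qed
  finally show "1 \<le> a m * (1 + (D + t + 1 + t / D) / (2 - t) + D / (1 + t))" .
qed

end

section \<open>Small atoms next to the mean and small variance\<close>

lemma quadratic_nonneg:
  fixes a b c x :: real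
  assumes "0 < a" "b\<^sup>2 \<le> 4 * a * c"
  shows "0 \<le> a * x\<^sup>2 + b * x + c"
proof -
  have "4 * a * (a * x\<^sup>2 + b * x + c) = (2 * a * x + b)\<^sup>2 + (4 * a * c - b\<^sup>2)"
    by (simp add: power2_eq_square algebra_simps)
  then have "0 \<le> 4 * a * (a * x\<^sup>2 + b * x + c)" using assms by simp
  then show ?thesis using assms(1) by (simp add: zero_le_mult_iff)
qed

lemma linear_between:
  fixes a b t u :: real
  assumes "0 \<le> t" "t \<le> u" "0 \<le> a" "0 \<le> a + b * u"
  shows "0 \<le> a + b * t"
proof (cases "0 \<le> b")
  case True
  then show ?thesis using assms by simp
next
  case False
  then have "b * u \<le> b * t" using assms by (intro mult_left_mono_neg) auto
  then show ?thesis using assms by linarith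
qed

context bernoulli_family begin

text \<open>\<open>a m * DD m\<close> is the first moment of the centred count over the atoms above
  \<open>m\<close>. It takes over the part of \<open>v\<close> in the exchange bounds.\<close>

definition DD :: "int \<Rightarrow> real" where "DD m = v - (\<Sum>j\<in>I. p j * (vn j * del m j))"

text \<open>The constant comes from \<open>t = 1/2\<close>: there the first mass bound reads
  \<open>4 D\<^sup>2 - (132/25) D + 1 > 0\<close>, whose larger root is about 1.09.\<close>

lemma DD_lower:
  assumes am: "0 < a m" "94 / 25 * a m < 1" and t: "t = of_int m - \<mu>" "0 \<le> t" "t \<le> 1 / 2"
  shows "27 / 25 \<le> DD m"
proof (rule ccontr)
  assume "\<not> 27 / 25 \<le> DD m"
  define D where "D = DD m"
  have D1: "D < 27 / 25" using \<open>\<not> 27 / 25 \<le> DD m\<close> by (simp add: D_def)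
  have t1: "t < 1" using t by simp
  note b = atom_mass_bound[OF am(1) t(1) t(2) t1, folded DD_def, folded D_def]
  have inv: "94 / 25 < y" if "1 \<le> a m * y" for y
  proof (rule ccontr)
    assume "\<not> 94 / 25 < y"
    then have "a m * y \<le> a m * (94 / 25)" using am(1) by (intro mult_left_mono) auto
    then show False using that am(2) by simp
  qed
  have l: "94 / 25 < 1 + D / (1 - t) + t / (1 - t) + D / (1 + t)" by (rule inv) (rule b(2))
  \<comment> \<open>The sharper mass bound contains \<open>t / D\<close> and would also admit very
    small \<open>D\<close>; the cruder one excludes them.\<close>
  have D12: "1 / 2 < D"
  proof (rule ccontr)
    assume "\<not> 1 / 2 < D"
    then have D: "D \<le> 1 / 2" by simp
    have "D / (1 - t) \<le> (1 / 2) / (1 / 2)" using D b(3) t by (intro frac_le) auto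
    moreover have "t / (1 - t) \<le> (1 / 2) / (1 / 2)" using t by (intro frac_le) auto
    moreover have "D / (1 + t) \<le> (1 / 2) / 1" using D b(3) t by (intro frac_le) auto
    ultimately show False using l by simp
  qed
  then have Dp: "0 < D" by simp
  have u: "94 / 25 < 1 + (D + t + 1 + t / D) / (2 - t) + D / (1 + t)" by (rule inv) (rule b(1)[OF Dp])
  have "69 / 25 < ((D + t + 1 + t / D) * (1 + t) + D * (2 - t)) / ((2 - t) * (1 + t))"
    using u t1 t by (simp add: add_divide_distrib)
  then have "69 / 25 * ((2 - t) * (1 + t)) < (D + t + 1 + t / D) * (1 + t) + D * (2 - t)"
    using t1 t by (simp add: pos_less_divide_eq)
  then have "D * (69 / 25 * ((2 - t) * (1 + t))) < D * ((D + t + 1 + t / D) * (1 + t) + D * (2 - t))"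
    using Dp by simp
  also have "D * ((D + t + 1 + t / D) * (1 + t) + D * (2 - t)) = (D\<^sup>2 + t * D + D + t) * (1 + t) + D\<^sup>2 * (2 - t)"
    using Dp by (simp add: field_simps power2_eq_square)
  finally have "0 < (D\<^sup>2 + t * D + D + t) * (1 + t) + D\<^sup>2 * (2 - t) - D * (69 / 25 * ((2 - t) * (1 + t)))" by simp
  also have "\<dots> = 3 * D\<^sup>2 - (113 / 25 - 94 / 25 * t) * (1 + t) * D + t * (1 + t)"
    by (simp add: field_simps power2_eq_square)
  finally have g: "0 < 3 * D\<^sup>2 - (113 / 25 - 94 / 25 * t) * (1 + t) * D + t * (1 + t)" .
  \<comment> \<open>\<open>D\<^sup>2\<close> lies below its chord on \<open>[1/2, 27/25]\<close>.
    This makes the inequality linear in \<open>D\<close>, to be refuted at the endpoints only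
    (\<open>e1\<close>, \<open>e2\<close>).\<close>
  have "(D - 1 / 2) * (27 / 25 - D) \<ge> 0" using D12 D1 by simp
  moreover have "(D - 1 / 2) * (27 / 25 - D) = (79 / 50) * D - 27 / 50 - D\<^sup>2"
    by (simp add: field_simps power2_eq_square)
  ultimately have sq: "D\<^sup>2 \<le> (79 / 50) * D - 27 / 50" by linarith
  define \<beta> where "\<beta> = (113 / 25 - 94 / 25 * t) * (1 + t)"
  have tt: "t * t \<le> 1 / 2 * t" "t * t \<le> 1 / 4" using t mult_right_mono[of t "1/2" t] by auto
  have \<beta>: "\<beta> = 113 / 25 + 19 / 25 * t - 94 / 25 * (t * t)" by (simp add: \<beta>_def field_simps)
  have e1: "3 * (79 / 50 * (1 / 2) - 27 / 50) - \<beta> * (1 / 2) + t * (1 + t) \<le> 0"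
  proof -
    have "3 * (79 / 50 * (1 / 2) - 27 / 50) - \<beta> * (1 / 2) + t * (1 + t) = - 151 / 100 + 31 / 50 * t + 72 / 25 * (t * t)"
      by (simp add: \<beta> field_simps)
    then show ?thesis using tt t by linarith
  qed
  have e2: "3 * (79 / 50 * (27 / 25) - 27 / 50) - \<beta> * (27 / 25) + t * (1 + t) \<le> 0"
  proof -
    have "3 * (79 / 50 * (27 / 25) - 27 / 50) - \<beta> * (27 / 25) + t * (1 + t)
       = - 864 / 625 + 112 / 625 * t + 3163 / 625 * (t * t)"
      by (simp add: \<beta> field_simps)
    then show ?thesis using tt t by linarith
  qed
  have "0 \<le> - (3 * (79 / 50 * (1 / 2) - 27 / 50) - \<beta> * (1 / 2) + t * (1 + t)) + (\<beta> - 3 * (79 / 50)) * (D - 1 / 2)"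
    by (rule linear_between[where u = "27 / 25 - 1 / 2"]) (use e1 e2 D12 D1 in \<open>auto simp: algebra_simps\<close>)
  moreover have "- (3 * (79 / 50 * (1 / 2) - 27 / 50) - \<beta> * (1 / 2) + t * (1 + t)) + (\<beta> - 3 * (79 / 50)) * (D - 1 / 2)
    = - (3 * (79 / 50 * D - 27 / 50) - \<beta> * D + t * (1 + t))" by (simp add: field_simps)
  ultimately have "3 * (79 / 50 * D - 27 / 50) - \<beta> * D + t * (1 + t) \<le> 0" by linarith
  moreover have "3 * D\<^sup>2 - \<beta> * D + t * (1 + t) \<le> 3 * (79 / 50 * D - 27 / 50) - \<beta> * D + t * (1 + t)"
    by (intro add_right_mono diff_right_mono mult_left_mono sq) simp
  ultimately show False using g[folded \<beta>_def] by (meson less_le_trans not_less order_trans)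
qed

text \<open>Same scheme as \<open>second_moment_decay\<close>, with shifts bounded by
  \<open>del_exchange\<close> and \<open>27/25 \<le> D\<close>, so that no lower bound on
  \<open>v\<close> beyond the smallness of the atom is needed.\<close>

lemma second_moment_small:
  assumes am: "0 < a m" "94 / 25 * a m < 1" and t: "\<mu> \<le> of_int m" "of_int m \<le> \<mu> + 1 / 2"
    and v: "v \<le> 5 / 2"
  shows "ex (\<lambda>A. (centred_sum y A)\<^sup>2 * of_bool (int (card A) = m)) \<le> 94 / 25 * (\<Sum>n\<in>I. vn n * (y n)\<^sup>2) * a m"
proof -
  define t where "t = of_int m - \<mu>"
  have t: "0 \<le> t" "t \<le> 1 / 2" using assms(3,4) by (auto simp: t_def)
  define D where "D = DD m"
  have D: "27 / 25 \<le> D" unfolding D_def by (rule DD_lower[OF am t_def t])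
  \<comment> \<open>\<open>- d\<close> and \<open>c\<close> enclose the shifts, \<open>1 + k\<close>
    bounds the variance factors. The total \<open>2 * (1 + k) + ...\<close> is largest at
    \<open>t = 1/2\<close>, where it is 149/40, just below 94/25.\<close>
  define c where "c = (19 / 25 :: real)"
  define d where "d = 11 / 20 * (1 - t)"
  define k where "k = 7 / 50 + 17 / 25 * t"
  have bounds: "del m n \<le> c \<and> - d \<le> del m n \<and> kap m n \<le> 1 + k" if n: "n \<in> I" for n
  proof -
    define x where "x = p n"
    define \<delta> where "\<delta> = del m n"
    have x: "0 < x" "x < 1" using p01[OF n] by (auto simp: x_def)
    have kap: "kap m n \<le> 1 + (1 - 2 * x) * \<delta>" using x by (simp add: kap_def x_def \<delta>_def)
    note exch = del_exchange[OF n am(1), folded DD_def, folded D_def t_def x_def \<delta>_def]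
    have xq: "x * (1 - x) \<le> 1 / 4" by (rule quarter_bound)
    have up: "\<delta> * (D + x * (t - 1 + 2 * x)) \<le> t + x"
      using exch(2) mult_left_mono[OF kap, of x] x by (simp add: algebra_simps)
    have w: "0 < D + x * (t - 1 + 2 * x)"
    proof -
      have "0 \<le> 2 * x\<^sup>2 + (- 1) * x + 1 / 8" by (rule quadratic_nonneg) auto
      moreover have "0 \<le> x * t" using x t by simp
      ultimately show ?thesis using D by (simp add: algebra_simps power2_eq_square)
    qed
    have wD: "27 / 25 + x * (t - 1 + 2 * x) \<le> D + x * (t - 1 + 2 * x)" using D by simp
    have "t + x \<le> c * (27 / 25 + x * (t - 1 + 2 * x))"
    proof -
      have "0 \<le> 38 / 25 * x\<^sup>2 + (- 69 / 50) * x + 401 / 1250" by (rule quadratic_nonneg) (auto simp: power2_eq_square)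
      moreover have "(1 - 19 / 25 * x) * t \<le> (1 - 19 / 25 * x) * (1 / 2)" using x t by (intro mult_left_mono) auto
      ultimately show ?thesis by (simp add: c_def algebra_simps power2_eq_square)
    qed
    also have "\<dots> \<le> c * (D + x * (t - 1 + 2 * x))" using wD by (simp add: c_def)
    finally have "\<delta> * (D + x * (t - 1 + 2 * x)) \<le> c * (D + x * (t - 1 + 2 * x))" using up by linarith
    then have dc: "\<delta> \<le> c" using w by simp
    have lo: "- \<delta> * (D + x * t + (1 - x) * (1 - 2 * x)) \<le> 1 - x - t"
      using exch(1) mult_left_mono[OF kap, of "1 - x"] x by (simp add: algebra_simps)
    have w': "19 / 20 \<le> D + x * t + (1 - x) * (1 - 2 * x)"
    proof -
      have "0 \<le> 2 * x\<^sup>2 + (- 3) * x + 9 / 8" by (rule quadratic_nonneg) auto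
      moreover have "0 \<le> x * t" using x t by simp
      ultimately show ?thesis using D by (simp add: algebra_simps power2_eq_square)
    qed
    have "1 - x - t \<le> d * (27 / 25 + x * t + (1 - x) * (1 - 2 * x))"
    proof -
      have q1: "0 \<le> 11 / 10 * x\<^sup>2 + (- 13 / 20) * x + 18 / 125" by (rule quadratic_nonneg) (auto simp: power2_eq_square)
      have "0 \<le> 1 * (11 / 10 * x\<^sup>2 + (- 13 / 20) * x + 18 / 125) + (- (18 / 125 + 11 / 10 * x\<^sup>2 - 33 / 20 * x)) * t"
      proof (rule linear_between[where u = "1 / 2"])
        show "0 \<le> 1 * (11 / 10 * x\<^sup>2 + (- 13 / 20) * x + 18 / 125) + (- (18 / 125 + 11 / 10 * x\<^sup>2 - 33 / 20 * x)) * (1 / 2)"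
          using x by (simp add: algebra_simps)
      qed (use t q1 in auto)
      moreover have "0 \<le> (1 - t) * (11 / 20 * (x * t))" using x t by simp
      moreover have "d * (27 / 25 + x * t + (1 - x) * (1 - 2 * x)) - (1 - x - t)
        = (1 * (11 / 10 * x\<^sup>2 + (- 13 / 20) * x + 18 / 125) + (- (18 / 125 + 11 / 10 * x\<^sup>2 - 33 / 20 * x)) * t)
          + (1 - t) * (11 / 20 * (x * t))"
        by (simp add: d_def field_simps power2_eq_square)
      ultimately show ?thesis by linarith
    qed
    also have "\<dots> \<le> d * (D + x * t + (1 - x) * (1 - 2 * x))" using D t by (intro mult_left_mono) (auto simp: d_def)
    finally have "- \<delta> * (D + x * t + (1 - x) * (1 - 2 * x)) \<le> d * (D + x * t + (1 - x) * (1 - 2 * x))"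
      using lo by linarith
    then have dd: "- \<delta> \<le> d" by (rule mult_right_le_imp_le) (use w' in linarith)
    have "(1 - 2 * x) * \<delta> \<le> k"
    proof (cases "x \<le> 1 / 2")
      case True
      have lin: "(1 - 2 * x) * (t + x) \<le> k * (27 / 25 + x * (t - 1 + 2 * x))"
      proof -
        have q0: "0 \<le> 57 / 25 * x\<^sup>2 + (- 57 / 50) * x + 189 / 1250" by (rule quadratic_nonneg) (auto simp: power2_eq_square)
        have q1: "0 \<le> 74 / 25 * x\<^sup>2 + (- 41 / 100) * x + 23 / 1250" by (rule quadratic_nonneg) (auto simp: power2_eq_square)
        have "0 \<le> (57 / 25 * x\<^sup>2 + (- 57 / 50) * x + 189 / 1250) + (34 / 25 * x\<^sup>2 + 73 / 50 * x - 166 / 625) * t"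
          by (rule linear_between[where u = "1 / 2"]) (use t q0 q1 in \<open>auto simp: algebra_simps\<close>)
        moreover have "0 \<le> 17 / 25 * (x * (t * t))" using x t by simp
        ultimately show ?thesis by (simp add: k_def algebra_simps power2_eq_square)
      qed
      have "((1 - 2 * x) * \<delta>) * (D + x * (t - 1 + 2 * x)) \<le> (1 - 2 * x) * (t + x)"
        using mult_left_mono[OF up, of "1 - 2 * x"] True by (simp add: mult.assoc)
      also have "\<dots> \<le> k * (D + x * (t - 1 + 2 * x))"
      proof -
        have "0 \<le> k" using t by (simp add: k_def)
        then show ?thesis using lin mult_left_mono[OF wD, of k] by linarith
      qed
      finally show ?thesis using w by simp
    next
      case False
      have "(2 * x - 1) * - \<delta> * (D + x * t + (1 - x) * (1 - 2 * x)) \<le> (2 * x - 1) * (1 - x - t)"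
        using mult_left_mono[OF lo, of "2 * x - 1"] False by (simp add: mult.assoc)
      also have "\<dots> \<le> (2 * x - 1) * (1 - x)" using False t by (intro mult_left_mono) auto
      also have "\<dots> \<le> 7 / 50 * (19 / 20)"
      proof -
        have "0 \<le> 2 * x\<^sup>2 + (- 3) * x + 9 / 8" by (rule quadratic_nonneg) auto
        then show ?thesis by (simp add: algebra_simps power2_eq_square)
      qed
      also have "\<dots> \<le> k * (D + x * t + (1 - x) * (1 - 2 * x))"
        using w' t by (intro mult_mono) (auto simp: k_def)
      finally have "(2 * x - 1) * - \<delta> \<le> k" by (rule mult_right_le_imp_le) (use w' in linarith)
      then show ?thesis by (simp add: algebra_simps)
    qed
    with kap dc dd show ?thesis by (simp add: \<delta>_def)
  qed
  have "(\<Sum>n\<in>I. vn n * (del m n)\<^sup>2) \<le> (\<Sum>n\<in>I. (c - d) * (vn n * del m n) + c * d * vn n)"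
  proof (rule sum_mono)
    fix n assume n: "n \<in> I"
    have "0 \<le> (c - del m n) * (del m n + d)" using bounds[OF n] by (intro mult_nonneg_nonneg) auto
    then have "(del m n)\<^sup>2 \<le> (c - d) * del m n + c * d" by (simp add: algebra_simps power2_eq_square)
    then have "vn n * (del m n)\<^sup>2 \<le> vn n * ((c - d) * del m n + c * d)"
      using vn_pos[OF n] by (intro mult_left_mono) auto
    then show "vn n * (del m n)\<^sup>2 \<le> (c - d) * (vn n * del m n) + c * d * vn n"
      by (simp add: algebra_simps)
  qed
  also have "\<dots> = (c - d) * t + c * d * v"
    using sum_del[OF am(1)] by (simp add: sum.distrib sum_distrib_left[symmetric] bvar_def t_def)
  also have "\<dots> \<le> (c - d) * t + c * d * (5 / 2)" using v t by (intro add_left_mono mult_left_mono) (auto simp: c_def d_def)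
  finally have s: "(\<Sum>n\<in>I. vn n * (del m n)\<^sup>2) \<le> (c - d) * t + c * d * (5 / 2)" .
  have "ex (\<lambda>A. (centred_sum y A)\<^sup>2 * of_bool (int (card A) = m))
      \<le> (2 * (1 + k) + ((c - d) * t + c * d * (5 / 2))) * (\<Sum>n\<in>I. vn n * (y n)\<^sup>2) * a m"
    by (rule second_moment[OF am(1)]) (use bounds s in auto)
  also have "\<dots> \<le> 94 / 25 * (\<Sum>n\<in>I. vn n * (y n)\<^sup>2) * a m"
  proof (intro mult_right_mono)
    have "t * t \<le> 1 / 2 * (1 / 2)" using t by (intro mult_mono) auto
    moreover have "2 * (1 + k) + ((c - d) * t + c * d * (5 / 2)) = 133 / 40 + 21 / 40 * t + 11 / 20 * (t * t)"
      by (simp add: k_def c_def d_def field_simps)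
    ultimately show "2 * (1 + k) + ((c - d) * t + c * d * (5 / 2)) \<le> 94 / 25"
      using t by linarith
    show "0 \<le> (\<Sum>n\<in>I. vn n * (y n)\<^sup>2)" by (intro sum_nonneg mult_nonneg_nonneg) (use p01' in auto)
  qed (rule a_nonneg)
  finally show ?thesis .
qed

text \<open>If all shifts are nonnegative, then \<open>DD m \<le> v\<close>. A negative shift gives
  \<open>a (m - 1) \<le> a m\<close>; log-concavity on the left and monotonicity on the right then
  make \<open>m\<close> a mode, and \<open>max_atom_lower\<close> applies.\<close>

lemma small_atom_var:
  assumes am: "0 < a m" "94 / 25 * a m < 1" and t: "\<mu> \<le> of_int m" "of_int m \<le> \<mu> + 1 / 2" and v0: "0 < v"
  shows "27 / 25 \<le> v"
proof (cases "\<forall>n\<in>I. 0 \<le> del m n")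
  case True
  then have "0 \<le> (\<Sum>j\<in>I. p j * (vn j * del m j))"
    by (intro sum_nonneg mult_nonneg_nonneg) (use p01' in auto)
  moreover have "27 / 25 \<le> DD m" by (rule DD_lower[OF am refl]) (use t in auto)
  ultimately show ?thesis by (simp add: DD_def)
next
  case False
  then obtain n where n: "n \<in> I" "del m n < 0" by auto
  then have lt: "q n (m - 1) < q n m" using am by (simp add: del_def divide_less_0_iff)
  have le1: "a (m - 1) \<le> a m"
  proof -
    have "q n m * a (m - 1) \<le> q n (m - 1) * a m" by (rule ratio_bound[OF n(1)])
    also have "\<dots> \<le> q n m * a m" using lt am by simp
    finally show ?thesis using lt q_nonneg[of n "m - 1"] by simp
  qed
  have left: "a (m - 1 - int i) \<le> a (m - int i)" for i
  proof (induction i)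
    case (Suc i)
    define l where "l = m - 1 - int i"
    have "a (l - 1) * a (l + 1) \<le> (a l)\<^sup>2"
      by (rule pbin_log_concave) (use fin p01' in auto)
    also have "\<dots> \<le> a l * a (l + 1)"
      using Suc a_nonneg[of l] by (simp add: power2_eq_square l_def mult_left_mono)
    finally have *: "a (l - 1) * a (l + 1) \<le> a l * a (l + 1)" .
    have "a (l - 1) \<le> a l"
    proof (cases "0 \<le> l - 1")
      case True
      have "int (card I) \<ge> m" using am a_zero[of m] by force
      then have "0 < a (l + 1)" using True by (intro a_pos) (auto simp: l_def)
      then show ?thesis using * by simp
    next
      case False
      then show ?thesis using a_zero[of "l - 1"] a_nonneg by simp
    qed
    then show ?case by (simp add: l_def algebra_simps)
  qed (use le1 in simp)
  have "a (m - int i) \<le> a m" for i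
  proof (induction i)
    case (Suc i)
    have "a (m - int (Suc i)) \<le> a (m - int i)" using left[of i] by (simp add: algebra_simps)
    with Suc show ?case by linarith
  qed simp
  then have "a k \<le> a m" if "k \<le> m" for k using that by (metis diff_diff_eq2 add_diff_cancel_left' zle_iff_zadd)
  moreover have "a k \<le> a m" if "m \<le> k" for k by (rule decreasing_right[OF v0 t(1) that])
  ultimately have "1 \<le> (a m)\<^sup>2 * (1 + 12 * v)" using am by (intro max_atom_lower) (meson linear)+
  also have "(a m)\<^sup>2 \<le> (25 / 94)\<^sup>2" using am by (intro power_mono) auto
  then have "(a m)\<^sup>2 * (1 + 12 * v) \<le> (25 / 94)\<^sup>2 * (1 + 12 * v)" using v0 by (intro mult_right_mono) auto
  finally show ?thesis by (simp add: power2_eq_square)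
qed

end

section \<open>Exponential moments and Fourier bounds\<close>

text \<open>The exponent in Bennett's inequality.\<close>

definition psi :: "real \<Rightarrow> real" where "psi u = exp u - 1 - u"

lemma psi_le_sq_neg: assumes "u \<le> 0" shows "psi u \<le> u\<^sup>2 / 2"
proof -
  have *: "(\<lambda>u::real. u\<^sup>2 / 2 - psi u) 0 \<le> (\<lambda>u. u\<^sup>2 / 2 - psi u) u"
  proof (rule DERIV_nonpos_imp_nonincreasing[OF assms])
    fix x :: real assume "u \<le> x" "x \<le> 0"
    have "((\<lambda>u. u\<^sup>2 / 2 - psi u) has_real_derivative (x - (exp x - 1))) (at x)"
      unfolding psi_def by (auto intro!: derivative_eq_intros)
    moreover have "x - (exp x - 1) \<le> 0" using exp_ge_add_one_self[of x] by linarith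
    ultimately show "\<exists>d. ((\<lambda>u. u\<^sup>2 / 2 - psi u) has_real_derivative d) (at x) \<and> d \<le> 0" by blast
  qed
  then show ?thesis by (simp add: psi_def)
qed

text \<open>Every term of the power series of \<open>psi\<close> has degree at least 2, so scaling
  by \<open>x \<le> 1\<close> gains a factor \<open>x\<^sup>2\<close>.\<close>

lemma psi_scale:
  assumes "0 \<le> x" "x \<le> 1" "0 \<le> u"
  shows "psi (x * u) \<le> x\<^sup>2 * psi u"
proof -
  have "psi u = (\<Sum>n. u ^ (n + 2) / fact (n + 2))" if "0 \<le> u" for u
  proof -
    have s: "(\<lambda>n. u ^ n / fact n) sums exp u"
      using exp_converges[of u] by (simp add: divide_inverse mult.commute)
    from sums_split_initial_segment[OF s, of 2]
    have "(\<lambda>n. u ^ (n + 2) / fact (n + 2)) sums (exp u - (1 + u))"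
      by (simp add: numeral_2_eq_2)
    then show ?thesis by (simp add: psi_def sums_iff)
  qed note series = this
  have sm: "summable (\<lambda>n. u ^ (n + 2) / fact (n + 2))" for u :: real
  proof -
    have "summable (\<lambda>n. u ^ n / fact n)" using summable_exp[of u] by (simp add: divide_inverse mult.commute)
    then show ?thesis using summable_iff_shift[of "\<lambda>n. u ^ n / fact n" 2] by simp
  qed
  have "psi (x * u) = (\<Sum>n. (x * u) ^ (n + 2) / fact (n + 2))" using assms by (intro series) auto
  also have "\<dots> \<le> (\<Sum>n. x\<^sup>2 * (u ^ (n + 2) / fact (n + 2)))"
  proof (rule suminf_le)
    fix n
    have "x ^ (n + 2) \<le> x ^ 2" using assms by (intro power_decreasing) auto
    then have "x ^ (n + 2) * u ^ (n + 2) \<le> x\<^sup>2 * u ^ (n + 2)" using assms by (intro mult_right_mono) auto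
    then show "(x * u) ^ (n + 2) / fact (n + 2) \<le> x\<^sup>2 * (u ^ (n + 2) / fact (n + 2))"
      unfolding power_mult_distrib times_divide_eq_right by (intro divide_right_mono) auto
  qed (use sm summable_mult[OF sm] in auto)
  also have "\<dots> = x\<^sup>2 * psi u" by (simp only: suminf_mult[OF sm] series[OF assms(3)])
  finally show ?thesis .
qed

text \<open>Upward jumps of a centred Bernoulli variable carry the share \<open>1 - x\<close> of the variance.\<close>

lemma bernoulli_mgf:
  assumes "0 \<le> x" "x \<le> 1" "0 \<le> u"
  shows "x * exp ((1 - x) * u) + (1 - x) * exp (- x * u)
     \<le> exp (x * (1 - x) * ((1 - x) * psi u + x * (u\<^sup>2 / 2)))"
    "x * exp ((1 - x) * - u) + (1 - x) * exp (- x * - u)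
     \<le> exp (x * (1 - x) * (x * psi u + (1 - x) * (u\<^sup>2 / 2)))"
proof -
  have main: "x * exp ((1 - x) * u) + (1 - x) * exp (- x * u)
     \<le> exp (x * (1 - x) * ((1 - x) * psi u + x * (u\<^sup>2 / 2)))" if x: "0 \<le> x" "x \<le> 1" for x
  proof -
    have 1: "psi ((1 - x) * u) \<le> (1 - x)\<^sup>2 * psi u" using x assms(3) by (intro psi_scale) auto
    have 2: "psi (- x * u) \<le> (- x * u)\<^sup>2 / 2" using x assms(3) by (intro psi_le_sq_neg) auto
    have "x * exp ((1 - x) * u) + (1 - x) * exp (- x * u) = 1 + x * psi ((1 - x) * u) + (1 - x) * psi (- x * u)"
      by (simp add: psi_def algebra_simps)
    also have "\<dots> \<le> 1 + x * ((1 - x)\<^sup>2 * psi u) + (1 - x) * ((- x * u)\<^sup>2 / 2)"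
      by (intro add_mono mult_left_mono 1 2) (use x in auto)
    also have "\<dots> = 1 + x * (1 - x) * ((1 - x) * psi u + x * (u\<^sup>2 / 2))"
      by (simp add: power2_eq_square algebra_simps)
    also have "\<dots> \<le> exp (x * (1 - x) * ((1 - x) * psi u + x * (u\<^sup>2 / 2)))"
      by (rule exp_ge_add_one_self)
    finally show ?thesis .
  qed
  show "x * exp ((1 - x) * u) + (1 - x) * exp (- x * u)
     \<le> exp (x * (1 - x) * ((1 - x) * psi u + x * (u\<^sup>2 / 2)))" by (rule main) (use assms in auto)
  show "x * exp ((1 - x) * - u) + (1 - x) * exp (- x * - u)
     \<le> exp (x * (1 - x) * (x * psi u + (1 - x) * (u\<^sup>2 / 2)))"
    using main[of "1 - x"] assms by (simp add: algebra_simps)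
qed

context bernoulli_family begin

text \<open>Moment generating function of \<open>centred_sum y\<close> in product form; it is also
  the normaliser of the tilted law.\<close>

definition mgf :: "('a \<Rightarrow> real) \<Rightarrow> real \<Rightarrow> real" where
  "mgf y s = (\<Prod>n\<in>I. p n * exp ((1 - p n) * (s * y n)) + (1 - p n) * exp (- p n * (s * y n)))"

lemma exp_centred_sum:
  assumes "A \<subseteq> I"
  shows "exp (s * centred_sum y A) = (\<Prod>n\<in>A. exp ((1 - p n) * (s * y n))) * (\<Prod>n\<in>I - A. exp (- p n * (s * y n)))"
proof -
  have "exp (s * centred_sum y A) = (\<Prod>n\<in>I. exp (s * ((ind A n - p n) * y n)))"
    unfolding centred_sum_def sum_distrib_left using fin by (rule exp_sum)
  also have "\<dots> = (\<Prod>n\<in>A. exp (s * ((ind A n - p n) * y n))) * (\<Prod>n\<in>I - A. exp (s * ((ind A n - p n) * y n)))"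
    by (subst prod.subset_diff[OF assms fin]) (rule mult.commute)
  also have "(\<Prod>n\<in>A. exp (s * ((ind A n - p n) * y n))) = (\<Prod>n\<in>A. exp ((1 - p n) * (s * y n)))"
    by (rule prod.cong) (auto simp: ind_def mult_ac)
  also have "(\<Prod>n\<in>I - A. exp (s * ((ind A n - p n) * y n))) = (\<Prod>n\<in>I - A. exp (- p n * (s * y n)))"
    by (rule prod.cong) (auto simp: ind_def mult_ac)
  finally show ?thesis .
qed

lemma ex_exp_centred_sum: "ex (\<lambda>A. exp (s * centred_sum y A)) = mgf y s"
proof -
  have "ex (\<lambda>A. exp (s * centred_sum y A)) = ex (\<lambda>A. (\<Prod>n\<in>A. exp ((1 - p n) * (s * y n))) * (\<Prod>n\<in>I - A. exp (- p n * (s * y n))))"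
    by (rule ber_ex_cong) (rule exp_centred_sum)
  then show ?thesis by (simp only: ber_ex_prod[OF fin] mgf_def)
qed

lemma mgf_pos: "0 < mgf y s"
  unfolding mgf_def by (rule prod_pos) (use p01 in \<open>auto intro!: add_pos_pos mult_pos_pos\<close>)

text \<open>Bennett's bound would cost \<open>psi\<close> on both sides. A jump upwards for
  \<open>s\<close> is a jump downwards for \<open>-s\<close>, so each trial divides its variance
  between \<open>psi\<close> and the Gaussian exponent in complementary shares, and in the sum only
  one side pays \<open>psi\<close>.\<close>

lemma mgf_two_sided:
  assumes y: "\<And>n. n \<in> I \<Longrightarrow> \<bar>y n\<bar> \<le> 1" and s: "0 \<le> s"
    and V: "(\<Sum>n\<in>I. vn n * (y n)\<^sup>2) \<le> V"
  shows "mgf y s + mgf y (- s) \<le> exp (V * psi s) + exp (V * (s\<^sup>2 / 2))"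
proof -
  \<comment> \<open>Share of the variance of trial \<open>n\<close> carried by jumps that increase
    the sum.\<close>
  define w where "w = (\<lambda>n. if 0 \<le> y n then 1 - p n else p n)"
  define V0 where "V0 = (\<Sum>n\<in>I. vn n * (y n)\<^sup>2)"
  define A where "A = (\<Sum>n\<in>I. vn n * (y n)\<^sup>2 * (w n * psi s + (1 - w n) * (s\<^sup>2 / 2)))"
  define B where "B = (\<Sum>n\<in>I. vn n * (y n)\<^sup>2 * ((1 - w n) * psi s + w n * (s\<^sup>2 / 2)))"
  have psi_sq: "s\<^sup>2 / 2 \<le> psi s"
    using exp_lower_Taylor_quadratic[OF s] by (simp add: psi_def)
  have w01: "0 \<le> w n" "w n \<le> 1" if "n \<in> I" for n using p01'[OF that] by (auto simp: w_def)
  have V0: "0 \<le> V0" unfolding V0_def by (intro sum_nonneg mult_nonneg_nonneg) (use p01' in auto)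
  have AB: "A + B = V0 * psi s + V0 * (s\<^sup>2 / 2)"
    unfolding A_def B_def V0_def sum.distrib[symmetric] sum_distrib_right
    by (rule sum.cong) (simp_all add: field_simps)
  have lo: "V0 * (s\<^sup>2 / 2) \<le> A" "V0 * (s\<^sup>2 / 2) \<le> B"
  proof -
    have conv: "s\<^sup>2 / 2 \<le> c * psi s + (1 - c) * (s\<^sup>2 / 2)" if "0 \<le> c" "c \<le> 1" for c
    proof -
      have "c * psi s + (1 - c) * (s\<^sup>2 / 2) = s\<^sup>2 / 2 + (c * psi s - c * (s\<^sup>2 / 2))"
        by (simp add: field_simps)
      then show ?thesis using mult_left_mono[OF psi_sq that(1)] by linarith
    qed
    show "V0 * (s\<^sup>2 / 2) \<le> A"
      unfolding A_def V0_def sum_distrib_right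
      by (intro sum_mono mult_left_mono conv) (use w01 p01' in auto)
    have conv': "s\<^sup>2 / 2 \<le> (1 - c) * psi s + c * (s\<^sup>2 / 2)" if "0 \<le> c" "c \<le> 1" for c
      using conv[of "1 - c"] that by simp
    show "V0 * (s\<^sup>2 / 2) \<le> B"
      unfolding B_def V0_def sum_distrib_right
      by (intro sum_mono mult_left_mono conv') (use w01 p01' in auto)
  qed
  have fac: "p n * exp ((1 - p n) * (s * y n)) + (1 - p n) * exp (- p n * (s * y n))
       \<le> exp (vn n * (y n)\<^sup>2 * (w n * psi s + (1 - w n) * (s\<^sup>2 / 2)))"
    "p n * exp ((1 - p n) * (- s * y n)) + (1 - p n) * exp (- p n * (- s * y n))
       \<le> exp (vn n * (y n)\<^sup>2 * ((1 - w n) * psi s + w n * (s\<^sup>2 / 2)))" if n: "n \<in> I" for n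
  proof -
    define x where "x = p n"
    define z where "z = \<bar>y n\<bar>"
    have x: "0 \<le> x" "x \<le> 1" using p01'[OF n] by (auto simp: x_def)
    have z: "0 \<le> z" "z \<le> 1" "(y n)\<^sup>2 = z\<^sup>2" using y[OF n] by (auto simp: z_def)
    have ps: "psi (z * s) \<le> z\<^sup>2 * psi s" by (rule psi_scale) (use z s in auto)
    have sq: "(z * s)\<^sup>2 / 2 = z\<^sup>2 * (s\<^sup>2 / 2)" by (simp add: power_mult_distrib)
    have mono: "x * (1 - x) * (c * psi (z * s) + c' * ((z * s)\<^sup>2 / 2)) \<le> x * (1 - x) * z\<^sup>2 * (c * psi s + c' * (s\<^sup>2 / 2))"
      if "0 \<le> c" for c c'
    proof -
      have "c * psi (z * s) \<le> c * (z\<^sup>2 * psi s)" using ps that by (intro mult_left_mono)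
      then have "c * psi (z * s) + c' * ((z * s)\<^sup>2 / 2) \<le> z\<^sup>2 * (c * psi s + c' * (s\<^sup>2 / 2))"
        unfolding sq by (simp add: algebra_simps)
      then have "x * (1 - x) * (c * psi (z * s) + c' * ((z * s)\<^sup>2 / 2)) \<le> x * (1 - x) * (z\<^sup>2 * (c * psi s + c' * (s\<^sup>2 / 2)))"
        using x by (intro mult_left_mono) auto
      then show ?thesis by (simp only: mult.assoc)
    qed
    have zs: "0 \<le> z * s" using z s by simp
    have m1: "x * exp ((1 - x) * (z * s)) + (1 - x) * exp (- x * (z * s))
       \<le> exp (x * (1 - x) * z\<^sup>2 * ((1 - x) * psi s + x * (s\<^sup>2 / 2)))"
      by (rule order_trans[OF bernoulli_mgf(1)[OF x zs]]) (use mono[of "1 - x" x] x in simp)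
    have m2: "x * exp ((1 - x) * - (z * s)) + (1 - x) * exp (- x * - (z * s))
       \<le> exp (x * (1 - x) * z\<^sup>2 * (x * psi s + (1 - x) * (s\<^sup>2 / 2)))"
      by (rule order_trans[OF bernoulli_mgf(2)[OF x zs]]) (use mono[of x "1 - x"] x in simp)
    show "p n * exp ((1 - p n) * (s * y n)) + (1 - p n) * exp (- p n * (s * y n))
       \<le> exp (vn n * (y n)\<^sup>2 * (w n * psi s + (1 - w n) * (s\<^sup>2 / 2)))"
    proof (cases "0 \<le> y n")
      case True
      then have e: "s * y n = z * s" by (simp add: z_def)
      show ?thesis using m1 True z(3) unfolding e by (simp add: w_def x_def)
    next
      case False
      then have e: "s * y n = - (z * s)" by (simp add: z_def)
      show ?thesis using m2 False z(3) unfolding e by (simp add: w_def x_def)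
    qed
    show "p n * exp ((1 - p n) * (- s * y n)) + (1 - p n) * exp (- p n * (- s * y n))
       \<le> exp (vn n * (y n)\<^sup>2 * ((1 - w n) * psi s + w n * (s\<^sup>2 / 2)))"
    proof (cases "0 \<le> y n")
      case True
      then have e: "- s * y n = - (z * s)" by (simp add: z_def)
      show ?thesis using m2 True z(3) unfolding e by (simp add: w_def x_def)
    next
      case False
      then have e: "- s * y n = z * s" by (simp add: z_def)
      show ?thesis using m1 False z(3) unfolding e by (simp add: w_def x_def)
    qed
  qed
  have "mgf y s \<le> exp A" unfolding mgf_def A_def exp_sum[OF fin]
    by (intro prod_mono conjI fac) (use p01' in auto)
  moreover have "mgf y (- s) \<le> exp B" unfolding mgf_def B_def exp_sum[OF fin]
    by (intro prod_mono conjI fac) (use p01' in auto)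
  \<comment> \<open>\<open>A + B\<close> is fixed and both are at least the Gaussian exponent; by
    convexity of \<open>exp\<close> the extreme split is the worst.\<close>
  moreover have "exp A + exp B \<le> exp (V0 * psi s) + exp (V0 * (s\<^sup>2 / 2))"
  proof -
    define X where "X = V0 * (s\<^sup>2 / 2)"
    define Y where "Y = V0 * psi s"
    have BY: "B = X + Y - A" using AB by (simp add: X_def Y_def)
    have AX: "X \<le> A" and AY: "A \<le> Y" using lo AB by (simp_all add: X_def Y_def)
    have "0 \<le> (exp Y - exp A) * (exp A - exp X)" using AX AY by (intro mult_nonneg_nonneg) auto
    then have "exp A * exp A + exp X * exp Y \<le> exp A * (exp X + exp Y)" by (simp add: algebra_simps)
    moreover have "exp B * exp A = exp X * exp Y" by (simp add: BY exp_add[symmetric])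
    ultimately have "exp A * (exp A + exp B) \<le> exp A * (exp Y + exp X)" by (simp add: algebra_simps)
    then show ?thesis by (simp add: X_def Y_def)
  qed
  moreover have "exp (V0 * psi s) \<le> exp (V * psi s)" "exp (V0 * (s\<^sup>2 / 2)) \<le> exp (V * (s\<^sup>2 / 2))"
  proof -
    have "0 \<le> psi s" using psi_sq zero_le_power2[of s] by linarith
    then show "exp (V0 * psi s) \<le> exp (V * psi s)" "exp (V0 * (s\<^sup>2 / 2)) \<le> exp (V * (s\<^sup>2 / 2))"
      using V by (auto simp: V0_def intro!: mult_right_mono)
  qed
  ultimately show ?thesis by linarith
qed

end

text \<open>Joint induction over the trials. The third moment of the old sum enters linearly and
  cancels because the new summand has mean 0; the fourth moment exceeds the Gaussian
  \<open>3 V\<^sup>2\<close> by at most \<open>V\<close>, as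
  \<open>\<bar>y n\<bar> \<le> 1\<close>.\<close>

lemma ber_ex_moments:
  assumes "finite I" "\<And>n. n \<in> I \<Longrightarrow> 0 \<le> p n \<and> p n \<le> 1" "\<And>n. n \<in> I \<Longrightarrow> \<bar>y n\<bar> \<le> 1"
  shows "ber_ex p I (\<lambda>A. \<Sum>n\<in>I. (ind A n - p n) * y n) = 0
    \<and> ber_ex p I (\<lambda>A. (\<Sum>n\<in>I. (ind A n - p n) * y n)\<^sup>2) = (\<Sum>n\<in>I. p n * (1 - p n) * (y n)\<^sup>2)
    \<and> ber_ex p I (\<lambda>A. (\<Sum>n\<in>I. (ind A n - p n) * y n) ^ 4)
       \<le> 3 * (\<Sum>n\<in>I. p n * (1 - p n) * (y n)\<^sup>2)\<^sup>2 + (\<Sum>n\<in>I. p n * (1 - p n) * (y n)\<^sup>2)"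
  using assms
proof (induction I rule: finite_induct)
  case (insert n I)
  define S where "S = (\<lambda>A. \<Sum>j\<in>I. (ind A j - p j) * y j)"
  define V where "V = (\<Sum>j\<in>I. p j * (1 - p j) * (y j)\<^sup>2)"
  have IH: "ber_ex p I S = 0" "ber_ex p I (\<lambda>A. (S A)\<^sup>2) = V" "ber_ex p I (\<lambda>A. S A ^ 4) \<le> 3 * V\<^sup>2 + V"
    using insert by (simp_all add: S_def V_def)
  define M3 where "M3 = ber_ex p I (\<lambda>A. S A ^ 3)"
  define M4 where "M4 = ber_ex p I (\<lambda>A. S A ^ 4)"
  have p: "0 \<le> p n" "p n \<le> 1" and y: "\<bar>y n\<bar> \<le> 1" using insert.prems by auto
  have V: "0 \<le> V" unfolding V_def by (intro sum_nonneg mult_nonneg_nonneg) (use insert.prems in auto)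
  have S1: "(\<Sum>j\<in>insert n I. (ind (insert n A) j - p j) * y j) = S A + (1 - p n) * y n" if "A \<subseteq> I" for A
  proof -
    have "(\<Sum>j\<in>I. (ind (insert n A) j - p j) * y j) = S A"
      unfolding S_def by (rule sum.cong) (use insert.hyps in \<open>auto simp: ind_def\<close>)
    then show ?thesis using insert.hyps by (simp add: ind_def)
  qed
  have S2: "(\<Sum>j\<in>insert n I. (ind A j - p j) * y j) = S A + (- p n) * y n" if "A \<subseteq> I" for A
    using insert.hyps that by (auto simp: S_def ind_def)
  have E: "ber_ex p (insert n I) (\<lambda>A. f (\<Sum>j\<in>insert n I. (ind A j - p j) * y j))
     = p n * ber_ex p I (\<lambda>A. f (S A + (1 - p n) * y n)) + (1 - p n) * ber_ex p I (\<lambda>A. f (S A + (- p n) * y n))" for f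
  proof -
    have 1: "ber_ex p I (\<lambda>A. f (\<Sum>j\<in>insert n I. (ind (insert n A) j - p j) * y j)) = ber_ex p I (\<lambda>A. f (S A + (1 - p n) * y n))"
      by (rule ber_ex_cong) (simp only: S1)
    have 2: "ber_ex p I (\<lambda>A. f (\<Sum>j\<in>insert n I. (ind A j - p j) * y j)) = ber_ex p I (\<lambda>A. f (S A + (- p n) * y n))"
      by (rule ber_ex_cong) (simp only: S2)
    show ?thesis unfolding ber_ex_insert[OF insert.hyps] 1 2 ..
  qed
  have e1: "ber_ex p I (\<lambda>A. S A + c) = c" for c
    using insert.hyps IH(1) by (simp add: ber_ex_add)
  have e2: "ber_ex p I (\<lambda>A. (S A + c)\<^sup>2) = V + c\<^sup>2" for c
  proof -
    have "ber_ex p I (\<lambda>A. (S A + c)\<^sup>2) = ber_ex p I (\<lambda>A. (S A)\<^sup>2 + (2 * c) * S A + c\<^sup>2)"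
      by (rule ber_ex_cong) (simp add: power2_eq_square algebra_simps)
    then show ?thesis using insert.hyps IH by (simp add: ber_ex_add ber_ex_cmult)
  qed
  have e4: "ber_ex p I (\<lambda>A. (S A + c) ^ 4) = M4 + 4 * c * M3 + 6 * c\<^sup>2 * V + c ^ 4" for c
  proof -
    have "ber_ex p I (\<lambda>A. (S A + c) ^ 4)
      = ber_ex p I (\<lambda>A. S A ^ 4 + (4 * c) * S A ^ 3 + (6 * c\<^sup>2) * (S A)\<^sup>2 + (4 * c ^ 3) * S A + c ^ 4)"
      by (rule ber_ex_cong) (simp add: eval_nat_numeral algebra_simps)
    then show ?thesis using insert.hyps IH by (simp add: ber_ex_add ber_ex_cmult M3_def M4_def)
  qed
  have V': "(\<Sum>j\<in>insert n I. p j * (1 - p j) * (y j)\<^sup>2) = V + p n * (1 - p n) * (y n)\<^sup>2"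
    using insert.hyps by (simp add: V_def)
  show ?case
  proof (intro conjI)
    show "ber_ex p (insert n I) (\<lambda>A. \<Sum>j\<in>insert n I. (ind A j - p j) * y j) = 0"
      unfolding E[of "\<lambda>x. x"] e1 by (simp add: algebra_simps)
    show "ber_ex p (insert n I) (\<lambda>A. (\<Sum>j\<in>insert n I. (ind A j - p j) * y j)\<^sup>2)
      = (\<Sum>j\<in>insert n I. p j * (1 - p j) * (y j)\<^sup>2)"
      unfolding E[of "\<lambda>x. x\<^sup>2"] e2 V' by (simp add: power2_eq_square algebra_simps)
    define w where "w = p n * (1 - p n)"
    have w: "0 \<le> w" using p by (simp add: w_def)
    have "p n * (M4 + 4 * ((1 - p n) * y n) * M3 + 6 * ((1 - p n) * y n)\<^sup>2 * V + ((1 - p n) * y n) ^ 4)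
      + (1 - p n) * (M4 + 4 * (- p n * y n) * M3 + 6 * (- p n * y n)\<^sup>2 * V + (- p n * y n) ^ 4)
      = M4 + 6 * V * (w * (y n)\<^sup>2) + w * (1 - 3 * w) * (y n) ^ 4"
      by (simp add: w_def eval_nat_numeral algebra_simps)
    also have "\<dots> \<le> (3 * V\<^sup>2 + V) + 6 * V * (w * (y n)\<^sup>2) + (3 * (w * (y n)\<^sup>2)\<^sup>2 + w * (y n)\<^sup>2)"
    proof -
      have y2: "(y n)\<^sup>2 \<le> 1" using y by (simp add: abs_square_le_1)
      have "w * (1 - 3 * w) * (y n) ^ 4 \<le> w * 1 * (y n) ^ 4"
        using w by (intro mult_right_mono mult_left_mono) auto
      also have "\<dots> = w * ((y n)\<^sup>2 * (y n)\<^sup>2)" by (simp add: eval_nat_numeral)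
      also have "\<dots> \<le> w * ((y n)\<^sup>2 * 1)" using w y2 by (intro mult_left_mono) auto
      finally have "w * (1 - 3 * w) * (y n) ^ 4 \<le> w * (y n)\<^sup>2" by simp
      moreover have "0 \<le> 3 * (w * (y n)\<^sup>2)\<^sup>2" by simp
      ultimately show ?thesis using IH(3) unfolding M4_def by linarith
    qed
    also have "\<dots> = 3 * (V + w * (y n)\<^sup>2)\<^sup>2 + (V + w * (y n)\<^sup>2)"
      by (simp add: power2_eq_square algebra_simps)
    finally show "ber_ex p (insert n I) (\<lambda>A. (\<Sum>j\<in>insert n I. (ind A j - p j) * y j) ^ 4)
       \<le> 3 * (\<Sum>j\<in>insert n I. p j * (1 - p j) * (y j)\<^sup>2)\<^sup>2 + (\<Sum>j\<in>insert n I. p j * (1 - p j) * (y j)\<^sup>2)"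
      unfolding E[of "\<lambda>x. x ^ 4"] e4 V' w_def .
  qed
qed simp

section \<open>Markov inequalities, also restricted to an event\<close>

context bernoulli_family begin

lemma markov_restricted:
  assumes "\<And>A. A \<subseteq> I \<Longrightarrow> P A \<Longrightarrow> c \<le> F A" "\<And>A. A \<subseteq> I \<Longrightarrow> 0 \<le> F A" "0 < c"
  shows "c * ex (\<lambda>A. of_bool (P A \<and> Q A)) \<le> ex (\<lambda>A. F A * of_bool (Q A))"
  unfolding ber_ex_cmult[symmetric]
  by (rule ex_mono) (use assms in \<open>auto simp: of_bool_def\<close>)

lemma tail_second:
  assumes "0 < T" and V: "(\<Sum>n\<in>I. vn n * (y n)\<^sup>2) \<le> V" and y: "\<And>n. n \<in> I \<Longrightarrow> \<bar>y n\<bar> \<le> 1"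
  shows "ex (\<lambda>A. of_bool (T < \<bar>centred_sum y A\<bar>)) \<le> V / T\<^sup>2"
    and "ex (\<lambda>A. of_bool (T < \<bar>centred_sum y A\<bar>)) \<le> (3 * V\<^sup>2 + V) / T ^ 4"
proof -
  have V0: "0 \<le> (\<Sum>n\<in>I. vn n * (y n)\<^sup>2)" by (intro sum_nonneg mult_nonneg_nonneg) (use p01' in auto)
  have mom: "ex (\<lambda>A. (centred_sum y A)\<^sup>2) = (\<Sum>n\<in>I. vn n * (y n)\<^sup>2)"
    "ex (\<lambda>A. centred_sum y A ^ 4) \<le> 3 * (\<Sum>n\<in>I. vn n * (y n)\<^sup>2)\<^sup>2 + (\<Sum>n\<in>I. vn n * (y n)\<^sup>2)"
    using ber_ex_moments[of I p y] fin p01' y unfolding centred_sum_def by blast+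
  have sq: "T\<^sup>2 \<le> x\<^sup>2" if "T < \<bar>x\<bar>" for x :: real
    using that assms(1) by (simp add: abs_le_square_iff[symmetric])
  have "T\<^sup>2 * ex (\<lambda>A. of_bool (T < \<bar>centred_sum y A\<bar> \<and> True)) \<le> ex (\<lambda>A. (centred_sum y A)\<^sup>2 * of_bool True)"
    by (rule markov_restricted) (use sq assms(1) in auto)
  then have "T\<^sup>2 * ex (\<lambda>A. of_bool (T < \<bar>centred_sum y A\<bar>)) \<le> V" using mom(1) V by simp
  then show "ex (\<lambda>A. of_bool (T < \<bar>centred_sum y A\<bar>)) \<le> V / T\<^sup>2"
    using assms(1) by (simp add: pos_le_divide_eq mult.commute)
  have qu: "T ^ 4 \<le> x ^ 4" if "T < \<bar>x\<bar>" for x :: real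
    using power_mono[OF sq[OF that], of 2] by (simp add: power_mult[symmetric])
  have "T ^ 4 * ex (\<lambda>A. of_bool (T < \<bar>centred_sum y A\<bar> \<and> True)) \<le> ex (\<lambda>A. centred_sum y A ^ 4 * of_bool True)"
    by (rule markov_restricted) (use qu assms(1) in auto)
  moreover have "3 * (\<Sum>n\<in>I. vn n * (y n)\<^sup>2)\<^sup>2 + (\<Sum>n\<in>I. vn n * (y n)\<^sup>2) \<le> 3 * V\<^sup>2 + V"
    using V V0 by (intro add_mono mult_left_mono power_mono) auto
  ultimately have "T ^ 4 * ex (\<lambda>A. of_bool (T < \<bar>centred_sum y A\<bar>)) \<le> 3 * V\<^sup>2 + V" using mom(2) by simp
  then show "ex (\<lambda>A. of_bool (T < \<bar>centred_sum y A\<bar>)) \<le> (3 * V\<^sup>2 + V) / T ^ 4"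
    using assms(1) by (simp add: pos_le_divide_eq mult.commute)
qed

lemma tail_exp:
  assumes "0 < s"
  shows "ex (\<lambda>A. of_bool (T < \<bar>centred_sum y A\<bar> \<and> Q A))
    \<le> exp (- s * T) * (ex (\<lambda>A. exp (s * centred_sum y A) * of_bool (Q A)) + ex (\<lambda>A. exp (- s * centred_sum y A) * of_bool (Q A)))"
proof -
  have "exp (s * T) * ex (\<lambda>A. of_bool (T < \<bar>centred_sum y A\<bar> \<and> Q A))
     \<le> ex (\<lambda>A. (exp (s * centred_sum y A) + exp (- s * centred_sum y A)) * of_bool (Q A))"
  proof (rule markov_restricted)
    fix A assume "T < \<bar>centred_sum y A\<bar>"
    then have "T \<le> centred_sum y A \<or> T \<le> - centred_sum y A" by auto
    then have "s * T \<le> s * centred_sum y A \<or> s * T \<le> s * - centred_sum y A"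
      using assms by (meson mult_left_mono less_imp_le)
    then have "exp (s * T) \<le> exp (s * centred_sum y A) \<or> exp (s * T) \<le> exp (- s * centred_sum y A)"
      by auto
    moreover have "0 \<le> exp (s * centred_sum y A)" "0 \<le> exp (- s * centred_sum y A)" by auto
    ultimately show "exp (s * T) \<le> exp (s * centred_sum y A) + exp (- s * centred_sum y A)" by linarith
  qed (auto intro!: add_nonneg_nonneg)
  then have "exp (- s * T) * (exp (s * T) * ex (\<lambda>A. of_bool (T < \<bar>centred_sum y A\<bar> \<and> Q A)))
     \<le> exp (- s * T) * ex (\<lambda>A. (exp (s * centred_sum y A) + exp (- s * centred_sum y A)) * of_bool (Q A))"
    by (intro mult_left_mono) auto
  then show ?thesis
    by (simp add: mult.assoc[symmetric] exp_add[symmetric] distrib_right ber_ex_add)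
qed

end

section \<open>Fourier bounds for atoms and for tilted atoms\<close>

lemma sin_ge_linear: assumes "0 \<le> x" "x \<le> pi / 2" shows "2 * x / pi \<le> sin x"
proof -
  have conv: "convex_on {0..pi / 2} (\<lambda>x. - sin x)"
  proof (rule f''_ge0_imp_convex)
    show "((\<lambda>x. - sin x) has_real_derivative - cos x) (at x)" for x :: real
      by (auto intro!: derivative_eq_intros)
    show "((\<lambda>x. - cos x) has_real_derivative sin x) (at x)" for x :: real
      by (auto intro!: derivative_eq_intros)
    show "0 \<le> sin x" if "x \<in> {0..pi / 2}" for x
      using that by (intro sin_ge_zero) auto
  qed simp
  have "- sin x \<le> (- sin (pi / 2) - - sin 0) / (pi / 2 - 0) * (x - 0) + - sin 0"
    by (rule convex_onD_Icc'[OF conv]) (use assms in auto)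
  then show ?thesis by simp
qed

lemma one_minus_cos_ge: assumes "\<bar>x\<bar> \<le> pi" shows "2 * x\<^sup>2 / pi\<^sup>2 \<le> 1 - cos x"
proof -
  have "2 * (\<bar>x\<bar> / 2) / pi \<le> sin (\<bar>x\<bar> / 2)" by (rule sin_ge_linear) (use assms in auto)
  then have "(\<bar>x\<bar> / pi)\<^sup>2 \<le> (sin (\<bar>x\<bar> / 2))\<^sup>2" by (intro power_mono) auto
  moreover have "cos \<bar>x\<bar> = 1 - 2 * (sin (\<bar>x\<bar> / 2))\<^sup>2"
    using cos_double_sin[of "\<bar>x\<bar> / 2"] by simp
  ultimately show ?thesis by (simp add: power_divide)
qed

lemma gauss_integral_bound:
  assumes "0 < c"
  shows "integral {-pi..pi} (\<lambda>x. exp (- c * x\<^sup>2)) \<le> sqrt (pi / c)"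
proof -
  define \<sigma> where "\<sigma> = sqrt (1 / (2 * c))"
  have \<sigma>: "0 < \<sigma>" "\<sigma>\<^sup>2 = 1 / (2 * c)" using assms by (simp_all add: \<sigma>_def)
  have nd: "exp (- c * x\<^sup>2) = sqrt (pi / c) * normal_density 0 \<sigma> x" for x
  proof -
    have "2 * pi * \<sigma>\<^sup>2 = pi / c" using \<sigma> by simp
    then show ?thesis using assms \<sigma> by (simp add: normal_density_def)
  qed
  have "set_integrable lborel {-pi..pi} (\<lambda>x. exp (- c * x\<^sup>2))"
    by (intro borel_integrable_atLeastAtMost' continuous_intros)
  then have "integral {-pi..pi} (\<lambda>x. exp (- c * x\<^sup>2)) = (LINT x:{-pi..pi}|lborel. exp (- c * x\<^sup>2))"
    by (rule set_borel_integral_eq_integral(2)[symmetric])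
  also have "\<dots> \<le> (LINT x|lborel. sqrt (pi / c) * normal_density 0 \<sigma> x)"
    unfolding set_lebesgue_integral_def nd
  proof (rule integral_mono)
    show "integrable lborel (\<lambda>x. sqrt (pi / c) * normal_density 0 \<sigma> x)"
      using integrable_normal_density[OF \<sigma>(1)] by simp
    show "integrable lborel (\<lambda>x. indicat_real {- pi..pi} x *\<^sub>R (sqrt (pi / c) * normal_density 0 \<sigma> x))"
      using integrable_normal_density[OF \<sigma>(1)] by (intro integrable_mult_indicator) auto
    show "indicat_real {- pi..pi} x *\<^sub>R (sqrt (pi / c) * normal_density 0 \<sigma> x) \<le> sqrt (pi / c) * normal_density 0 \<sigma> x" for x
      using assms by (auto simp: indicator_def normal_density_nonneg)
  qed
  also have "\<dots> = sqrt (pi / c)" using integral_normal_density[OF \<sigma>(1)] by simp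
  finally show ?thesis .
qed

text \<open>The phase stays general because a success of the new trial shifts it by
  \<open>\<theta>\<close>.\<close>

lemma ber_ex_cos:
  assumes "finite I"
  shows "ber_ex p I (\<lambda>A. cos (real (card A) * \<theta> + \<phi>)) = Re (cis \<phi> * (\<Prod>n\<in>I. of_real (1 - p n) + of_real (p n) * cis \<theta>))"
  using assms
proof (induction I arbitrary: \<phi> rule: finite_induct)
  case (insert n I)
  define G where "G = (\<Prod>n\<in>I. of_real (1 - p n) + of_real (p n) * cis \<theta>)"
  have "ber_ex p I (\<lambda>A. cos (real (card (insert n A)) * \<theta> + \<phi>)) = ber_ex p I (\<lambda>A. cos (real (card A) * \<theta> + (\<phi> + \<theta>)))"
  proof (rule ber_ex_cong)
    fix A assume "A \<subseteq> I"
    then have "n \<notin> A" "finite A" using insert.hyps finite_subset[of A I] by auto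
    then have "card (insert n A) = Suc (card A)" by simp
    then show "cos (real (card (insert n A)) * \<theta> + \<phi>) = cos (real (card A) * \<theta> + (\<phi> + \<theta>))"
      by (simp add: algebra_simps)
  qed
  then have "ber_ex p (insert n I) (\<lambda>A. cos (real (card A) * \<theta> + \<phi>))
     = p n * Re (cis (\<phi> + \<theta>) * G) + (1 - p n) * Re (cis \<phi> * G)"
    by (simp only: ber_ex_insert[OF insert.hyps] insert.IH G_def)
  also have "\<dots> = Re (cis \<phi> * ((of_real (1 - p n) + of_real (p n) * cis \<theta>) * G))"
    by (simp add: cis_mult[symmetric] algebra_simps)
  finally show ?case using insert.hyps by (simp add: G_def)
qed simp

text \<open>The squared modulus is exactly
  \<open>1 - 2 * (x * (1 - x)) * (1 - cos \<theta>)\<close>.\<close>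

lemma cmod_bernoulli_cf:
  assumes "0 \<le> x" "x \<le> 1"
  shows "cmod (of_real (1 - x) + of_real x * cis \<theta>) \<le> exp (- (x * (1 - x)) * (1 - cos \<theta>))"
proof -
  have "(cmod (of_real (1 - x) + of_real x * cis \<theta>))\<^sup>2 = (1 - x + x * cos \<theta>)\<^sup>2 + (x * sin \<theta>)\<^sup>2"
    by (simp add: cmod_power2)
  also have "\<dots> = 1 + 2 * (- (x * (1 - x)) * (1 - cos \<theta>))"
    (is "?l = ?r")
  proof -
    have "(1 - x + x * c)\<^sup>2 + (x * s)\<^sup>2 = 1 + 2 * (- (x * (1 - x)) * (1 - c)) + x\<^sup>2 * (s\<^sup>2 + c\<^sup>2 - 1)" for c s :: real
      by (simp add: power2_eq_square algebra_simps)
    from this[of "cos \<theta>" "sin \<theta>"] show ?thesis by simp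
  qed
  also have "\<dots> \<le> exp (2 * (- (x * (1 - x)) * (1 - cos \<theta>)))" by (rule exp_ge_add_one_self)
  also have "\<dots> = (exp (- (x * (1 - x)) * (1 - cos \<theta>)))\<^sup>2"
    by (rule exp_double)
  finally show ?thesis by (rule power2_le_imp_le) simp
qed

lemma integral_cos_int:
  fixes j :: int
  shows "((\<lambda>\<theta>. cos (of_int j * \<theta>)) has_integral (if j = 0 then 2 * pi else 0)) {-pi..pi}"
proof (cases "j = 0")
  case True
  then show ?thesis using has_integral_const_real[of "1 :: real" "-pi" pi] by simp
next
  case False
  have "((\<lambda>\<theta>. cos (of_int j * \<theta>)) has_integral (sin (of_int j * pi) / of_int j - sin (of_int j * - pi) / of_int j)) {-pi..pi}"
    by (rule fundamental_theorem_of_calculus)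
      (use False in \<open>auto intro!: derivative_eq_intros simp: has_real_derivative_iff_has_vector_derivative[symmetric]\<close>)
  moreover have "sin (of_int j * pi) = 0" using sin_zero_iff_int2 by blast
  ultimately show ?thesis using False by simp
qed

context bernoulli_family begin

text \<open>Fourier inversion: the characteristic function is dominated by a Gaussian on \<open>[-\<pi>, \<pi>]\<close>.\<close>

lemma pbin_upper: assumes "0 < v" shows "a k \<le> sqrt (pi / (2 * v)) / 2"
proof -
  define c where "c = 2 * v / pi\<^sup>2"
  have c: "0 < c" using assms by (simp add: c_def)
  \<comment> \<open>Real part of the characteristic function times
    \<open>cis (- k * \<theta>)\<close>; orthogonality of the cosines isolates the atom
    \<open>k\<close>.\<close>
  define h where "h = (\<lambda>\<theta>. ex (\<lambda>A. cos (real (card A) * \<theta> + (- of_int k * \<theta>))))"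
  have "(h has_integral ex (\<lambda>A. if int (card A) - k = 0 then 2 * pi else 0)) {-pi..pi}"
  proof -
    have "((\<lambda>\<theta>. \<Sum>A\<in>Pow I. ber_wt p I A * cos (of_int (int (card A) - k) * \<theta>)) has_integral
       (\<Sum>A\<in>Pow I. ber_wt p I A * (if int (card A) - k = 0 then 2 * pi else 0))) {-pi..pi}"
      using fin by (intro has_integral_sum has_integral_mult_right integral_cos_int) auto
    then show ?thesis unfolding h_def ber_ex_def by (simp add: algebra_simps)
  qed
  moreover have "ex (\<lambda>A. if int (card A) - k = 0 then 2 * pi else 0) = a k * (2 * pi)"
    unfolding pbin_def ber_ex_mult_right[symmetric] by (rule ber_ex_cong) auto
  ultimately have hi: "(h has_integral a k * (2 * pi)) {-pi..pi}" by simp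
  have le: "h \<theta> \<le> exp (- c * \<theta>\<^sup>2)" if "\<theta> \<in> {-pi..pi}" for \<theta>
  proof -
    have "h \<theta> = Re (cis (- of_int k * \<theta>) * (\<Prod>n\<in>I. of_real (1 - p n) + of_real (p n) * cis \<theta>))"
      unfolding h_def by (rule ber_ex_cos[OF fin])
    also have "\<dots> \<le> cmod (cis (- of_int k * \<theta>) * (\<Prod>n\<in>I. of_real (1 - p n) + of_real (p n) * cis \<theta>))"
      by (rule complex_Re_le_cmod)
    also have "\<dots> = (\<Prod>n\<in>I. cmod (of_real (1 - p n) + of_real (p n) * cis \<theta>))"
      by (simp add: norm_mult prod_norm)
    also have "\<dots> \<le> (\<Prod>n\<in>I. exp (- (p n * (1 - p n)) * (1 - cos \<theta>)))"
      by (intro prod_mono conjI cmod_bernoulli_cf) (use p01' in auto)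
    also have "\<dots> = exp (- v * (1 - cos \<theta>))"
      unfolding bvar_def exp_sum[OF fin, symmetric] by (simp add: sum_negf sum_distrib_right)
    also have "\<dots> \<le> exp (- c * \<theta>\<^sup>2)"
    proof -
      have "2 * \<theta>\<^sup>2 / pi\<^sup>2 \<le> 1 - cos \<theta>" by (rule one_minus_cos_ge) (use that in auto)
      then have "v * (2 * \<theta>\<^sup>2 / pi\<^sup>2) \<le> v * (1 - cos \<theta>)" using assms by (intro mult_left_mono) auto
      then show ?thesis by (simp add: c_def mult_ac)
    qed
    finally show ?thesis .
  qed
  have "a k * (2 * pi) \<le> integral {-pi..pi} (\<lambda>x. exp (- c * x\<^sup>2))"
    using integral_le[OF has_integral_integrable[OF hi] _ le] integral_unique[OF hi]
    by (simp add: integrable_continuous_interval continuous_intros)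
  also have "\<dots> \<le> sqrt (pi / c)" by (rule gauss_integral_bound[OF c])
  also have "\<dots> = pi * sqrt (pi / (2 * v))"
  proof -
    have "pi / c = pi\<^sup>2 * (pi / (2 * v))" using assms by (simp add: c_def)
    then show ?thesis by (simp only: real_sqrt_mult) simp
  qed
  finally have "pi * (2 * a k) \<le> pi * sqrt (pi / (2 * v))" by (simp add: mult_ac)
  then have "2 * a k \<le> sqrt (pi / (2 * v))" by (simp only: mult_le_cancel_left_pos[OF pi_gt_zero])
  then show ?thesis by simp
qed

text \<open>Tilting by \<open>exp (s S)\<close> gives again independent trials, and their variance is at least \<open>exp (- \<bar>s\<bar>) v\<close>.\<close>

lemma ex_exp_atom:
  assumes y: "\<And>n. n \<in> I \<Longrightarrow> \<bar>y n\<bar> \<le> 1" and v: "0 < v"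
  shows "ex (\<lambda>A. exp (s * centred_sum y A) * of_bool (int (card A) = k)) \<le> mgf y s * (sqrt (pi * exp \<bar>s\<bar> / (2 * v)) / 2)"
proof -
  define up where "up = (\<lambda>n. exp ((1 - p n) * (s * y n)))"
  define dn where "dn = (\<lambda>n. exp (- p n * (s * y n)))"
  define Z where "Z = (\<lambda>n. p n * up n + (1 - p n) * dn n)"
  define p' where "p' = (\<lambda>n. p n * up n / Z n)"
  have Zp: "0 < Z n" if "n \<in> I" for n
    unfolding Z_def up_def dn_def using p01[OF that] by (intro add_pos_pos mult_pos_pos) auto
  have m1: "1 - p' n = (1 - p n) * dn n / Z n" if "n \<in> I" for n
    using Zp[OF that] by (simp add: p'_def Z_def field_simps)
  interpret T: bernoulli_family I p'
  proof
    fix n assume n: "n \<in> I"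
    have "0 < p' n" unfolding p'_def up_def using p01[OF n] Zp[OF n] by simp
    moreover have "0 < 1 - p' n" unfolding m1[OF n] dn_def using p01[OF n] Zp[OF n] by simp
    ultimately show "0 < p' n \<and> p' n < 1" by simp
  qed (rule fin)
  have wt: "ber_wt p I A * exp (s * centred_sum y A) = mgf y s * ber_wt p' I A" if A: "A \<subseteq> I" for A
  proof -
    have fA: "finite A" "finite (I - A)" using A fin finite_subset by auto
    have "mgf y s = (\<Prod>n\<in>I. Z n)" by (simp add: mgf_def Z_def up_def dn_def)
    also have "\<dots> = (\<Prod>n\<in>A. Z n) * (\<Prod>n\<in>I - A. Z n)"
      by (subst prod.subset_diff[OF A fin]) (rule mult.commute)
    finally have "mgf y s * ber_wt p' I A = (\<Prod>n\<in>A. Z n * p' n) * (\<Prod>n\<in>I - A. Z n * (1 - p' n))"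
      by (simp add: ber_wt_def prod.distrib mult_ac)
    also have "(\<Prod>n\<in>A. Z n * p' n) = (\<Prod>n\<in>A. p n * up n)"
    proof (rule prod.cong)
      fix n assume "n \<in> A"
      then have "0 < Z n" using A Zp by auto
      then show "Z n * p' n = p n * up n" by (simp add: p'_def)
    qed simp
    also have "(\<Prod>n\<in>I - A. Z n * (1 - p' n)) = (\<Prod>n\<in>I - A. (1 - p n) * dn n)"
    proof (rule prod.cong)
      fix n assume "n \<in> I - A"
      then show "Z n * (1 - p' n) = (1 - p n) * dn n" using m1[of n] Zp[of n] by simp
    qed simp
    also have "(\<Prod>n\<in>A. p n * up n) * (\<Prod>n\<in>I - A. (1 - p n) * dn n) = ber_wt p I A * exp (s * centred_sum y A)"
      unfolding exp_centred_sum[OF A] ber_wt_def up_def dn_def by (simp add: prod.distrib mult_ac)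
    finally show ?thesis by simp
  qed
  have "ex (\<lambda>A. exp (s * centred_sum y A) * of_bool (int (card A) = k)) = mgf y s * T.a k"
    unfolding pbin_def ber_ex_def sum_distrib_left
  proof (rule sum.cong)
    fix A assume "A \<in> Pow I"
    then have "ber_wt p I A * exp (s * centred_sum y A) = mgf y s * ber_wt p' I A" by (intro wt) auto
    then show "ber_wt p I A * (exp (s * centred_sum y A) * of_bool (int (card A) = k))
      = mgf y s * (ber_wt p' I A * of_bool (int (card A) = k))" by (simp add: mult.assoc[symmetric])
  qed simp
  also have "\<dots> \<le> mgf y s * (sqrt (pi * exp \<bar>s\<bar> / (2 * v)) / 2)"
  proof (intro mult_left_mono)
    have var: "exp (- \<bar>s\<bar>) * vn n \<le> T.vn n" if n: "n \<in> I" for n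
    proof -
      define u where "u = s * y n"
      have "\<bar>u\<bar> \<le> \<bar>s\<bar> * 1" unfolding u_def abs_mult using y[OF n] by (intro mult_left_mono) auto
      then have u: "\<bar>u\<bar> \<le> \<bar>s\<bar>" by simp
      have p: "0 < p n" "p n < 1" using p01[OF n] by auto
      \<comment> \<open>\<open>Z n\<close> is a convex combination of \<open>up n\<close> and
        \<open>dn n\<close>, whose ratio is \<open>exp u\<close>; the square of the larger one is
        \<open>exp \<bar>u\<bar> * (up n * dn n)\<close>.\<close>
      have Zd: "(Z n)\<^sup>2 \<le> exp \<bar>u\<bar> * (up n * dn n)"
      proof -
        have ud: "up n = dn n * exp u" by (simp add: up_def dn_def u_def exp_add[symmetric] algebra_simps)
        have "(p n * exp u + (1 - p n))\<^sup>2 \<le> exp \<bar>u\<bar> * exp u"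
        proof (cases "0 \<le> u")
          case True
          then have "p n * exp u + (1 - p n) * 1 \<le> p n * exp u + (1 - p n) * exp u"
            using p by (intro add_left_mono mult_left_mono) auto
          then have "p n * exp u + (1 - p n) \<le> exp u" by (simp add: algebra_simps)
          then have "(p n * exp u + (1 - p n))\<^sup>2 \<le> (exp u)\<^sup>2" using p by (intro power_mono) auto
          then show ?thesis using True by (simp add: power2_eq_square)
        next
          case False
          then have "p n * exp u + (1 - p n) * 1 \<le> p n * 1 + (1 - p n) * 1"
            using p by (intro add_right_mono mult_left_mono) auto
          then have "(p n * exp u + (1 - p n))\<^sup>2 \<le> 1\<^sup>2" using p by (intro power_mono) auto
          then show ?thesis using False by (simp add: exp_add[symmetric])
        qed
        then have "(dn n)\<^sup>2 * (p n * exp u + (1 - p n))\<^sup>2 \<le> (dn n)\<^sup>2 * (exp \<bar>u\<bar> * exp u)"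
          by (intro mult_left_mono) auto
        then show ?thesis unfolding Z_def ud by (simp add: power2_eq_square algebra_simps)
      qed
      have "T.vn n = vn n * (up n * dn n) / (Z n)\<^sup>2"
        unfolding m1[OF n] by (simp add: p'_def power2_eq_square)
      moreover have "exp (- \<bar>s\<bar>) \<le> (up n * dn n) / (Z n)\<^sup>2"
      proof -
        have "exp (- \<bar>s\<bar>) * (Z n)\<^sup>2 \<le> exp (- \<bar>u\<bar>) * (exp \<bar>u\<bar> * (up n * dn n))"
          using u Zd by (intro mult_mono) auto
        also have "\<dots> = up n * dn n" by (simp add: mult.assoc[symmetric] exp_add[symmetric])
        finally show ?thesis using Zp[OF n] by (simp add: pos_le_divide_eq)
      qed
      then have "vn n * exp (- \<bar>s\<bar>) \<le> vn n * ((up n * dn n) / (Z n)\<^sup>2)"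
        using p by (intro mult_left_mono) auto
      ultimately show ?thesis by (simp add: mult_ac)
    qed
    have vT: "exp (- \<bar>s\<bar>) * v \<le> T.v"
      unfolding bvar_def sum_distrib_left by (rule sum_mono) (rule var)
    moreover have pos: "0 < exp (- \<bar>s\<bar>) * v" using v by simp
    ultimately have Tv: "0 < T.v" by linarith
    have "pi / (2 * T.v) \<le> pi / (2 * (exp (- \<bar>s\<bar>) * v))"
      using vT pos by (intro divide_left_mono) auto
    also have "\<dots> = pi * exp \<bar>s\<bar> / (2 * v)" by (simp add: exp_minus field_simps)
    finally have "sqrt (pi / (2 * T.v)) \<le> sqrt (pi * exp \<bar>s\<bar> / (2 * v))" by simp
    then show "T.a k \<le> sqrt (pi * exp \<bar>s\<bar> / (2 * v)) / 2" using T.pbin_upper[OF Tv, of k] by linarith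
  qed (use mgf_pos in \<open>simp add: less_imp_le\<close>)
  finally show ?thesis .
qed

end

section \<open>Numerical bounds for the tails\<close>

lemma exp_ge_Taylor_even:
  fixes x :: real
  assumes "even n" shows "(\<Sum>m<n. x ^ m / fact m) \<le> exp x"
proof -
  obtain t where "exp x = (\<Sum>m<n. x ^ m / fact m) + exp t / fact n * x ^ n"
    using Maclaurin_exp_le[of x n] by (elim exE conjE)
  moreover have "0 \<le> exp t / fact n * x ^ n" using assms by (intro mult_nonneg_nonneg zero_le_even_power) auto
  ultimately show ?thesis by linarith
qed

text \<open>An upper bound at \<open>x\<close> from a lower bound at \<open>-x\<close>: after an
  even number of terms the remainder is nonnegative for either sign.\<close>

lemma exp_le_Taylor_even:
  fixes x :: real
  assumes "even n" "1 \<le> c * (\<Sum>m<n. (- x) ^ m / fact m)" "0 \<le> c"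
  shows "exp x \<le> c"
proof -
  have "1 \<le> c * exp (- x)"
    using assms(2) mult_left_mono[OF exp_ge_Taylor_even[OF assms(1), of "- x"] assms(3)] by linarith
  then have "exp x * 1 \<le> exp x * (c * exp (- x))" by (intro mult_left_mono) auto
  moreover have "exp x * (c * exp (- x)) = c" by (simp add: exp_minus)
  ultimately show ?thesis by simp
qed

text \<open>6931/10000 stands for \<open>ln 2\<close>, 7/5 is the Chernoff parameter, and the
  arguments from 137/100 on are the values of \<open>L\<close> at which the method changes.\<close>

lemma exp_numeric:
  "exp 1 \<le> (27183 / 10000 :: real)" "27182 / 10000 \<le> (exp 1 :: real)" "exp (6931 / 10000) \<le> (2 :: real)"
  "exp (7 / 5) \<le> (40553 / 10000 :: real)"
  "exp (137 / 100) \<le> (3936 / 1000 :: real)" "exp (165 / 100) \<le> (52075 / 10000 :: real)"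
  "exp (11 / 5) \<le> (9026 / 1000 :: real)" "exp (14 / 5) \<le> (16446 / 1000 :: real)"
proof -
  note s = lessThan_nat_numeral fact_numeral power_divide
  show "exp 1 \<le> (27183 / 10000 :: real)" by (rule exp_le_Taylor_even[of 10]) (simp_all add: s)
  show "27182 / 10000 \<le> (exp 1 :: real)"
    by (rule order_trans[OF _ exp_ge_Taylor_even[of 10]]) (simp_all add: s)
  show "exp (6931 / 10000) \<le> (2 :: real)" by (rule exp_le_Taylor_even[of 10]) (simp_all add: s)
  show "exp (7 / 5) \<le> (40553 / 10000 :: real)" by (rule exp_le_Taylor_even[of 12]) (simp_all add: s)
  show "exp (137 / 100) \<le> (3936 / 1000 :: real)" by (rule exp_le_Taylor_even[of 12]) (simp_all add: s)
  show "exp (165 / 100) \<le> (52075 / 10000 :: real)" by (rule exp_le_Taylor_even[of 14]) (simp_all add: s)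
  show "exp (11 / 5) \<le> (9026 / 1000 :: real)" by (rule exp_le_Taylor_even[of 16]) (simp_all add: s)
  show "exp (14 / 5) \<le> (16446 / 1000 :: real)" by (rule exp_le_Taylor_even[of 18]) (simp_all add: s)
qed

text \<open>The surplus exponents of \<open>chernoff_pair\<close> at \<open>L = 14/5\<close> and at
  \<open>L = 11/5\<close>, rounded.\<close>

lemma exp_neg_numeric:
  "exp (- (162 / 100)) \<le> (198 / 1000 :: real)" "exp (- 3) \<le> (499 / 10000 :: real)"
  "exp (- (128 / 100)) \<le> (2781 / 10000 :: real)" "exp (- (237 / 100)) \<le> (936 / 10000 :: real)"
proof -
  have *: "exp (- x) \<le> c" if "1 \<le> c * (\<Sum>m<12. x ^ m / fact m)" "0 \<le> c" for x c :: real
    using exp_le_Taylor_even[of 12 c "- x"] that by simp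
  note s = lessThan_nat_numeral fact_numeral power_divide
  show "exp (- (162 / 100)) \<le> (198 / 1000 :: real)" by (rule *) (simp_all add: s)
  show "exp (- 3) \<le> (499 / 10000 :: real)" by (rule *) (simp_all add: s)
  show "exp (- (128 / 100)) \<le> (2781 / 10000 :: real)" by (rule *) (simp_all add: s)
  show "exp (- (237 / 100)) \<le> (936 / 10000 :: real)" by (rule *) (simp_all add: s)
qed

lemma ln2_ge: "6931 / 10000 \<le> ln (2 :: real)"
  by (subst ln_ge_iff) (use exp_numeric(3) in auto)

text \<open>The function \<open>x - n ln x\<close> is convex.\<close>

lemma exp_le_power_interval:
  fixes x l u c :: real
  assumes "0 < l" "l \<le> x" "x \<le> u" and l: "exp l \<le> c * l ^ n" and u: "exp u \<le> c * u ^ n"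
  shows "exp x \<le> c * x ^ n"
proof -
  have "0 < c * l ^ n" using exp_gt_zero[of l] l by linarith
  then have c: "0 < c" using assms(1) by (simp add: zero_less_mult_iff)
  have up: "0 < u" "0 < x" using assms by auto
  have ln_le: "z \<le> ln c + real n * ln z" if "exp z \<le> c * z ^ n" "0 < z" for z
  proof -
    have "z \<le> ln (c * z ^ n)" using that c by (subst ln_ge_iff) auto
    then show ?thesis using that c by (simp add: ln_mult ln_realpow)
  qed
  have "x \<le> ln c + real n * ln x"
  proof (cases "l = u")
    case True
    then show ?thesis using assms ln_le[OF l] by auto
  next
    case False
    define w where "w = (x - l) / (u - l)"
    have lu: "l < u" using False assms by auto
    have w: "0 \<le> w" "w \<le> 1" using assms lu by (simp_all add: w_def)
    have "w * (u - l) = x - l" using lu by (simp add: w_def)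
    then have x: "x = (1 - w) * l + w * u" by (simp add: algebra_simps)
    have "(1 - w) * ln l + w * ln u \<le> ln ((1 - w) *\<^sub>R l + w *\<^sub>R u)"
      by (rule concave_onD[OF ln_concave]) (use w assms up in auto)
    then have "real n * ((1 - w) * ln l + w * ln u) \<le> real n * ln x" unfolding x
      by (intro mult_left_mono) auto
    moreover have "(1 - w) * l + w * u \<le> (1 - w) * (ln c + real n * ln l) + w * (ln c + real n * ln u)"
      using w by (intro add_mono mult_left_mono ln_le[OF l] ln_le[OF u] up assms) auto
    ultimately show ?thesis unfolding x[symmetric] by (simp add: algebra_simps)
  qed
  then have "exp x \<le> exp (ln c + real n * ln x)" by simp
  also have "\<dots> = c * x ^ n" using c up by (simp add: exp_add exp_of_nat_mult)
  finally show ?thesis .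
qed

text \<open>Chebyshev on an atom with second moment \<open>K * V\<close> and
  \<open>V = 2 L / e\<close> reaches \<open>2 exp (- L)\<close> exactly under this inequality. Near
  \<open>L = ln 2\<close> it forces \<open>K\<close> below about 3.77; a smaller \<open>K\<close>
  extends the admissible range of \<open>L\<close>.\<close>

lemma second_moment_switch:
  fixes L K :: real
  assumes "ln 2 \<le> L"
    and "K \<le> 94 / 25 \<and> L \<le> 137 / 100 \<or> K \<le> 344 / 100 \<and> L \<le> 165 / 100 \<or> K \<le> 265 / 100 \<and> L \<le> 11 / 5"
  shows "K * exp L \<le> 4 * exp 1 * L"
proof -
  note e = exp_numeric
  have L: "6931 / 10000 \<le> L" using assms(1) ln2_ge by linarith
  \<comment> \<open>108728/10000 is 4 times the lower bound 27182/10000 for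
    \<open>e\<close>.\<close>
  have *: "K * exp L \<le> 4 * exp 1 * L" if "K \<le> K'" "L \<le> u" "0 < K'" "exp u \<le> (108728 / (10000 * K')) * u ^ 1"
     "K' \<le> 94 / 25" for K' u
  proof -
    have "2 / (6931 / 10000) \<le> 108728 / (10000 * K')" using that by (simp add: field_simps)
    then have "2 \<le> 108728 / (10000 * K') * (6931 / 10000)" by (subst (asm) pos_divide_le_eq) auto
    with e(3) have "exp (6931 / 10000) \<le> 108728 / (10000 * K') * (6931 / 10000) ^ 1" by simp
    from exp_le_power_interval[OF _ L that(2) this that(4)]
    have "exp L \<le> (108728 / (10000 * K')) * L ^ 1" by simp
    then have "K' * exp L \<le> K' * ((108728 / (10000 * K')) * L ^ 1)" using that by (intro mult_left_mono) auto
    also have "\<dots> = 108728 / 10000 * L" using that by simp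
    also have "\<dots> \<le> 4 * exp 1 * L" using e L by (intro mult_right_mono) auto
    also have "K * exp L \<le> K' * exp L" using that by (intro mult_right_mono) auto
    finally show ?thesis by simp
  qed
  from assms(2) consider "K \<le> 94 / 25" "L \<le> 137 / 100" | "K \<le> 344 / 100" "L \<le> 165 / 100"
    | "K \<le> 265 / 100" "L \<le> 11 / 5" by blast
  then show ?thesis
  proof cases
    case 1
    then show ?thesis by (rule *) (use e(5) in simp_all)
  next
    case 2
    then show ?thesis by (rule *) (use e(6) in simp_all)
  next
    case 3
    then show ?thesis by (rule *) (use e(7) in simp_all)
  qed
qed

text \<open>The left side is \<open>(3 V\<^sup>2 + V) / (2 L) ^ 4\<close> for
  \<open>V = 2 L / e\<close>. \<open>c\<close> and \<open>d\<close> bound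
  \<open>exp L / L ^ 2\<close> and \<open>exp L / L ^ 3\<close> at both ends of the interval, hence
  throughout; 4064 and 1840 encode \<open>3 / (4 e\<^sup>2)\<close> and
  \<open>1 / (8 e)\<close>.\<close>

lemma fourth_moment_switch:
  fixes L P l u c d :: real
  assumes "0 < u" "l \<le> L" "L \<le> u" "0 < l" and
    "exp l \<le> c * l ^ 2" "exp u \<le> c * u ^ 2" "exp l \<le> d * l ^ 3" "exp u \<le> d * u ^ 3"
    "4064 * c + 1840 * d \<le> 40000 * P"
  shows "3 / (4 * (exp 1)\<^sup>2 * L\<^sup>2) + 1 / (8 * exp 1 * L ^ 3) \<le> exp (- L) * P"
proof -
  have L: "0 < L" using assms by simp
  have 2: "exp L \<le> c * L ^ 2" by (rule exp_le_power_interval[where l = l and u = u]) (use assms in auto)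
  have 3: "exp L \<le> d * L ^ 3" by (rule exp_le_power_interval[where l = l and u = u]) (use assms in auto)
  have c0: "0 \<le> c" "0 \<le> d"
    using 2 3 L exp_gt_zero[of L] by (smt (verit) mult_neg_pos zero_less_power)+
  have e2: "(27182 / 10000)\<^sup>2 \<le> (exp 1 :: real)\<^sup>2" using exp_numeric by (intro power_mono) auto
  have i2: "3 / (4 * (exp 1)\<^sup>2) \<le> (1016 / 10000 :: real)"
    using e2 by (simp add: field_simps power2_eq_square)
  have i3: "1 / (8 * exp 1) \<le> (460 / 10000 :: real)"
    using exp_numeric by (simp add: field_simps)
  have "exp L * (3 / (4 * (exp 1)\<^sup>2 * L\<^sup>2) + 1 / (8 * exp 1 * L ^ 3))
     = (exp L / L ^ 2) * (3 / (4 * (exp 1)\<^sup>2)) + (exp L / L ^ 3) * (1 / (8 * exp 1))"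
    using L by (simp add: field_simps)
  also have "\<dots> \<le> c * (1016 / 10000) + d * (460 / 10000)"
    using 2 3 L c0 i2 i3 by (intro add_mono mult_mono) (auto simp: pos_divide_le_eq)
  also have "\<dots> \<le> P" using assms by simp
  finally have "exp (- L) * (exp L * (3 / (4 * (exp 1)\<^sup>2 * L\<^sup>2) + 1 / (8 * exp 1 * L ^ 3))) \<le> exp (- L) * P"
    by (intro mult_left_mono) auto
  then show ?thesis by (simp add: mult.assoc[symmetric] exp_add[symmetric])
qed

section \<open>Tail bounds for the centred sum, unconditional and on one atom\<close>

context bernoulli_family begin

text \<open>The parameter 7/5 is close to \<open>ln (1 + e)\<close>, which minimises the exponent of
  the \<open>psi\<close> term. Beyond \<open>exp (- L)\<close> a surplus decay remains, to be spent
  on the probability of the conditioning event.\<close>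

lemma chernoff_pair:
  assumes y: "\<And>n. n \<in> I \<Longrightarrow> \<bar>y n\<bar> \<le> 1" and V: "(\<Sum>n\<in>I. vn n * (y n)\<^sup>2) \<le> 2 * L / exp 1" and L: "0 \<le> L"
  shows "exp (- (7 / 5) * (2 * L)) * (mgf y (7 / 5) + mgf y (- (7 / 5)))
     \<le> exp (- L) * (exp (- (582 / 1000) * L) + exp (- (1078 / 1000) * L))"
proof -
  define c where "c = 2 / exp (1 :: real)"
  have c: "0 \<le> c" "c \<le> 7358 / 10000" using exp_numeric unfolding c_def by (simp_all add: field_simps)
  have ps: "psi (7 / 5) \<le> 16553 / 10000" using exp_numeric by (simp add: psi_def)
  have ps0: "0 \<le> psi (7 / 5)" using exp_ge_add_one_self[of "7 / 5"] by (simp add: psi_def)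
  have A: "c * psi (7 / 5) \<le> 7358 / 10000 * (16553 / 10000)" using c ps ps0 by (intro mult_mono) auto
  have B: "c * ((7 / 5)\<^sup>2 / 2) \<le> 7358 / 10000 * ((7 / 5)\<^sup>2 / 2)" using c by (intro mult_right_mono) auto
  have "L * (c * psi (7 / 5)) \<le> L * (7358 / 10000 * (16553 / 10000))" using A L by (rule mult_left_mono)
  then have e1: "exp (- (7 / 5) * (2 * L)) * exp (2 * L / exp 1 * psi (7 / 5)) \<le> exp (- L) * exp (- (582 / 1000) * L)"
    using L unfolding exp_add[symmetric] exp_le_cancel_iff c_def by simp
  have "L * (c * ((7 / 5)\<^sup>2 / 2)) \<le> L * (7358 / 10000 * ((7 / 5)\<^sup>2 / 2))" using B L by (rule mult_left_mono)
  then have e2: "exp (- (7 / 5) * (2 * L)) * exp (2 * L / exp 1 * ((7 / 5)\<^sup>2 / 2)) \<le> exp (- L) * exp (- (1078 / 1000) * L)"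
    using L unfolding exp_add[symmetric] exp_le_cancel_iff c_def by (simp add: power2_eq_square)
  have "mgf y (7 / 5) + mgf y (- (7 / 5)) \<le> exp (2 * L / exp 1 * psi (7 / 5)) + exp (2 * L / exp 1 * ((7 / 5)\<^sup>2 / 2))"
    by (rule mgf_two_sided[OF y _ V]) auto
  then have "exp (- (7 / 5) * (2 * L)) * (mgf y (7 / 5) + mgf y (- (7 / 5)))
     \<le> exp (- (7 / 5) * (2 * L)) * (exp (2 * L / exp 1 * psi (7 / 5)) + exp (2 * L / exp 1 * ((7 / 5)\<^sup>2 / 2)))"
    by (rule mult_left_mono) simp
  also have "\<dots> \<le> exp (- L) * (exp (- (582 / 1000) * L) + exp (- (1078 / 1000) * L))"
    unfolding distrib_left by (rule add_mono[OF e1 e2])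
  finally show ?thesis .
qed

text \<open>Conditioning is paid for by \<open>P\<close> alone. Chebyshev serves up to
  \<open>L = 1\<close> (with 25/94 dictated by \<open>L = ln 2\<close>), the fourth moment up to
  14/5, Chernoff beyond. Smaller \<open>P\<close> suffices for larger \<open>L\<close>; the entry
  points 137/100 and 165/100 are where the second moment on atoms stops working.\<close>

lemma unconditional_tail:
  assumes y: "\<And>n. n \<in> I \<Longrightarrow> \<bar>y n\<bar> \<le> 1" and V: "(\<Sum>n\<in>I. vn n * (y n)\<^sup>2) \<le> 2 * L / exp 1" and L: "ln 2 \<le> L"
    and P: "25 / 94 \<le> P \<or> 137 / 100 \<le> L \<and> 1435 / 10000 \<le> P \<or> 165 / 100 \<le> L \<and> 127 / 1000 \<le> P"
  shows "ex (\<lambda>A. of_bool (2 * L < \<bar>centred_sum y A\<bar> \<and> Q A)) \<le> 2 * exp (- L) * P"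
proof -
  define b where "b = ex (\<lambda>A. of_bool (2 * L < \<bar>centred_sum y A\<bar>))"
  have L0: "6931 / 10000 \<le> L" using L ln2_ge by linarith
  have "0 < 2 * L" using L0 by simp
  note tl = tail_second[OF this V y, folded b_def]
  note e = exp_numeric
  have four: "b \<le> exp (- L) * (2 * P)" if "3 / (4 * (exp 1)\<^sup>2 * L\<^sup>2) + 1 / (8 * exp 1 * L ^ 3) \<le> exp (- L) * (2 * P)"
  proof -
    have "(3 * (2 * L / exp 1)\<^sup>2 + 2 * L / exp 1) / (2 * L) ^ 4 = 3 / (4 * (exp 1)\<^sup>2 * L\<^sup>2) + 1 / (8 * exp 1 * L ^ 3)"
      using L0 by (simp add: field_simps eval_nat_numeral)
    then show ?thesis using tl(2) that by linarith
  qed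
  have P127: "127 / 1000 \<le> P" using P by linarith
  have "b \<le> exp (- L) * (2 * P)"
  proof (cases "14 / 5 \<le> L")
    case True
    have mg: "ex (\<lambda>A. exp (s * centred_sum y A)) = mgf y s" for s by (rule ex_exp_centred_sum)
    have "ex (\<lambda>A. of_bool (2 * L < \<bar>centred_sum y A\<bar> \<and> True)) \<le> exp (- (7 / 5) * (2 * L)) * (ex (\<lambda>A. exp (7 / 5 * centred_sum y A) * of_bool True) + ex (\<lambda>A. exp (- (7 / 5) * centred_sum y A) * of_bool True))"
      by (rule tail_exp) simp
    then have "b \<le> exp (- (7 / 5) * (2 * L)) * (mgf y (7 / 5) + mgf y (- (7 / 5)))"
      unfolding b_def of_bool_eq mult_1_right mg simp_thms by simp
    also have "\<dots> \<le> exp (- L) * (exp (- (582 / 1000) * L) + exp (- (1078 / 1000) * L))"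
      by (rule chernoff_pair[OF y V]) (use L0 in auto)
    also have "\<dots> \<le> exp (- L) * (198 / 1000 + 499 / 10000)"
    proof (intro mult_left_mono add_mono)
      have "exp (- (582 / 1000) * L) \<le> exp (- (162 / 100))" "exp (- (1078 / 1000) * L) \<le> exp (- 3)"
        using True by auto
      then show "exp (- (582 / 1000) * L) \<le> 198 / 1000" "exp (- (1078 / 1000) * L) \<le> 499 / 10000"
        using exp_neg_numeric(1,2) by linarith+
    qed simp
    also have "\<dots> \<le> exp (- L) * (2 * P)" using P127 by (intro mult_left_mono) auto
    finally show ?thesis .
  next
    case False
    consider "L \<le> 1" "25 / 94 \<le> P" | "1 \<le> L" "L \<le> 14 / 5" "25 / 94 \<le> P" | "137 / 100 \<le> L" "L \<le> 14 / 5" "1435 / 10000 \<le> P"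
      | "165 / 100 \<le> L" "L \<le> 11 / 5" "127 / 1000 \<le> P" | "11 / 5 \<le> L" "L \<le> 14 / 5" "127 / 1000 \<le> P"
      using P False by linarith
    then show ?thesis
    proof cases
      case 1
      have "exp L \<le> (28857 / 10000) * L ^ 1"
        by (rule exp_le_power_interval[where l = "6931 / 10000" and u = 1]) (use L0 1 e in auto)
      then have "exp L * (1 / L) \<le> 28857 / 10000" using L0 by (simp add: field_simps)
      moreover have "1 / (2 * exp 1) \<le> (1840 / 10000 :: real)" using e by (simp add: field_simps)
      ultimately have "(exp L * (1 / L)) * (1 / (2 * exp 1)) \<le> 28857 / 10000 * (1840 / 10000)"
        using L0 by (intro mult_mono) auto
      also have "\<dots> \<le> 2 * P" using 1 by simp
      finally have "exp (- L) * (exp L * (1 / L) * (1 / (2 * exp 1))) \<le> exp (- L) * (2 * P)"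
        by (intro mult_left_mono) auto
      moreover have "2 * L / exp 1 / (2 * L)\<^sup>2 = exp (- L) * (exp L * (1 / L) * (1 / (2 * exp 1)))"
        using L0 by (simp add: exp_minus field_simps power2_eq_square)
      ultimately show ?thesis using tl(1) by linarith
    next
      case 2
      show ?thesis
        by (rule four, rule fourth_moment_switch[where l = 1 and u = "14 / 5" and c = "28 / 10" and d = "28 / 10"])
          (use 2 e in \<open>auto simp: eval_nat_numeral\<close>)
    next
      case 3
      show ?thesis
        by (rule four, rule fourth_moment_switch[where l = "137 / 100" and u = "14 / 5" and c = "2099 / 1000" and d = "1533 / 1000"])
          (use 3 e in \<open>auto simp: eval_nat_numeral\<close>)
    next
      case 4
      show ?thesis
        by (rule four, rule fourth_moment_switch[where l = "165 / 100" and u = "11 / 5" and c = "1914 / 1000" and d = "1161 / 1000"])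
          (use 4 e in \<open>auto simp: eval_nat_numeral\<close>)
    next
      case 5
      show ?thesis
        by (rule four, rule fourth_moment_switch[where l = "11 / 5" and u = "14 / 5" and c = "2099 / 1000" and d = "849 / 1000"])
          (use 5 e in \<open>auto simp: eval_nat_numeral\<close>)
    qed
  qed
  moreover have "ex (\<lambda>A. of_bool (2 * L < \<bar>centred_sum y A\<bar> \<and> Q A)) \<le> b" unfolding b_def
    by (rule ex_mono) auto
  ultimately show ?thesis by simp
qed

lemma atom_tail_second:
  assumes V: "(\<Sum>n\<in>I. vn n * (y n)\<^sup>2) \<le> 2 * L / exp 1" and L: "ln 2 \<le> L" and K0: "0 \<le> K"
    and K: "K \<le> 94 / 25 \<and> L \<le> 137 / 100 \<or> K \<le> 344 / 100 \<and> L \<le> 165 / 100 \<or> K \<le> 265 / 100 \<and> L \<le> 11 / 5"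
    and m: "ex (\<lambda>A. (centred_sum y A)\<^sup>2 * of_bool (int (card A) = m)) \<le> K * (\<Sum>n\<in>I. vn n * (y n)\<^sup>2) * a m"
  shows "ex (\<lambda>A. of_bool (2 * L < \<bar>centred_sum y A\<bar> \<and> int (card A) = m)) \<le> 2 * exp (- L) * a m"
proof -
  define b where "b = ex (\<lambda>A. of_bool (2 * L < \<bar>centred_sum y A\<bar> \<and> int (card A) = m))"
  have L0: "6931 / 10000 \<le> L" using L ln2_ge by linarith
  have "(2 * L)\<^sup>2 * b \<le> ex (\<lambda>A. (centred_sum y A)\<^sup>2 * of_bool (int (card A) = m))"
    unfolding b_def
  proof (rule markov_restricted)
    fix A assume "2 * L < \<bar>centred_sum y A\<bar>"
    then have "(2 * L)\<^sup>2 \<le> \<bar>centred_sum y A\<bar>\<^sup>2" using L0 by (intro power_mono) auto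
    then show "(2 * L)\<^sup>2 \<le> (centred_sum y A)\<^sup>2" by simp
  qed (use L0 in auto)
  also note m
  also have "K * (\<Sum>n\<in>I. vn n * (y n)\<^sup>2) * a m \<le> K * (2 * L / exp 1) * a m"
    using V K0 a_nonneg by (intro mult_right_mono mult_left_mono) auto
  finally have "(2 * L)\<^sup>2 * b \<le> K * (2 * L / exp 1) * a m" .
  then have "(2 * L) * (2 * L * b) \<le> (2 * L) * (K / exp 1 * a m)"
    by (simp add: power2_eq_square mult_ac)
  then have "2 * L * b \<le> K / exp 1 * a m" by (rule mult_left_le_imp_le) (use L0 in simp)
  then have 1: "2 * exp 1 * L * b \<le> K * a m" by (simp add: field_simps)
  have "exp L * (2 * exp 1 * L * b) \<le> exp L * (K * a m)" using 1 by (intro mult_left_mono) auto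
  also have "\<dots> = (K * exp L) * a m" by simp
  also have "\<dots> \<le> (4 * exp 1 * L) * a m"
    by (intro mult_right_mono second_moment_switch[OF L K] a_nonneg)
  finally have "(2 * exp 1 * L) * (exp L * b) \<le> (2 * exp 1 * L) * (2 * a m)" by (simp add: mult_ac)
  then have "exp L * b \<le> 2 * a m" using L0 by (subst (asm) mult_le_cancel_left_pos) auto
  then have "exp (- L) * (exp L * b) \<le> exp (- L) * (2 * a m)" by (intro mult_left_mono) auto
  moreover have "exp (- L) * (exp L * b) = b" by (simp add: mult.assoc[symmetric] exp_add[symmetric])
  moreover have "exp (- L) * (2 * a m) = 2 * exp (- L) * a m" by simp
  ultimately show ?thesis unfolding b_def by linarith
qed

text \<open>At \<open>L = 11/5\<close> the surplus of \<open>chernoff_pair\<close> is at most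
  0.3717, which leaves room for a tilted atom bound up to 53/10 times the untilted atom.\<close>

lemma atom_tail_tilt:
  assumes y: "\<And>n. n \<in> I \<Longrightarrow> \<bar>y n\<bar> \<le> 1" and V: "(\<Sum>n\<in>I. vn n * (y n)\<^sup>2) \<le> 2 * L / exp 1" and L: "11 / 5 \<le> L"
    and v: "0 < v" and C: "sqrt (pi * exp (7 / 5) / (2 * v)) / 2 \<le> 53 / 10 * a m"
  shows "ex (\<lambda>A. of_bool (2 * L < \<bar>centred_sum y A\<bar> \<and> int (card A) = m)) \<le> 2 * exp (- L) * a m"
proof -
  define c where "c = sqrt (pi * exp (7 / 5) / (2 * v)) / 2"
  have c0: "0 \<le> c" using v by (simp add: c_def)
  have "ex (\<lambda>A. of_bool (2 * L < \<bar>centred_sum y A\<bar> \<and> int (card A) = m))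
     \<le> exp (- (7 / 5) * (2 * L)) * (ex (\<lambda>A. exp (7 / 5 * centred_sum y A) * of_bool (int (card A) = m)) + ex (\<lambda>A. exp (- (7 / 5) * centred_sum y A) * of_bool (int (card A) = m)))"
    by (rule tail_exp) simp
  also have "\<dots> \<le> exp (- (7 / 5) * (2 * L)) * (mgf y (7 / 5) * c + mgf y (- (7 / 5)) * c)"
    using ex_exp_atom[OF y v, where s = "7 / 5" and k = m] ex_exp_atom[OF y v, where s = "- (7 / 5)" and k = m]
    by (intro mult_left_mono add_mono) (auto simp: c_def)
  also have "\<dots> = (exp (- (7 / 5) * (2 * L)) * (mgf y (7 / 5) + mgf y (- (7 / 5)))) * c"
    by (simp add: distrib_left distrib_right mult_ac)
  also have "\<dots> \<le> (exp (- L) * (exp (- (582 / 1000) * L) + exp (- (1078 / 1000) * L))) * c"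
    using c0 L by (intro mult_right_mono chernoff_pair[OF y V]) auto
  also have "\<dots> \<le> (exp (- L) * (2781 / 10000 + 936 / 10000)) * (53 / 10 * a m)"
  proof (rule mult_mono)
    show "exp (- L) * (exp (- (582 / 1000) * L) + exp (- (1078 / 1000) * L)) \<le> exp (- L) * (2781 / 10000 + 936 / 10000)"
    proof (intro mult_left_mono add_mono)
      have "exp (- (582 / 1000) * L) \<le> exp (- (128 / 100))" "exp (- (1078 / 1000) * L) \<le> exp (- (237 / 100))"
        using L by auto
      then show "exp (- (582 / 1000) * L) \<le> 2781 / 10000" "exp (- (1078 / 1000) * L) \<le> 936 / 10000"
        using exp_neg_numeric(3,4) by linarith+
    qed simp
  qed (use C c0 in \<open>auto simp: c_def\<close>)
  also have "\<dots> \<le> 2 * exp (- L) * a m"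
    using a_nonneg[of m] by (simp add: mult_left_mono)
  finally show ?thesis .
qed

section \<open>Windows around the mean\<close>

definition window_prob :: "real \<Rightarrow> real" where
  "window_prob r = ex (\<lambda>A. of_bool (\<bar>real (card A) - \<mu>\<bar> \<le> r))"

lemma sum_vn_sq_nonneg: "0 \<le> (\<Sum>n\<in>I. vn n * (y n)\<^sup>2)"
  by (intro sum_nonneg mult_nonneg_nonneg) (use p01' in auto)

text \<open>The hypotheses of \<open>second_moment_decay\<close> are hardest at the largest distance
  \<open>t1\<close> and the least variance \<open>v0\<close>. For \<open>t \<le> 1\<close> the
  squared shifts contribute \<open>c - d * t\<close>, hence \<open>max 1 t1\<close>.\<close>

lemma second_moment_const:
  assumes am: "0 < a m" and t: "\<mu> \<le> of_int m" "of_int m \<le> \<mu> + t1" and v0: "2 \<le> v0" "v0 \<le> v" and ck: "0 \<le> c" "0 \<le> k"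
    and c: "\<And>x. 0 \<le> x \<Longrightarrow> x \<le> 1 \<Longrightarrow> t1 + x \<le> c * (v0 - (1 - x) * (t1 + 2 * x))"
    and k: "\<And>x. 0 \<le> x \<Longrightarrow> x \<le> 1 / 2 \<Longrightarrow> (1 - 2 * x) * (t1 + x) \<le> k * (v0 - (1 - x) * (t1 + 2 * x))"
    and k2: "1 \<le> 8 * k * (v0 - 1 / 2)" and pos: "t1 + 1 / 2 < v0"
    and K: "2 * (1 + k) + c * max 1 t1 \<le> K"
  shows "ex (\<lambda>A. (centred_sum y A)\<^sup>2 * of_bool (int (card A) = m)) \<le> K * (\<Sum>n\<in>I. vn n * (y n)\<^sup>2) * a m"
proof -
  define t where "t = of_int m - \<mu>"
  define d where "d = max 0 (1 - t) / v"
  have t': "0 \<le> t" "t \<le> t1" using t by (auto simp: t_def)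
  have mono: "v0 - (1 - x) * (t1 + 2 * x) \<le> v - (1 - x) * (t + 2 * x)" if "0 \<le> x" "x \<le> 1" for x
  proof -
    have "(1 - x) * (t + 2 * x) \<le> (1 - x) * (t1 + 2 * x)" using that t' by (intro mult_left_mono) auto
    then show ?thesis using v0 by linarith
  qed
  have "ex (\<lambda>A. (centred_sum y A)\<^sup>2 * of_bool (int (card A) = m))
     \<le> (2 * (1 + k) + ((c - d) * t + c * d * v)) * (\<Sum>n\<in>I. vn n * (y n)\<^sup>2) * a m"
  proof (rule second_moment_decay[OF am _ t_def t'(1) _ _ _ _ d_def])
    show "2 \<le> v" using v0 by simp
    show "(1 - x) * (t + 2 * x) < v" if "0 \<le> x" "x \<le> 1" for x
    proof -
      have "0 \<le> (x - 1 / 2)\<^sup>2" "0 \<le> x * t" using that t' by auto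
      then have "(1 - x) * (t + 2 * x) \<le> t + 1 / 2" by (simp add: power2_eq_square algebra_simps)
      then show ?thesis using pos t' v0 by linarith
    qed
    show "t + x \<le> c * (v - (1 - x) * (t + 2 * x))" if "0 \<le> x" "x \<le> 1" for x
      using c[OF that] mult_left_mono[OF mono[OF that] ck(1)] t' by linarith
    show "(1 - 2 * x) * (t + x) \<le> k * (v - (1 - x) * (t + 2 * x))" if x: "0 \<le> x" "x \<le> 1 / 2" for x
    proof -
      have "(1 - 2 * x) * (t + x) \<le> (1 - 2 * x) * (t1 + x)" using x t' by (intro mult_left_mono) auto
      moreover have "k * (v0 - (1 - x) * (t1 + 2 * x)) \<le> k * (v - (1 - x) * (t + 2 * x))"
        using ck x by (intro mult_left_mono mono) auto
      ultimately show ?thesis using k[OF x] by linarith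
    qed
    have "8 * k * (v0 - 1 / 2) \<le> 8 * k * (v - 1 / 2)" using ck v0 by (intro mult_left_mono) auto
    then show "1 \<le> 8 * k * (v - 1 / 2)" using k2 by linarith
  qed
  also have "\<dots> \<le> K * (\<Sum>n\<in>I. vn n * (y n)\<^sup>2) * a m"
  proof (intro mult_right_mono sum_vn_sq_nonneg a_nonneg)
    have "(c - d) * t + c * d * v \<le> c * max 1 t1"
    proof (cases "t \<le> 1")
      case True
      have "d * v = 1 - t" using True v0 by (simp add: d_def)
      moreover have "(c - d) * t + c * d * v = c * t - d * t + c * (d * v)" by (simp add: algebra_simps)
      ultimately have "(c - d) * t + c * d * v = c * t - d * t + c * (1 - t)" by (simp only:)
      then have "(c - d) * t + c * d * v = c - d * t" by (simp add: algebra_simps)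
      also have "\<dots> \<le> c * 1" using t' v0 by (simp add: d_def)
      also have "\<dots> \<le> c * max 1 t1" using ck by (intro mult_left_mono) auto
      finally show ?thesis .
    next
      case False
      then have "d = 0" by (simp add: d_def)
      moreover have "c * t \<le> c * max 1 t1" using ck t' by (intro mult_left_mono) auto
      ultimately show ?thesis by simp
    qed
    then show "2 * (1 + k) + ((c - d) * t + c * d * v) \<le> K" using K by linarith
  qed
  finally show ?thesis .
qed

text \<open>Once \<open>(1 + t) * (t + 2) \<le> v\<close>, the shift bound
  \<open>c = (1 + t) / v\<close> is admissible, and the contribution of the squared shifts decays
  like \<open>1 / v\<close>.\<close>

lemma second_moment_large:
  assumes am: "0 < a m" and t: "t = of_int m - \<mu>" "0 \<le> t" and v: "(1 + t) * (t + 2) \<le> v"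
    and k: "\<And>x. 0 \<le> x \<Longrightarrow> x \<le> 1 / 2 \<Longrightarrow> (1 - 2 * x) * (t + x) \<le> k * (v - (1 - x) * (t + 2 * x))"
    and k2: "1 \<le> 8 * k * (v - 1 / 2)"
    and K: "2 * (1 + k) + (if t \<le> 1 then 1 + t\<^sup>2 else t * (1 + t)) / v \<le> K"
  shows "ex (\<lambda>A. (centred_sum y A)\<^sup>2 * of_bool (int (card A) = m)) \<le> K * (\<Sum>n\<in>I. vn n * (y n)\<^sup>2) * a m"
proof -
  define d where "d = max 0 (1 - t) / v"
  define c where "c = (1 + t) / v"
  have tt: "0 \<le> t * t" by simp
  have e: "(1 + t) * (t + 2) = t * t + 3 * t + 2" by (simp add: algebra_simps)
  have v2: "2 \<le> v" using v t(2) tt unfolding e by linarith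
  have "ex (\<lambda>A. (centred_sum y A)\<^sup>2 * of_bool (int (card A) = m))
     \<le> (2 * (1 + k) + ((c - d) * t + c * d * v)) * (\<Sum>n\<in>I. vn n * (y n)\<^sup>2) * a m"
  proof (rule second_moment_decay[OF am v2 t _ _ k k2 d_def])
    fix x :: real assume x: "0 \<le> x" "x \<le> 1"
    have "0 \<le> (x - 1 / 2)\<^sup>2" "0 \<le> x * t" using x t by auto
    then have "(1 - x) * (t + 2 * x) \<le> t + 1 / 2" by (simp add: power2_eq_square algebra_simps)
    also have "\<dots> < (1 + t) * (t + 2)" using t(2) tt unfolding e by linarith
    finally show "(1 - x) * (t + 2 * x) < v" using v by linarith
    have "(1 + t) * ((1 - x) * (t + 2 * x)) = (1 - x) * ((1 + t) * (t + 2 * x))" by simp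
    also have "\<dots> \<le> (1 - x) * ((1 + t) * (t + 2))" using x t by (intro mult_left_mono) auto
    also have "\<dots> \<le> (1 - x) * v" using x v by (intro mult_left_mono) auto
    finally have "(1 + t) * (v - (1 - x) * (t + 2 * x)) \<ge> (t + x) * v" by (simp add: algebra_simps)
    then show "t + x \<le> c * (v - (1 - x) * (t + 2 * x))" using v2 by (simp add: c_def pos_le_divide_eq)
  qed
  also have "\<dots> \<le> K * (\<Sum>n\<in>I. vn n * (y n)\<^sup>2) * a m"
  proof (intro mult_right_mono sum_vn_sq_nonneg a_nonneg)
    have "(c - d) * t + c * d * v = (if t \<le> 1 then 1 + t\<^sup>2 else t * (1 + t)) / v"
      using v2 by (simp add: c_def d_def field_simps power2_eq_square)
    then show "2 * (1 + k) + ((c - d) * t + c * d * v) \<le> K" using K by linarith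
  qed
  finally show ?thesis .
qed

text \<open>Here \<open>d = 0\<close>, and the condition on \<open>k\<close> for all
  \<open>x\<close> follows from its instance \<open>x = 0\<close>, namely
  \<open>t \<le> k * (v - t)\<close>.\<close>

lemma second_moment_far:
  assumes am: "0 < a m" and t: "t = of_int m - \<mu>" "3 / 2 \<le> t" and v: "(1 + t) * (t + 2) \<le> v"
    and k: "0 \<le> k" "k \<le> 4" "t \<le> k * (v - t)" and s: "t * (1 + t) \<le> s * v" and K: "2 * (1 + k) + s \<le> K"
  shows "ex (\<lambda>A. (centred_sum y A)\<^sup>2 * of_bool (int (card A) = m)) \<le> K * (\<Sum>n\<in>I. vn n * (y n)\<^sup>2) * a m"
proof (rule second_moment_large[OF am t(1) _ v])
  show "0 \<le> t" using t by simp
  have tt: "0 \<le> t * t" by simp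
  have e: "(1 + t) * (t + 2) = t * t + 3 * t + 2" by (simp add: algebra_simps)
  have v2: "0 < v" using v t(2) tt unfolding e by linarith
  show "(1 - 2 * x) * (t + x) \<le> k * (v - (1 - x) * (t + 2 * x))" if x: "0 \<le> x" "x \<le> 1 / 2" for x
  proof -
    have "k * (1 / 2) + k * (t - 2) = k * (t - 3 / 2)" by (simp add: algebra_simps)
    moreover have "0 \<le> k * (t - 3 / 2)" using k t by (intro mult_nonneg_nonneg) auto
    ultimately have "0 \<le> k * (t - 2) + 2 * t - 1" using k t by linarith
    then have "0 \<le> x * (k * (t - 2) + 2 * t - 1)" using x by (intro mult_nonneg_nonneg) auto
    moreover have "0 \<le> 2 * (1 + k) * x\<^sup>2" using k by (intro mult_nonneg_nonneg) auto
    ultimately have "(1 - 2 * x) * (t + x) \<le> t + k * ((t - 2) * x + 2 * x\<^sup>2)"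
      by (simp add: power2_eq_square algebra_simps)
    also have "\<dots> \<le> k * (v - t) + k * ((t - 2) * x + 2 * x\<^sup>2)" using k by simp
    also have "\<dots> = k * (v - (1 - x) * (t + 2 * x))" by (simp add: power2_eq_square algebra_simps)
    finally show ?thesis .
  qed
  have "8 * (k * (v - t)) \<le> 8 * (k * (v - 1 / 2))" using k t by (intro mult_left_mono) auto
  then show "1 \<le> 8 * k * (v - 1 / 2)" using k t by (simp add: mult.assoc)
  have "t * (1 + t) / v \<le> s" using s v2 by (simp add: pos_divide_le_eq)
  then show "2 * (1 + k) + (if t \<le> 1 then 1 + t\<^sup>2 else t * (1 + t)) / v \<le> K"
    using K t by simp
qed

text \<open>Expresses the loss of \<open>near_mode_right\<close> by the distance
  \<open>t = m - \<mu>\<close>: completing the square bounds it by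
  \<open>(t + 1/2)\<^sup>2 / 2\<close> with slack \<open>(frac \<mu> - 1/2)\<^sup>2 / 2\<close>.
  Within distance 1/2 at most one step is taken and the loss is \<open>t\<close>.\<close>

lemma right_atom_ge:
  assumes v: "0 < v" and M: "\<And>k. a k \<le> a M" and m: "\<mu> \<le> of_int m"
  shows "a M * (1 - (of_int m - \<mu> + 1 / 2)\<^sup>2 / (2 * v)) \<le> a m"
    and "of_int m \<le> \<mu> + 1 / 2 \<Longrightarrow> a M * (1 - (of_int m - \<mu>) / v) \<le> a m"
proof -
  define i where "i = nat (m - \<lfloor>\<mu>\<rfloor>)"
  define loss where "loss = (if i = 0 then 0 else real i * (real i + 1) / 2 - real i * frac \<mu>)"
  have fm: "\<lfloor>\<mu>\<rfloor> \<le> m" using m by (simp add: floor_le_iff)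
  then have mi: "m = \<lfloor>\<mu>\<rfloor> + int i" by (simp add: i_def)
  then have t: "of_int m - \<mu> = real i - frac \<mu>" by (simp add: frac_def)
  have f: "0 \<le> frac \<mu>" "frac \<mu> < 1" by (simp_all add: frac_lt_1)
  have aM: "0 \<le> a M" by (rule a_nonneg)
  have ge: "a M * (1 - loss / v) \<le> a m"
  proof (cases "i = 0")
    case True
    then have f0: "frac \<mu> = 0" using t m f by linarith
    then show ?thesis using near_mode_left[OF v M, of 0, unfolded f0] True mi by (simp add: loss_def)
  next
    case False
    then show ?thesis using near_mode_right[OF v M, of i] mi by (simp add: loss_def)
  qed
  have le: "a M * (1 - L' / v) \<le> a m" if "loss \<le> L'" for L'
  proof -
    have "loss / v \<le> L' / v" using that v by (intro divide_right_mono) auto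
    then have "a M * (1 - L' / v) \<le> a M * (1 - loss / v)" using aM by (intro mult_left_mono) auto
    then show ?thesis using ge by linarith
  qed
  have "loss \<le> (real i - frac \<mu> + 1 / 2)\<^sup>2 / 2"
  proof -
    have "(real i - frac \<mu> + 1 / 2)\<^sup>2 / 2 - (real i * (real i + 1) / 2 - real i * frac \<mu>) = (frac \<mu> - 1 / 2)\<^sup>2 / 2"
      by (simp add: power2_eq_square field_simps)
    moreover have "0 \<le> (frac \<mu> - 1 / 2)\<^sup>2 / 2" "0 \<le> (real i - frac \<mu> + 1 / 2)\<^sup>2 / 2" by auto
    moreover have "loss = 0 \<or> loss = real i * (real i + 1) / 2 - real i * frac \<mu>" by (simp add: loss_def)
    ultimately show ?thesis by linarith
  qed
  from le[OF this] show "a M * (1 - (of_int m - \<mu> + 1 / 2)\<^sup>2 / (2 * v)) \<le> a m" by (simp add: t)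
  show "a M * (1 - (of_int m - \<mu>) / v) \<le> a m" if "of_int m \<le> \<mu> + 1 / 2"
  proof (rule le)
    have "real i < 2" using that t f by linarith
    then consider "i = 0" | "i = 1" by fastforce
    then show "loss \<le> of_int m - \<mu>" unfolding t
    proof cases
      case 1
      then show "loss \<le> real i - frac \<mu>" using t m f by (simp add: loss_def)
    next
      case 2
      then show "loss \<le> real i - frac \<mu>" by (simp add: loss_def)
    qed
  qed
qed

lemma left_atom_ge:
  assumes v: "0 < v" and M: "\<And>k. a k \<le> a M" and m: "of_int m \<le> \<mu>" "\<mu> \<le> of_int m + 1"
  shows "a M * (1 - (\<mu> - of_int m) / v) \<le> a m"
proof (cases "\<mu> = of_int m + 1")
  case True
  then have "\<lfloor>\<mu>\<rfloor> = m + 1" "frac \<mu> = 0" by (simp_all add: frac_def)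
  then show ?thesis using near_mode_left[OF v M, of 1] True by simp
next
  case False
  then have "\<lfloor>\<mu>\<rfloor> = m" using m by (simp add: floor_eq_iff)
  moreover from this have "frac \<mu> = \<mu> - of_int m" by (simp add: frac_def)
  ultimately show ?thesis using near_mode_left[OF v M, of 0] by simp
qed

text \<open>\<open>s\<close> counts the atoms of a window and \<open>r / v\<close> is their total
  relative loss. With the lower bound for the largest atom this gives a cubic inequality in
  \<open>v\<close>. It holds near \<open>v = r / s\<close> and for large \<open>v\<close>; a
  preliminary bound has to single out the latter.\<close>

lemma mode_mass:
  assumes v: "0 < v" and M: "\<And>k. a k \<le> a M" "0 < a M" and P: "a M * (s - r / v) \<le> P" "P \<le> c" and r: "r \<le> s * v"
  shows "(s * v - r)\<^sup>2 \<le> c\<^sup>2 * v\<^sup>2 * (1 + 12 * v)"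
proof -
  have x: "0 \<le> s - r / v" using r v by (simp add: field_simps)
  have sv: "s * v - r = v * (s - r / v)" using v by (simp add: field_simps)
  have "(s - r / v)\<^sup>2 * 1 \<le> (s - r / v)\<^sup>2 * ((a M)\<^sup>2 * (1 + 12 * v))"
    by (intro mult_left_mono max_atom_lower M) auto
  also have "\<dots> = (a M * (s - r / v))\<^sup>2 * (1 + 12 * v)" by (simp add: power_mult_distrib mult_ac)
  also have "\<dots> \<le> c\<^sup>2 * (1 + 12 * v)"
    using x P M v by (intro mult_right_mono power_mono) auto
  finally have "v\<^sup>2 * (s - r / v)\<^sup>2 \<le> v\<^sup>2 * (c\<^sup>2 * (1 + 12 * v))" by (intro mult_left_mono) auto
  then show ?thesis unfolding sv by (simp add: power_mult_distrib mult_ac)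
qed

section \<open>Mass of windows\<close>

lemma atoms_le_window_prob:
  assumes "finite J" "\<And>j. j \<in> J \<Longrightarrow> \<bar>of_int j - \<mu>\<bar> \<le> r"
  shows "(\<Sum>j\<in>J. a j) \<le> window_prob r"
proof -
  have "(\<Sum>j\<in>J. a j) = ex (\<lambda>A. \<Sum>j\<in>J. of_bool (int (card A) = j))"
    unfolding pbin_def by (rule ber_ex_sum[symmetric])
  also have "\<dots> \<le> window_prob r" unfolding window_prob_def
  proof (rule ex_mono)
    fix A assume "A \<subseteq> I"
    have "(\<Sum>j\<in>J. of_bool (int (card A) = j)) = (of_bool (int (card A) \<in> J) :: real)"
      using assms(1) by (simp add: of_bool_def)
    also have "\<dots> \<le> of_bool (\<bar>real (card A) - \<mu>\<bar> \<le> r)" using assms(2)[of "int (card A)"] by auto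
    finally show "(\<Sum>j\<in>J. of_bool (int (card A) = j)) \<le> (of_bool (\<bar>real (card A) - \<mu>\<bar> \<le> r) :: real)" .
  qed
  finally show ?thesis .
qed

text \<open>Pairing the next atom on the right with the next on the left cancels
  \<open>frac \<mu>\<close> and leaves a loss of \<open>(l + 1)\<^sup>2\<close>; the total is a sum
  of squares.\<close>

lemma window_mass:
  assumes v: "0 < v" and M: "\<And>k. a k \<le> a M"
  shows "a M * (2 * real l - real l * (real l + 1) * (2 * real l + 1) / 6 / v) \<le> (\<Sum>j\<in>{\<lfloor>\<mu>\<rfloor> - int l<..\<lfloor>\<mu>\<rfloor> + int l}. a j)"
proof (induction l)
  case (Suc l)
  have J: "{\<lfloor>\<mu>\<rfloor> - int (Suc l)<..\<lfloor>\<mu>\<rfloor> + int (Suc l)}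
     = insert (\<lfloor>\<mu>\<rfloor> + int (Suc l)) (insert (\<lfloor>\<mu>\<rfloor> - int l) {\<lfloor>\<mu>\<rfloor> - int l<..\<lfloor>\<mu>\<rfloor> + int l})"
    by auto
  have "a M * (1 - (real (Suc l) * (real (Suc l) + 1) / 2 - real (Suc l) * frac \<mu>) / v) \<le> a (\<lfloor>\<mu>\<rfloor> + int (Suc l))"
    by (rule near_mode_right[OF v M]) auto
  moreover have "a M * (1 - (real l * (real l + 1) / 2 + (real l + 1) * frac \<mu>) / v) \<le> a (\<lfloor>\<mu>\<rfloor> - int l)"
    by (rule near_mode_left[OF v M])
  moreover have "a M * (2 * real (Suc l) - real (Suc l) * (real (Suc l) + 1) * (2 * real (Suc l) + 1) / 6 / v)
    = a M * (2 * real l - real l * (real l + 1) * (2 * real l + 1) / 6 / v)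
      + a M * (1 - (real (Suc l) * (real (Suc l) + 1) / 2 - real (Suc l) * frac \<mu>) / v)
      + a M * (1 - (real l * (real l + 1) / 2 + (real l + 1) * frac \<mu>) / v)"
    using v by (simp add: field_simps)
  moreover have "(\<Sum>j\<in>{\<lfloor>\<mu>\<rfloor> - int (Suc l)<..\<lfloor>\<mu>\<rfloor> + int (Suc l)}. a j)
    = a (\<lfloor>\<mu>\<rfloor> + int (Suc l)) + (a (\<lfloor>\<mu>\<rfloor> - int l) + (\<Sum>j\<in>{\<lfloor>\<mu>\<rfloor> - int l<..\<lfloor>\<mu>\<rfloor> + int l}. a j))"
    unfolding J by simp
  ultimately show ?case using Suc.IH by linarith
qed simp

text \<open>Chebyshev with the quadratic \<open>(W - \<lfloor>\<mu>\<rfloor>) (W - \<lfloor>\<mu>\<rfloor> - 1)\<close>, which is nonnegative on integers.\<close>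

lemma window_chebyshev:
  assumes l: "1 \<le> l" and J: "\<And>j. j \<in> {\<lfloor>\<mu>\<rfloor> - int l<..\<lfloor>\<mu>\<rfloor> + int l} \<Longrightarrow> \<bar>of_int j - \<mu>\<bar> \<le> r"
  shows "1 - v / (real l * (real l + 1)) \<le> window_prob r"
proof -
  define Q where "Q = real l * (real l + 1)"
  have Q: "0 < Q" using l by (simp add: Q_def)
  define f where "f = frac \<mu>"
  have f: "0 \<le> f" "f \<le> 1" by (simp_all add: f_def less_imp_le frac_lt_1)
  \<comment> \<open>The quadratic equals \<open>l * (l + 1)\<close> at both integers nearest to the
    range of \<open>2 * l\<close> atoms, and its mean is at most \<open>v\<close>.\<close>
  define F where "F = (\<lambda>A :: 'a set. (of_int (int (card A) - \<lfloor>\<mu>\<rfloor>) :: real) * of_int (int (card A) - \<lfloor>\<mu>\<rfloor> - 1))"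
  have "ex F = ex (\<lambda>A. (real (card A) - \<mu>)\<^sup>2 + (2 * f - 1) * (real (card A) - \<mu>) + f * (f - 1))"
    by (rule ber_ex_cong) (simp add: F_def f_def frac_def power2_eq_square algebra_simps)
  also have "\<dots> = v + f * (f - 1)"
    using fin by (simp add: ber_ex_add ber_ex_cmult ex_card_var ex_card_centered)
  also have "\<dots> \<le> v" using f by (simp add: mult_nonneg_nonpos)
  finally have EF: "ex F \<le> v" .
  have "1 - ex F / Q = ex (\<lambda>A. 1 - F A * (1 / Q))"
    using fin by (simp only: ber_ex_diff ber_ex_mult_right ber_ex_const) simp
  also have "\<dots> \<le> window_prob r" unfolding window_prob_def
  proof (rule ex_mono)
    fix A assume "A \<subseteq> I"
    define w where "w = int (card A) - \<lfloor>\<mu>\<rfloor>"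
    have Fw: "F A = of_int (w * (w - 1))" by (simp add: F_def w_def)
    have F0: "0 \<le> F A"
    proof -
      have "0 \<le> w * (w - 1)"
      proof (cases "1 \<le> w")
        case False
        then show ?thesis by (intro mult_nonpos_nonpos) auto
      qed simp
      then show ?thesis unfolding Fw by (simp only: of_int_0_le_iff)
    qed
    show "1 - F A * (1 / Q) \<le> of_bool (\<bar>real (card A) - \<mu>\<bar> \<le> r)"
    proof (cases "int (card A) \<in> {\<lfloor>\<mu>\<rfloor> - int l<..\<lfloor>\<mu>\<rfloor> + int l}")
      case True
      have "0 \<le> F A * (1 / Q)" using F0 Q by simp
      then show ?thesis using J[OF True] by simp
    next
      case False
      then have "int l + 1 \<le> w \<or> w \<le> - int l" by (auto simp: w_def)
      then have "int l * (int l + 1) \<le> w * (w - 1)"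
      proof
        assume "int l + 1 \<le> w"
        then have "int l * (int l + 1) \<le> (w - 1) * w" by (intro mult_mono) auto
        then show ?thesis by (simp add: mult.commute)
      next
        assume "w \<le> - int l"
        then have "int l * (int l + 1) \<le> (- w) * (1 - w)" by (intro mult_mono) auto
        then show ?thesis by (simp add: algebra_simps)
      qed
      then have "of_int (int l * (int l + 1)) \<le> F A" unfolding Fw by (simp only: of_int_le_iff)
      then have "Q \<le> F A" by (simp add: Q_def)
      then have "1 \<le> F A * (1 / Q)" using Q by simp
      then show ?thesis by simp
    qed
  qed
  finally have "1 - ex F / Q \<le> window_prob r" .
  moreover have "ex F / Q \<le> v / Q" using EF Q by (intro divide_right_mono) auto
  ultimately show ?thesis unfolding Q_def by linarith
qed

text \<open>A window that reaches \<open>m\<close> contains \<open>2 * l\<close> atoms placed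
  symmetrically about the floor plus 1/2. The left end is critical; for
  \<open>frac \<mu> > 1/2\<close> integrality gains one more step.\<close>

lemma window_cover:
  assumes l: "real l \<le> of_int m - \<mu> + 1 / 2" and j: "j \<in> {\<lfloor>\<mu>\<rfloor> - int l<..\<lfloor>\<mu>\<rfloor> + int l}"
  shows "\<bar>of_int j - \<mu>\<bar> \<le> of_int m - \<mu>"
proof -
  define i where "i = m - \<lfloor>\<mu>\<rfloor>"
  define f where "f = frac \<mu>"
  have f: "0 \<le> f" "f < 1" by (simp_all add: f_def frac_lt_1)
  have mu: "\<mu> = of_int \<lfloor>\<mu>\<rfloor> + f" by (simp add: f_def frac_def)
  have t: "of_int m - \<mu> = of_int i - f" using mu by (simp add: i_def)
  have "of_int (int l) < (of_int (i + 1) :: real)" using l f unfolding t by simp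
  then have qi: "int l \<le> i" unfolding of_int_less_iff by simp
  have qi2: "int l \<le> i - 1" if "1 / 2 < f"
  proof -
    have "of_int (int l) < (of_int i :: real)" using l that unfolding t by simp
    then show ?thesis unfolding of_int_less_iff by simp
  qed
  have r: "of_int j \<le> (of_int (\<lfloor>\<mu>\<rfloor> + i) :: real)" using j qi unfolding of_int_le_iff by simp
  have l: "\<mu> - of_int j \<le> of_int i - f"
  proof -
    have "of_int (\<lfloor>\<mu>\<rfloor> - int l + 1) \<le> (of_int j :: real)" using j unfolding of_int_le_iff by simp
    then have j1: "of_int \<lfloor>\<mu>\<rfloor> - real l + 1 \<le> of_int j" by simp
    show ?thesis
    proof (cases "1 / 2 < f")
      case True
      then have "of_int (int l) \<le> (of_int (i - 1) :: real)" using qi2 unfolding of_int_le_iff by simp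
      then show ?thesis using j1 mu f by simp
    next
      case False
      then show ?thesis using j1 mu l unfolding t by linarith
    qed
  qed
  have r': "of_int j - \<mu> \<le> of_int i - f" using r mu by simp
  show ?thesis unfolding t using l r' by linarith
qed

text \<open>For distances between 1 and 3/2 the symmetric count yields only two atoms;
  \<open>m\<close>, \<open>m - 1\<close> and \<open>m - 2\<close> all fit, with total loss at most
  3.\<close>

lemma three_atoms:
  assumes v: "0 < v" and M: "\<And>k. a k \<le> a M" and t: "1 \<le> of_int m - \<mu>" "of_int m - \<mu> < 3 / 2" "of_int m - \<mu> \<le> r"
  shows "a M * (3 - 3 / v) \<le> window_prob r"
proof -
  define t where "t = of_int m - \<mu>"
  have t': "1 \<le> t" "t < 3 / 2" "t \<le> r" using t by (auto simp: t_def)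
  have 1: "a M * (1 - (t + 1 / 2)\<^sup>2 / (2 * v)) \<le> a m" using right_atom_ge(1)[OF v M, of m] t by (simp add: t_def)
  have 2: "a M * (1 - (t - 1) / v) \<le> a (m - 1)" using right_atom_ge(2)[OF v M, of "m - 1"] t by (simp add: t_def algebra_simps)
  have 3: "a M * (1 - (2 - t) / v) \<le> a (m - 2)" using left_atom_ge[OF v M, of "m - 2"] t by (simp add: t_def algebra_simps)
  have "(\<Sum>j\<in>{m, m - 1, m - 2}. a j) \<le> window_prob r"
    by (rule atoms_le_window_prob) (use t' in \<open>auto simp: t_def\<close>)
  then have P: "a m + (a (m - 1) + a (m - 2)) \<le> window_prob r" by simp
  have "a M * (3 - 3 / v) \<le> a M * (3 - (1 + (t + 1 / 2)\<^sup>2 / 2) / v)"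
  proof (intro mult_left_mono diff_left_mono divide_right_mono a_nonneg)
    have "(t + 1 / 2)\<^sup>2 \<le> 2\<^sup>2" using t' by (intro power_mono) auto
    then show "1 + (t + 1 / 2)\<^sup>2 / 2 \<le> 3" by simp
  qed (use v in auto)
  also have "\<dots> = a M * (1 - (t + 1 / 2)\<^sup>2 / (2 * v)) + a M * (1 - (t - 1) / v) + a M * (1 - (2 - t) / v)"
    using v by (simp add: field_simps)
  finally show ?thesis using 1 2 3 P by linarith
qed

end

text \<open>A cubic minus its chord over \<open>[l, u]\<close> is \<open>(x - l) (u - x)\<close> times a linear factor.\<close>

lemma cubic_between:
  fixes A B C D l u x :: real
  assumes neg: "A * x ^ 3 + B * x\<^sup>2 + C * x + D < 0"
    and l: "0 \<le> A * l ^ 3 + B * l\<^sup>2 + C * l + D" and u: "0 \<le> A * u ^ 3 + B * u\<^sup>2 + C * u + D"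
    and x: "l < u" "l \<le> x" and A: "A \<le> 0" "0 \<le> - A * (2 * l + u) - B"
  shows "u < x"
proof (rule ccontr)
  assume "\<not> u < x"
  then have xu: "x \<le> u" by simp
  define E where "E = - A * (l + u) - B"
  have "A * x \<le> A * l" using A x by (intro mult_left_mono_neg) auto
  then have "0 \<le> - A * x + E" using A by (simp add: E_def algebra_simps)
  then have "0 \<le> ((x - l) * (u - x)) * (- A * x + E)" using x xu by (intro mult_nonneg_nonneg) auto
  then have "0 \<le> (u - l) * (((x - l) * (u - x)) * (- A * x + E))" by (rule mult_nonneg_nonneg[rotated]) (use x in simp)
  moreover have "0 \<le> (A * l ^ 3 + B * l\<^sup>2 + C * l + D) * (u - x)" "0 \<le> (A * u ^ 3 + B * u\<^sup>2 + C * u + D) * (x - l)"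
    using l u x xu by (auto intro!: mult_nonneg_nonneg)
  moreover have "(u - l) * (A * x ^ 3 + B * x\<^sup>2 + C * x + D)
    = (u - l) * (((x - l) * (u - x)) * (- A * x + E)) + (A * l ^ 3 + B * l\<^sup>2 + C * l + D) * (u - x)
      + (A * u ^ 3 + B * u\<^sup>2 + C * u + D) * (x - l)"
    by (simp add: E_def eval_nat_numeral algebra_simps)
  ultimately have "0 \<le> (u - l) * (A * x ^ 3 + B * x\<^sup>2 + C * x + D)" by linarith
  moreover have "(u - l) * (A * x ^ 3 + B * x\<^sup>2 + C * x + D) < 0" using neg x by (intro mult_pos_neg) auto
  ultimately show False by simp
qed

text \<open>Improves a known bound \<open>l \<le> x\<close> to \<open>u < x\<close> under an
  inequality of the type in \<open>mode_mass\<close>. \<open>d2\<close> is a convenient number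
  slightly above \<open>c2\<close>, which makes the cubic strictly negative at
  \<open>x\<close>.\<close>

lemma square_cubic_between:
  fixes s r c2 d2 \<epsilon> l u x :: real
  assumes sq: "(s * x - r)\<^sup>2 \<le> c2 * x\<^sup>2 * (\<epsilon> + 12 * x)" and c2: "c2 < d2" "0 < x" "0 < \<epsilon>"
    and l: "d2 * l\<^sup>2 * (\<epsilon> + 12 * l) \<le> (s * l - r)\<^sup>2" and u: "d2 * u\<^sup>2 * (\<epsilon> + 12 * u) \<le> (s * u - r)\<^sup>2"
    and x: "l < u" "l \<le> x" and A: "0 \<le> d2" "s\<^sup>2 \<le> d2 * (\<epsilon> + 12 * (2 * l + u))"
  shows "u < x"
proof (rule cubic_between)
  have *: "- 12 * d2 * x ^ 3 + (s\<^sup>2 - d2 * \<epsilon>) * x\<^sup>2 + - 2 * s * r * x + r\<^sup>2 = (s * x - r)\<^sup>2 - d2 * x\<^sup>2 * (\<epsilon> + 12 * x)" for x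
    by (simp add: eval_nat_numeral algebra_simps)
  have "c2 * (x\<^sup>2 * (\<epsilon> + 12 * x)) < d2 * (x\<^sup>2 * (\<epsilon> + 12 * x))"
    using c2 by (intro mult_strict_right_mono mult_pos_pos) auto
  then show "- 12 * d2 * x ^ 3 + (s\<^sup>2 - d2 * \<epsilon>) * x\<^sup>2 + - 2 * s * r * x + r\<^sup>2 < 0"
    unfolding * using sq by (simp add: mult.assoc)
  show "0 \<le> - 12 * d2 * l ^ 3 + (s\<^sup>2 - d2 * \<epsilon>) * l\<^sup>2 + - 2 * s * r * l + r\<^sup>2"
    "0 \<le> - 12 * d2 * u ^ 3 + (s\<^sup>2 - d2 * \<epsilon>) * u\<^sup>2 + - 2 * s * r * u + r\<^sup>2"
    unfolding * using l u by simp_all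
  show "0 \<le> - (- 12 * d2) * (2 * l + u) - (s\<^sup>2 - d2 * \<epsilon>)" using A by (simp add: algebra_simps)
qed (use x A in auto)

section \<open>The tail bound on each single atom of a window\<close>

context bernoulli_family begin

text \<open>The Fourier bound for a tilted atom and the lower bound for the largest atom both scale
  like \<open>1 / sqrt v\<close>, so their ratio is bounded, by 53/10 from \<open>v = 19/5\<close>
  on.\<close>

lemma tilt_const:
  assumes v: "19 / 5 \<le> v" and M: "\<And>k. a k \<le> a M" "0 < a M" and m: "a M * (6 / 7) \<le> a m"
  shows "sqrt (pi * exp (7 / 5) / (2 * v)) / 2 \<le> 53 / 10 * a m"
proof -
  define X where "X = pi * exp (7 / 5) / (2 * v)"
  have "pi * exp (7 / 5) \<le> 31416 / 10000 * (40553 / 10000)"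
    using exp_numeric(4) pi_approx(2) by (intro mult_mono) auto
  then have Xv: "X * v \<le> 6371 / 1000" using v by (simp add: X_def)
  have X0: "0 \<le> X" using v by (simp add: X_def)
  have "X * (19 / 5) \<le> X * v" using v X0 by (intro mult_left_mono) auto
  then have X: "X + 12 * (X * v) \<le> 79" using Xv by simp
  have "X * 1 \<le> X * ((a M)\<^sup>2 * (1 + 12 * v))" by (intro mult_left_mono max_atom_lower M X0)
  also have "\<dots> = (a M)\<^sup>2 * (X + 12 * (X * v))" by (simp add: algebra_simps)
  also have "\<dots> \<le> (a M)\<^sup>2 * 79" using X by (intro mult_left_mono) auto
  also have "\<dots> \<le> (53 / 5)\<^sup>2 * (a M * (6 / 7))\<^sup>2" by (simp add: power_mult_distrib power2_eq_square)
  also have "\<dots> \<le> (53 / 5)\<^sup>2 * (a m)\<^sup>2"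
    using m M by (intro mult_left_mono power_mono) auto
  finally have "X \<le> (53 / 5 * a m)\<^sup>2" by (simp only: power_mult_distrib)
  then have "sqrt X \<le> 53 / 5 * a m" using a_nonneg[of m] by (intro real_le_lsqrt) auto
  then show ?thesis unfolding X_def by simp
qed

text \<open>Within 1/2 of the mean the window is not consulted. A large atom admits the
  unconditional tail. For a smaller one and \<open>v \<le> 19/5\<close>, the second moment serves
  for small \<open>L\<close>, and for larger \<open>L\<close> the atom is again big enough for the
  unconditional tail; for \<open>v > 19/5\<close>, tilting takes over at
  \<open>L = 11/5\<close>.\<close>

lemma central_atom_tail:
  assumes y: "\<And>n. n \<in> I \<Longrightarrow> \<bar>y n\<bar> \<le> 1" and V: "(\<Sum>n\<in>I. vn n * (y n)\<^sup>2) \<le> 2 * L / exp 1" and L: "ln 2 \<le> L"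
    and v: "0 < v" and m: "\<mu> \<le> of_int m" "of_int m \<le> \<mu> + 1 / 2"
  shows "ex (\<lambda>A. of_bool (2 * L < \<bar>centred_sum y A\<bar> \<and> int (card A) = m)) \<le> 2 * exp (- L) * a m"
proof -
  note unc = unconditional_tail[OF y V L, where P = "a m" and Q = "\<lambda>A. int (card A) = m"]
  consider "a m = 0" | "25 / 94 \<le> a m" | "0 < a m" "a m < 25 / 94" using a_nonneg[of m] by linarith
  then show ?thesis
  proof cases
    case 1
    have "ex (\<lambda>A. of_bool (2 * L < \<bar>centred_sum y A\<bar> \<and> int (card A) = m)) \<le> ex (\<lambda>A. of_bool (int (card A) = m))"
      by (rule ex_mono) auto
    then show ?thesis using 1 by (simp add: pbin_def)
  next
    case 2
    then show ?thesis by (intro unc) auto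
  next
    case am: 3
    then have am': "94 / 25 * a m < 1" by simp
    obtain M where M: "\<And>k. a k \<le> a M" "0 < a M" using ex_max_pbin by metis
    have v1: "27 / 25 \<le> v" by (rule small_atom_var[OF am(1) am' m v])
    have "a M * (1 - (1 / 2) / v) \<le> a M * (1 - (of_int m - \<mu>) / v)"
      using m v M by (intro mult_left_mono diff_left_mono divide_right_mono) auto
    also have "\<dots> \<le> a m" by (rule right_atom_ge(2)[OF v M(1) m])
    finally have atom: "a M * (1 - (1 / 2) / v) \<le> a m" .
    have var: "(1 * v - 1 / 2)\<^sup>2 \<le> c\<^sup>2 * v\<^sup>2 * (1 + 12 * v)" if "a m \<le> c" for c
      by (rule mode_mass[OF v M atom that]) (use v1 in simp)
    consider "v \<le> 5 / 2" | "5 / 2 < v" "v \<le> 19 / 5" | "19 / 5 < v" by linarith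
    then show ?thesis
    proof cases
      case 1
      show ?thesis
      proof (cases "L \<le> 137 / 100")
        case True
        then show ?thesis by (intro atom_tail_second[OF V L _ _ second_moment_small[OF am(1) am' m 1]]) auto
      next
        case False
        \<comment> \<open>By \<open>var\<close>, a smaller atom would push \<open>v\<close> above
          5/2.\<close>
        have "1435 / 10000 \<le> a m"
        proof (rule ccontr)
          assume "\<not> 1435 / 10000 \<le> a m"
          then have "a m \<le> 1435 / 10000" by simp
          from var[OF this] have "5 / 2 < v"
            by (rule square_cubic_between[where ?d2.0 = "206 / 10000" and l = "27 / 25"])
              (use v1 in \<open>auto simp: power2_eq_square\<close>)
          then show False using 1 by simp
        qed
        then show ?thesis using False by (intro unc) auto
      qed
    next
      case 2
      show ?thesis
      proof (cases "L \<le> 165 / 100")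
        case True
        have "ex (\<lambda>A. (centred_sum y A)\<^sup>2 * of_bool (int (card A) = m)) \<le> 344 / 100 * (\<Sum>n\<in>I. vn n * (y n)\<^sup>2) * a m"
        proof (rule second_moment_const[OF am(1) m, where ?v0.0 = "5 / 2" and c = "63 / 100" and k = "26 / 100"])
          fix x :: real
          have e: "(1 - x) * (1 / 2 + 2 * x) = 1 / 2 + 3 / 2 * x - 2 * x\<^sup>2" "(1 - 2 * x) * (1 / 2 + x) = 1 / 2 - 2 * x\<^sup>2"
            by (simp_all add: field_simps power2_eq_square)
          show "1 / 2 + x \<le> 63 / 100 * (5 / 2 - (1 - x) * (1 / 2 + 2 * x))"
            unfolding e using quadratic_nonneg[of "126 / 100" "- (1945 / 1000)" "76 / 100" x] by (simp add: power2_eq_square)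
          show "(1 - 2 * x) * (1 / 2 + x) \<le> 26 / 100 * (5 / 2 - (1 - x) * (1 / 2 + 2 * x))"
            unfolding e using quadratic_nonneg[of "252 / 100" "- (39 / 100)" "2 / 100" x] by (simp add: power2_eq_square)
        qed (use 2 in auto)
        then show ?thesis using True by (intro atom_tail_second[OF V L, where K = "344 / 100"]) auto
      next
        case False
        have "127 / 1000 \<le> a m"
        proof (rule ccontr)
          assume "\<not> 127 / 1000 \<le> a m"
          then have "a m \<le> 127 / 1000" by simp
          from var[OF this] have "19 / 5 < v"
            by (rule square_cubic_between[where ?d2.0 = "1613 / 100000" and l = "5 / 2"])
              (use v1 2 in \<open>auto simp: power2_eq_square\<close>)
          then show False using 2 by simp
        qed
        then show ?thesis using False by (intro unc) auto
      qed
    next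
      case 3
      define t where "t = of_int m - \<mu>"
      have t: "0 \<le> t" "t \<le> 1 / 2" using m by (auto simp: t_def)
      show ?thesis
      proof (cases "L \<le> 11 / 5")
        case True
        have "ex (\<lambda>A. (centred_sum y A)\<^sup>2 * of_bool (int (card A) = m)) \<le> 265 / 100 * (\<Sum>n\<in>I. vn n * (y n)\<^sup>2) * a m"
        proof (rule second_moment_large[OF am(1) t_def t(1), where k = "155 / 1000"])
          have "(1 + t) * (t + 2) \<le> (3 / 2) * (5 / 2)" using t by (intro mult_mono) auto
          then show "(1 + t) * (t + 2) \<le> v" using 3 by linarith
          show "(1 - 2 * x) * (t + x) \<le> 155 / 1000 * (v - (1 - x) * (t + 2 * x))" if x: "0 \<le> x" "x \<le> 1 / 2" for x
          proof -
            have "(1 - 2 * x) * (t + x) \<le> (1 - 2 * x) * (1 / 2 + x)" using x t by (intro mult_left_mono) auto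
            moreover have "(1 - x) * (t + 2 * x) \<le> (1 - x) * (1 / 2 + 2 * x)" using x t by (intro mult_left_mono) auto
            moreover have "(1 - 2 * x) * (1 / 2 + x) \<le> 155 / 1000 * (19 / 5 - (1 - x) * (1 / 2 + 2 * x))"
            proof -
              have e: "(1 - x) * (1 / 2 + 2 * x) = 1 / 2 + 3 / 2 * x - 2 * x\<^sup>2" "(1 - 2 * x) * (1 / 2 + x) = 1 / 2 - 2 * x\<^sup>2"
                by (simp_all add: field_simps power2_eq_square)
              show ?thesis unfolding e using quadratic_nonneg[of "231 / 100" "- (2325 / 10000)" "115 / 10000" x] by (simp add: power2_eq_square)
            qed
            moreover have "155 / 1000 * (19 / 5 - Y) \<le> 155 / 1000 * (v - X)" if "X \<le> Y" for X Y
              using 3 that by (intro mult_left_mono) auto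
            ultimately show ?thesis by (meson order_trans)
          qed
          have "t\<^sup>2 \<le> (1 / 2)\<^sup>2" using t by (intro power_mono) auto
          then have "1 + t\<^sup>2 \<le> 5 / 4" by (simp add: power2_eq_square)
          also have "\<dots> \<le> (34 / 100) * v" using 3 by simp
          finally have "(1 + t\<^sup>2) / v \<le> 34 / 100" using v by (simp add: pos_divide_le_eq)
          moreover have "2 * (1 + 155 / 1000) + w \<le> 265 / 100" if "w \<le> 34 / 100" for w :: real using that by simp
          ultimately have "2 * (1 + 155 / 1000) + (1 + t\<^sup>2) / v \<le> 265 / 100" by blast
          then show "2 * (1 + 155 / 1000) + (if t \<le> 1 then 1 + t\<^sup>2 else t * (1 + t)) / v \<le> 265 / 100"
            using t by (subst if_P) auto
        qed (use 3 in auto)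
        then show ?thesis using True by (intro atom_tail_second[OF V L, where K = "265 / 100"]) auto
      next
        case False
        have "a M * (6 / 7) \<le> a M * (1 - (1 / 2) / v)"
          using 3 M by (intro mult_left_mono) (auto simp: field_simps)
        then have "a M * (6 / 7) \<le> a m" using atom by linarith
        from tilt_const[OF _ M this] show ?thesis
          using False 3 by (intro atom_tail_tilt[OF y V _ v]) auto
      qed
    qed
  qed
qed

text \<open>The cubic inequality in the scale-free variable \<open>v / l\<^sup>2\<close>:
  \<open>\<rho>\<close> bounds the normalised total loss
  \<open>(l + 1) * (2 * l + 1) / (6 * l\<^sup>2)\<close> and \<open>\<epsilon>\<close> bounds
  \<open>1 / l\<^sup>2\<close>. The factor 73/100 is the mass outside the window, turned into a
  first bound by \<open>window_chebyshev\<close>.\<close>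

lemma window_ratio:
  assumes v: "0 < v" and M: "\<And>k. a k \<le> a M" "0 < a M" and l: "1 \<le> l"
    and J: "\<And>j. j \<in> {\<lfloor>\<mu>\<rfloor> - int l<..\<lfloor>\<mu>\<rfloor> + int l} \<Longrightarrow> \<bar>of_int j - \<mu>\<bar> \<le> r"
    and P: "window_prob r \<le> c" "window_prob r \<le> 27 / 100"
    and \<rho>: "(real l + 1) * (2 * real l + 1) \<le> 6 * \<rho> * (real l)\<^sup>2" "\<rho> \<le> 1" and \<epsilon>: "1 \<le> \<epsilon> * (real l)\<^sup>2"
  shows "73 / 100 * (real l + 1) \<le> v / (real l)\<^sup>2 * real l"
    and "(2 * (v / (real l)\<^sup>2) - \<rho>)\<^sup>2 \<le> c\<^sup>2 * (v / (real l)\<^sup>2)\<^sup>2 * (\<epsilon> + 12 * (v / (real l)\<^sup>2))"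
proof -
  define x where "x = real l"
  have x: "1 \<le> x" using l by (simp add: x_def)
  define u where "u = v / x\<^sup>2"
  have vu: "v = u * x\<^sup>2" using x by (simp add: u_def)
  have "1 - v / (x * (x + 1)) \<le> 27 / 100" using window_chebyshev[OF l J] P by (simp add: x_def)
  then have "73 / 100 \<le> v / (x * (x + 1))" by simp
  then have ch: "73 / 100 * (x * (x + 1)) \<le> v" using x by (simp add: pos_le_divide_eq)
  then have "x * (73 / 100 * (x + 1)) \<le> x * (u * x)" unfolding vu by (simp add: power2_eq_square mult_ac)
  then have u1: "73 / 100 * (x + 1) \<le> u * x" by (rule mult_left_le_imp_le) (use x in simp)
  then show "73 / 100 * (real l + 1) \<le> v / (real l)\<^sup>2 * real l" by (simp add: u_def x_def)
  have "a M * (2 * x - \<rho> * x ^ 3 / v) \<le> a M * (2 * x - x * (x + 1) * (2 * x + 1) / 6 / v)"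
  proof (intro mult_left_mono diff_left_mono divide_right_mono)
    have "x * ((x + 1) * (2 * x + 1)) \<le> x * (6 * \<rho> * x\<^sup>2)" using \<rho> x unfolding x_def by (intro mult_left_mono) auto
    then show "x * (x + 1) * (2 * x + 1) / 6 \<le> \<rho> * x ^ 3" by (simp add: eval_nat_numeral mult_ac)
  qed (use v M in auto)
  also have "\<dots> \<le> (\<Sum>j\<in>{\<lfloor>\<mu>\<rfloor> - int l<..\<lfloor>\<mu>\<rfloor> + int l}. a j)" unfolding x_def by (rule window_mass[OF v M(1)])
  also have "\<dots> \<le> window_prob r" by (rule atoms_le_window_prob) (use J in auto)
  finally have "a M * (2 * x - \<rho> * x ^ 3 / v) \<le> window_prob r" .
  from mode_mass[OF v M this P(1)] have "\<rho> * x ^ 3 \<le> 2 * x * v \<Longrightarrow> (2 * x * v - \<rho> * x ^ 3)\<^sup>2 \<le> c\<^sup>2 * v\<^sup>2 * (1 + 12 * v)" .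
  moreover have "\<rho> * x ^ 3 \<le> 2 * x * v"
  proof -
    have "\<rho> * x\<^sup>2 \<le> 1 * x\<^sup>2" using \<rho> by (intro mult_right_mono) auto
    also have "\<dots> \<le> 2 * (73 / 100 * (x * (x + 1)))" using x by (simp add: power2_eq_square algebra_simps)
    also have "\<dots> \<le> 2 * v" using ch by simp
    finally have "x * (\<rho> * x\<^sup>2) \<le> x * (2 * v)" using x by (intro mult_left_mono) auto
    then show ?thesis by (simp add: eval_nat_numeral mult_ac)
  qed
  ultimately have "(2 * x * v - \<rho> * x ^ 3)\<^sup>2 \<le> c\<^sup>2 * v\<^sup>2 * (1 + 12 * v)" by blast
  also have "\<dots> \<le> c\<^sup>2 * v\<^sup>2 * (\<epsilon> * x\<^sup>2 + 12 * v)" using \<epsilon> v by (intro mult_left_mono) (auto simp: x_def)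
  finally have "x ^ 6 * (2 * u - \<rho>)\<^sup>2 \<le> x ^ 6 * (c\<^sup>2 * u\<^sup>2 * (\<epsilon> + 12 * u))"
    unfolding vu by (simp add: eval_nat_numeral algebra_simps)
  then have "(2 * u - \<rho>)\<^sup>2 \<le> c\<^sup>2 * u\<^sup>2 * (\<epsilon> + 12 * u)" by (rule mult_left_le_imp_le) (use x in simp)
  then show "(2 * (v / (real l)\<^sup>2) - \<rho>)\<^sup>2 \<le> c\<^sup>2 * (v / (real l)\<^sup>2)\<^sup>2 * (\<epsilon> + 12 * (v / (real l)\<^sup>2))"
    by (simp add: u_def x_def)
qed

text \<open>Chebyshev gives the starting ratio (73/50 for \<open>l = 1\<close>, 73/100 otherwise);
  the cubic inequality raises it at level 25/94, and from there once more at level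
  1435/10000.\<close>

lemma window_var:
  assumes v: "0 < v" and M: "\<And>k. a k \<le> a M" "0 < a M" and l: "1 \<le> l"
    and J: "\<And>j. j \<in> {\<lfloor>\<mu>\<rfloor> - int l<..\<lfloor>\<mu>\<rfloor> + int l} \<Longrightarrow> \<bar>of_int j - \<mu>\<bar> \<le> r"
    and P: "window_prob r \<le> 25 / 94"
  shows "l = 1 \<Longrightarrow> 33 / 10 < v" "2 \<le> l \<Longrightarrow> 397 / 100 * (real l)\<^sup>2 < v"
    and "window_prob r \<le> 1435 / 10000 \<Longrightarrow> 14 * (real l)\<^sup>2 < v"
proof -
  have P27: "window_prob r \<le> 27 / 100" using P by simp
  have sq1: "((25 / 94)\<^sup>2 :: real) < 7074 / 100000" "((1435 / 10000)\<^sup>2 :: real) < 206 / 10000"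
    by (simp_all add: power2_eq_square)
  have one: "33 / 10 < v \<and> (window_prob r \<le> 1435 / 10000 \<longrightarrow> 14 < v)" if l1: "l = 1"
  proof -
    have w1: "73 / 100 * (real l + 1) \<le> v / (real l)\<^sup>2 * real l"
      by (rule window_ratio(1)[OF v M l J P P27, where \<rho> = 1 and \<epsilon> = 1]) (simp_all add: l1)
    have w2': "(2 * (v / (real l)\<^sup>2) - 1)\<^sup>2 \<le> c\<^sup>2 * (v / (real l)\<^sup>2)\<^sup>2 * (1 + 12 * (v / (real l)\<^sup>2))" if "window_prob r \<le> c" for c
      by (rule window_ratio(2)[OF v M l J that P27, where \<rho> = 1 and \<epsilon> = 1]) (simp_all add: l1)
    have v1: "73 / 50 \<le> v" using w1 unfolding l1 by simp
    have w2: "(2 * v - 1)\<^sup>2 \<le> c\<^sup>2 * v\<^sup>2 * (1 + 12 * v)" if "window_prob r \<le> c" for c using w2'[OF that] unfolding l1 by simp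
    have v33: "33 / 10 < v"
      by (rule square_cubic_between[OF w2[OF P] sq1(1) v, where l = "73 / 50"]) (use v1 in \<open>simp_all add: power2_eq_square\<close>)
    have "14 < v" if "window_prob r \<le> 1435 / 10000"
      by (rule square_cubic_between[OF w2[OF that] sq1(2) v, where l = "33 / 10"])
        (use v33 in \<open>simp_all add: power2_eq_square\<close>)
    with v33 show ?thesis by simp
  qed
  have two: "397 / 100 * (real l)\<^sup>2 < v \<and> (window_prob r \<le> 1435 / 10000 \<longrightarrow> 14 * (real l)\<^sup>2 < v)" if "2 \<le> l"
  proof -
    have x: "2 \<le> real l" using that by simp
    \<comment> \<open>\<open>\<rho> = 5/8\<close> and \<open>\<epsilon> = 1/4\<close> are the values
      at \<open>l = 2\<close>, the worst case.\<close>
    have "0 \<le> (real l - 2) * (7 * real l + 2)" using x by (intro mult_nonneg_nonneg) auto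
    then have r: "(real l + 1) * (2 * real l + 1) \<le> 6 * (5 / 8) * (real l)\<^sup>2" by (simp add: power2_eq_square algebra_simps)
    have "2\<^sup>2 \<le> (real l)\<^sup>2" using x by (intro power_mono) auto
    then have e: "1 \<le> (1 / 4) * (real l)\<^sup>2" by simp
    define u where "u = v / (real l)\<^sup>2"
    have u0: "0 < u" using x v by (simp add: u_def)
    have w1: "73 / 100 * (real l + 1) \<le> u * real l" unfolding u_def
      by (rule window_ratio(1)[OF v M l J P P27 r _ e]) simp_all
    have w2: "(2 * u - 5 / 8)\<^sup>2 \<le> c\<^sup>2 * u\<^sup>2 * (1 / 4 + 12 * u)" if "window_prob r \<le> c" for c unfolding u_def
      by (rule window_ratio(2)[OF v M l J that P27 r _ e]) simp_all
    have "73 / 100 * real l \<le> u * real l" using w1 by (simp add: algebra_simps)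
    then have u1: "73 / 100 \<le> u" by (rule mult_right_le_imp_le) (use x in simp)
    have u2: "397 / 100 < u"
      by (rule square_cubic_between[OF w2[OF P] sq1(1) u0, where l = "73 / 100"]) (use u1 in \<open>simp_all add: power2_eq_square\<close>)
    have u3: "14 < u" if "window_prob r \<le> 1435 / 10000"
      by (rule square_cubic_between[OF w2[OF that] sq1(2) u0, where l = "397 / 100"])
        (use u2 in \<open>simp_all add: power2_eq_square\<close>)
    show ?thesis using u2 u3 x by (simp add: u_def pos_less_divide_eq)
  qed
  show "l = 1 \<Longrightarrow> 33 / 10 < v" "2 \<le> l \<Longrightarrow> 397 / 100 * (real l)\<^sup>2 < v" using one two by auto
  show "14 * (real l)\<^sup>2 < v" if "window_prob r \<le> 1435 / 10000"
  proof (cases "l = 1")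
    case True
    then show ?thesis using one that by simp
  next
    case False
    then show ?thesis using two that l by simp
  qed
qed


text \<open>Here the window has about as many atoms as its reach \<open>2 * t\<close>, so its small
  mass makes \<open>v\<close> large compared with \<open>t\<^sup>2\<close>. This brings
  \<open>K\<close> down to the value required for each range of \<open>L\<close>, and keeps
  \<open>a m\<close> within 6/7 of the mode when tilting is used.\<close>

lemma far_atom_tail:
  assumes y: "\<And>n. n \<in> I \<Longrightarrow> \<bar>y n\<bar> \<le> 1" and V: "(\<Sum>n\<in>I. vn n * (y n)\<^sup>2) \<le> 2 * L / exp 1" and L: "ln 2 \<le> L"
    and v: "0 < v" and m: "\<mu> + 1 / 2 < of_int m" "of_int m \<le> \<mu> + r"
    and P: "window_prob r < 25 / 94" "L \<le> 137 / 100 \<or> window_prob r < 1435 / 10000"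
  shows "ex (\<lambda>A. of_bool (2 * L < \<bar>centred_sum y A\<bar> \<and> int (card A) = m)) \<le> 2 * exp (- L) * a m"
proof (cases "a m = 0")
  case True
  have "ex (\<lambda>A. of_bool (2 * L < \<bar>centred_sum y A\<bar> \<and> int (card A) = m)) \<le> ex (\<lambda>A. of_bool (int (card A) = m))"
    by (rule ex_mono) auto
  then show ?thesis using True by (simp add: pbin_def)
next
  case False
  then have am: "0 < a m" using a_nonneg[of m] by linarith
  define t where "t = of_int m - \<mu>"
  have t: "1 / 2 < t" "t \<le> r" using m by (auto simp: t_def)
  have m0: "\<mu> \<le> of_int m" using m by simp
  define l where "l = nat \<lfloor>t + 1 / 2\<rfloor>"
  have fl: "1 \<le> \<lfloor>t + 1 / 2\<rfloor>" using t by (simp add: le_floor_iff)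
  have il: "int l = \<lfloor>t + 1 / 2\<rfloor>" unfolding l_def by (rule nat_0_le) (use fl in linarith)
  have l1: "1 \<le> l" using fl unfolding il[symmetric] by simp
  have rl: "real l = of_int \<lfloor>t + 1 / 2\<rfloor>" unfolding il[symmetric] by simp
  have l: "real l \<le> t + 1 / 2" "t + 1 / 2 < real l + 1" unfolding rl by linarith+
  obtain M where M: "\<And>k. a k \<le> a M" "0 < a M" using ex_max_pbin by metis
  have J: "\<bar>of_int j - \<mu>\<bar> \<le> r" if "j \<in> {\<lfloor>\<mu>\<rfloor> - int l<..\<lfloor>\<mu>\<rfloor> + int l}" for j
    using window_cover[OF _ that, of m] l t unfolding t_def by linarith
  note P' = less_imp_le[OF P(1)]
  have var1: "33 / 10 < v" if "l = 1" by (rule window_var(1)[OF v M l1 _ P' that]) (rule J)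
  have var2: "397 / 100 * (real l)\<^sup>2 < v" if "2 \<le> l" by (rule window_var(2)[OF v M l1 _ P' that]) (rule J)
  have var3: "14 * (real l)\<^sup>2 < v" if "window_prob r \<le> 1435 / 10000" by (rule window_var(3)[OF v M l1 _ P' that]) (rule J)
  note sec = atom_tail_second[OF V L, where m = m]
  show ?thesis
  proof (cases "L \<le> 137 / 100")
    case True
    have "ex (\<lambda>A. (centred_sum y A)\<^sup>2 * of_bool (int (card A) = m)) \<le> 94 / 25 * (\<Sum>n\<in>I. vn n * (y n)\<^sup>2) * a m"
    proof -
      consider "t \<le> 1" | "1 < t" "t < 3 / 2" | "3 / 2 \<le> t" by linarith
      then show ?thesis
      proof cases
        case 1
        then have "real l < 2" using l by linarith
        then have "33 / 10 < v" using var1 l1 by simp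
        moreover have "1 + x \<le> 67 / 100 * (33 / 10 - (1 - x) * (1 + 2 * x))" for x :: real
          using quadratic_nonneg[of "134 / 100" "- (167 / 100)" "541 / 1000" x] by (simp add: power2_eq_square field_simps)
        moreover have "(1 - 2 * x) * (1 + x) \<le> 44 / 100 * (33 / 10 - (1 - x) * (1 + 2 * x))" if "0 \<le> x" for x :: real
        proof -
          have "0 \<le> x * x" by simp
          then show ?thesis using that by (simp add: field_simps)
        qed
        ultimately show ?thesis using 1
          by (intro second_moment_const[OF am m0, where ?t1.0 = 1 and ?v0.0 = "33 / 10" and c = "67 / 100" and k = "44 / 100"])
            (auto simp: t_def)
      next
        case 2
        then have "real l < 2" using l by linarith
        then have v33: "33 / 10 < v" using var1 l1 by simp
        \<comment> \<open>\<open>v > 33/10\<close> is too little for distances up to 3/2; the third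
          atom raises it to \<open>v > 8\<close>.\<close>
        have "a M * (3 - 3 / v) \<le> window_prob r" by (rule three_atoms[OF v M(1), of m]) (use 2 t in \<open>auto simp: t_def\<close>)
        from mode_mass[OF v M this less_imp_le[OF P(1)]] v33
        have "(3 * v - 3)\<^sup>2 \<le> (25 / 94)\<^sup>2 * v\<^sup>2 * (1 + 12 * v)" by simp
        then have "8 < v"
          by (rule square_cubic_between[where ?d2.0 = "7074 / 100000" and l = "33 / 10"])
            (use v33 in \<open>simp_all add: power2_eq_square\<close>)
        moreover have "3 / 2 + x \<le> 32 / 100 * (8 - (1 - x) * (3 / 2 + 2 * x))" for x :: real
          using quadratic_nonneg[of "64 / 100" "- (116 / 100)" "58 / 100" x] by (simp add: power2_eq_square field_simps)
        moreover have "(1 - 2 * x) * (3 / 2 + x) \<le> 24 / 100 * (8 - (1 - x) * (3 / 2 + 2 * x))" if "0 \<le> x" for x :: real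
        proof -
          have "0 \<le> x * x" by simp
          then show ?thesis using that by (simp add: field_simps)
        qed
        ultimately show ?thesis using 2
          by (intro second_moment_const[OF am m0, where ?t1.0 = "3 / 2" and ?v0.0 = 8 and c = "32 / 100" and k = "24 / 100"])
            (auto simp: t_def)
      next
        case 3
        then have "1 < real l" using l by linarith
        then have l2: "2 \<le> l" by simp
        define x where "x = real l"
        have x: "2 \<le> x" "t < x + 1 / 2" using l2 l by (simp_all add: x_def)
        have "0 \<le> (x - 2) * (297 / 100 * x + 194 / 100)" using x by (intro mult_nonneg_nonneg) auto
        then have "(x + 3 / 2) * (x + 5 / 2) \<le> 397 / 100 * x\<^sup>2" by (simp add: power2_eq_square field_simps)
        also have "\<dots> < v" using var2[OF l2] by (simp add: x_def)
        moreover have "(1 + t) * (t + 2) \<le> (x + 3 / 2) * (x + 5 / 2)" using x 3 by (intro mult_mono) auto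
        ultimately have vt: "(1 + t) * (t + 2) \<le> v" by linarith
        show ?thesis
        proof (rule second_moment_far[OF am t_def 3 vt, where k = "21 / 100" and s = 1])
          have e: "(1 + t) * (t + 2) = t\<^sup>2 + 3 * t + 2" by (simp add: power2_eq_square algebra_simps)
          show "t * (1 + t) \<le> 1 * v" using vt 3 unfolding e by (simp add: power2_eq_square algebra_simps)
          show "t \<le> 21 / 100 * (v - t)"
            using vt quadratic_nonneg[of "21 / 100" "- (58 / 100)" "42 / 100" t] unfolding e
            by (simp add: power2_eq_square)
        qed auto
      qed
    qed
    then show ?thesis using True by (intro sec[where K = "94 / 25"]) auto
  next
    case False
    then have P2: "window_prob r \<le> 1435 / 10000" using P by simp
    have v14: "14 * (real l)\<^sup>2 < v" by (rule var3[OF P2])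
    have "1\<^sup>2 \<le> (real l)\<^sup>2" using l1 by (intro power_mono) auto
    then have v14': "14 < v" using v14 by simp
    show ?thesis
    proof (cases "L \<le> 11 / 5")
      case True
      have "ex (\<lambda>A. (centred_sum y A)\<^sup>2 * of_bool (int (card A) = m)) \<le> 265 / 100 * (\<Sum>n\<in>I. vn n * (y n)\<^sup>2) * a m"
      proof (cases "t < 3 / 2")
        case t32: True
        have "3 / 2 + x \<le> 18 / 100 * (14 - (1 - x) * (3 / 2 + 2 * x))" if "0 \<le> x" "x \<le> 1" for x :: real
        proof -
          have "0 \<le> (1 - x) * (75 / 100 - 36 / 100 * x)" using that by (intro mult_nonneg_nonneg) auto
          then show ?thesis using that by (simp add: field_simps)
        qed
        moreover have "(1 - 2 * x) * (3 / 2 + x) \<le> 13 / 100 * (14 - (1 - x) * (3 / 2 + 2 * x))" if "0 \<le> x" for x :: real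
        proof -
          have "0 \<le> x * x" by simp
          then show ?thesis using that by (simp add: field_simps)
        qed
        ultimately show ?thesis using t32 v14'
          by (intro second_moment_const[OF am m0, where ?t1.0 = "3 / 2" and ?v0.0 = 14 and c = "18 / 100" and k = "13 / 100"])
            (auto simp: t_def)
      next
        case t32: False
        then have "1 < real l" using l by linarith
        then have "2 \<le> l" by simp
        then have "4 / 5 * t \<le> real l" using l by linarith
        then have "(4 / 5 * t)\<^sup>2 \<le> (real l)\<^sup>2" using t by (intro power_mono) auto
        then have v8: "896 / 100 * (t * t) \<le> v" using v14 by (simp add: power2_eq_square)
        have tt: "3 / 2 * t \<le> t * t" using t32 t by (intro mult_right_mono) auto
        have e: "(1 + t) * (t + 2) = t * t + 3 * t + 2" by (simp add: algebra_simps)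
        have vt: "(1 + t) * (t + 2) \<le> v" using v8 tt t32 unfolding e by linarith
        show ?thesis
        proof (rule second_moment_far[OF am t_def _ vt, where k = "1 / 10" and s = "2 / 10"])
          have "5 * t + 5 * (t * t) \<le> v" using v8 tt t32 by linarith
          then show "t * (1 + t) \<le> 2 / 10 * v" by (simp add: algebra_simps)
          have "11 * t \<le> v" using v8 tt t32 by linarith
          then show "t \<le> 1 / 10 * (v - t)" by simp
        qed (use t32 in auto)
      qed
      then show ?thesis using True by (intro sec[where K = "265 / 100"]) auto
    next
      case L2: False
      have "1 \<le> real l" using l1 by simp
      then have "t + 1 / 2 \<le> 2 * real l" using l by linarith
      then have "(t + 1 / 2)\<^sup>2 \<le> (2 * real l)\<^sup>2" using t by (intro power_mono) auto
      then have "7 * (t + 1 / 2)\<^sup>2 \<le> 2 * v" using v14 by (simp add: power_mult_distrib)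
      then have "(t + 1 / 2)\<^sup>2 / (2 * v) \<le> 1 / 7" using v by (simp add: pos_divide_le_eq)
      then have "a M * (6 / 7) \<le> a M * (1 - (t + 1 / 2)\<^sup>2 / (2 * v))" using M by (intro mult_left_mono) auto
      also have "\<dots> \<le> a m" unfolding t_def by (rule right_atom_ge(1)[OF v M(1) m0])
      finally have "a M * (6 / 7) \<le> a m" .
      from tilt_const[OF _ M this] show ?thesis
        using L2 v14' by (intro atom_tail_tilt[OF y V _ v]) auto
    qed
  qed
qed

lemma right_atom_tail:
  assumes y: "\<And>n. n \<in> I \<Longrightarrow> \<bar>y n\<bar> \<le> 1" and V: "(\<Sum>n\<in>I. vn n * (y n)\<^sup>2) \<le> 2 * L / exp 1" and L: "ln 2 \<le> L"
    and v: "0 < v" and m: "\<mu> \<le> of_int m" "of_int m \<le> \<mu> + r"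
    and P: "window_prob r < 25 / 94" "L \<le> 137 / 100 \<or> window_prob r < 1435 / 10000"
  shows "ex (\<lambda>A. of_bool (2 * L < \<bar>centred_sum y A\<bar> \<and> int (card A) = m)) \<le> 2 * exp (- L) * a m"
proof (cases "of_int m \<le> \<mu> + 1 / 2")
  case True
  show ?thesis by (rule central_atom_tail[OF y V L v m(1) True])
next
  case False
  then show ?thesis using m by (intro far_atom_tail[OF y V L v _ _ P]) auto
qed

text \<open>The sum is unchanged when outcomes, probabilities and the signs of the coefficients are
  reversed together; this carries the right half of a window to the left half.\<close>

lemma centred_sum_compl: "A \<subseteq> I \<Longrightarrow> bernoulli_family.centred_sum I (\<lambda>n. 1 - p n) (\<lambda>n. - y n) (I - A) = centred_sum y A"
  unfolding centred_sum_def bernoulli_family.centred_sum_def[OF compl_family]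
  by (rule sum.cong) (auto simp: ind_def algebra_simps)

lemma left_atom_tail:
  assumes y: "\<And>n. n \<in> I \<Longrightarrow> \<bar>y n\<bar> \<le> 1" and V: "(\<Sum>n\<in>I. vn n * (y n)\<^sup>2) \<le> 2 * L / exp 1" and L: "ln 2 \<le> L"
    and v: "0 < v" and m: "of_int m \<le> \<mu>" "\<mu> - r \<le> of_int m"
    and P: "window_prob r < 25 / 94" "L \<le> 137 / 100 \<or> window_prob r < 1435 / 10000"
  shows "ex (\<lambda>A. of_bool (2 * L < \<bar>centred_sum y A\<bar> \<and> int (card A) = m)) \<le> 2 * exp (- L) * a m"
proof -
  interpret C: bernoulli_family I "\<lambda>n. 1 - p n" by (rule compl_family)
  have card: "int (card (I - A)) = int (card I) - int (card A)" if "A \<subseteq> I" for A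
    using that fin card_mono[OF fin that] by (simp add: card_Diff_subset finite_subset of_nat_diff)
  have window_prob: "C.window_prob r = window_prob r" unfolding C.window_prob_def window_prob_def ber_ex_compl[OF fin] compl_mu
  proof (rule ber_ex_cong)
    fix A assume A: "A \<subseteq> I"
    have "real (card (I - A)) = real (card I) - real (card A)" using card[OF A] by linarith
    then show "of_bool (\<bar>real (card (I - A)) - (real (card I) - \<mu>)\<bar> \<le> r) = (of_bool (\<bar>real (card A) - \<mu>\<bar> \<le> r) :: real)"
      by (auto simp: abs_if)
  qed
  have "C.ex (\<lambda>A. of_bool (2 * L < \<bar>C.centred_sum (\<lambda>n. - y n) A\<bar> \<and> int (card A) = int (card I) - m))
     \<le> 2 * exp (- L) * C.a (int (card I) - m)"
    by (rule C.right_atom_tail[where r = r]) (use y V L v m P in \<open>auto simp: window_prob compl_var compl_mu mult.commute\<close>)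
  also have "C.a (int (card I) - m) = a m" by (simp add: pbin_compl[OF fin])
  also have "C.ex (\<lambda>A. of_bool (2 * L < \<bar>C.centred_sum (\<lambda>n. - y n) A\<bar> \<and> int (card A) = int (card I) - m))
     = ex (\<lambda>A. of_bool (2 * L < \<bar>centred_sum y A\<bar> \<and> int (card A) = m))"
    unfolding ber_ex_compl[OF fin]
    by (rule ber_ex_cong) (simp add: centred_sum_compl card)
  finally show ?thesis .
qed

text \<open>Below the mass thresholds each atom of the window satisfies the bound relative to its
  own mass, so summation over the window loses nothing.\<close>

lemma restricted_tail:
  assumes y: "\<And>n. n \<in> I \<Longrightarrow> \<bar>y n\<bar> \<le> 1" and V: "(\<Sum>n\<in>I. vn n * (y n)\<^sup>2) \<le> 2 * L / exp 1" and L: "ln 2 \<le> L"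
  shows "ex (\<lambda>A. of_bool (2 * L < \<bar>centred_sum y A\<bar> \<and> \<bar>real (card A) - \<mu>\<bar> \<le> r)) \<le> 2 * exp (- L) * window_prob r"
proof (cases "I = {}")
  case True
  have "0 < L" using L ln2_ge by linarith
  then have "\<not> 2 * L < \<bar>centred_sum y A\<bar>" for A unfolding centred_sum_def using True by simp
  moreover have "0 \<le> window_prob r" unfolding window_prob_def by (rule ber_ex_nonneg) (use p01' in auto)
  ultimately show ?thesis using fin by simp
next
  case False
  then have v: "0 < v" unfolding bvar_def using fin vn_pos by (intro sum_pos) auto
  show ?thesis
  proof (cases "25 / 94 \<le> window_prob r \<or> 137 / 100 \<le> L \<and> 1435 / 10000 \<le> window_prob r")
    case True
    then show ?thesis by (intro unconditional_tail[OF y V L]) auto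
  next
    case False
    then have P: "window_prob r < 25 / 94" "L \<le> 137 / 100 \<or> window_prob r < 1435 / 10000" by auto
    define J where "J = {m \<in> {0..int (card I)}. \<bar>of_int m - \<mu>\<bar> \<le> r}"
    have fJ: "finite J" unfolding J_def by (rule finite_subset[of _ "{0..int (card I)}"]) auto
    have "ex (\<lambda>A. of_bool (2 * L < \<bar>centred_sum y A\<bar> \<and> \<bar>real (card A) - \<mu>\<bar> \<le> r))
       = ex (\<lambda>A. \<Sum>m\<in>J. of_bool (2 * L < \<bar>centred_sum y A\<bar> \<and> int (card A) = m))"
    proof (rule ber_ex_cong)
      fix A assume "A \<subseteq> I"
      then have "card A \<le> card I" by (rule card_mono[OF fin])
      then have iff: "int (card A) \<in> J \<longleftrightarrow> \<bar>real (card A) - \<mu>\<bar> \<le> r" by (simp add: J_def)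
      have "(\<Sum>m\<in>J. of_bool (2 * L < \<bar>centred_sum y A\<bar> \<and> int (card A) = m))
        = (\<Sum>m\<in>J. if int (card A) = m then of_bool (2 * L < \<bar>centred_sum y A\<bar>) else (0 :: real))"
        by (rule sum.cong) auto
      also have "\<dots> = of_bool (2 * L < \<bar>centred_sum y A\<bar> \<and> \<bar>real (card A) - \<mu>\<bar> \<le> r)" using fJ iff by simp
      finally show "of_bool (2 * L < \<bar>centred_sum y A\<bar> \<and> \<bar>real (card A) - \<mu>\<bar> \<le> r)
         = (\<Sum>m\<in>J. of_bool (2 * L < \<bar>centred_sum y A\<bar> \<and> int (card A) = m) :: real)" by simp
    qed
    also have "\<dots> = (\<Sum>m\<in>J. ex (\<lambda>A. of_bool (2 * L < \<bar>centred_sum y A\<bar> \<and> int (card A) = m)))" by (rule ber_ex_sum)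
    also have "\<dots> \<le> (\<Sum>m\<in>J. 2 * exp (- L) * a m)"
    proof (rule sum_mono)
      fix m assume "m \<in> J"
      then have m: "\<bar>of_int m - \<mu>\<bar> \<le> r" by (simp add: J_def)
      show "ex (\<lambda>A. of_bool (2 * L < \<bar>centred_sum y A\<bar> \<and> int (card A) = m)) \<le> 2 * exp (- L) * a m"
      proof (cases "\<mu> \<le> of_int m")
        case True
        then show ?thesis using m by (intro right_atom_tail[OF y V L v _ _ P]) auto
      next
        case False
        then show ?thesis using m by (intro left_atom_tail[OF y V L v _ _ P]) auto
      qed
    qed
    also have "\<dots> = 2 * exp (- L) * (\<Sum>m\<in>J. a m)" by (simp add: sum_distrib_left)
    also have "\<dots> \<le> 2 * exp (- L) * window_prob r"
      by (intro mult_left_mono atoms_le_window_prob fJ) (auto simp: J_def)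
    finally show ?thesis .
  qed
qed

section \<open>Mixture assignments as Bernoulli trials\<close>

lemma scaled_restricted_tail:
  assumes D: "0 < D" and y: "\<And>n. n \<in> I \<Longrightarrow> \<bar>y n\<bar> \<le> D" and L: "ln 2 \<le> L"
    and V: "(\<Sum>n\<in>I. vn n * (y n)\<^sup>2) \<le> 2 * L / exp 1 * D\<^sup>2"
  shows "ex (\<lambda>A. of_bool (2 * L * D < \<bar>centred_sum y A\<bar> \<and> \<bar>real (card A) - \<mu>\<bar> \<le> r)) \<le> 2 * exp (- L) * window_prob r"
proof -
  have centred_sum: "centred_sum (\<lambda>n. y n / D) A = centred_sum y A / D" for A
    by (simp add: centred_sum_def sum_divide_distrib)
  have "(\<Sum>n\<in>I. vn n * (y n / D)\<^sup>2) = (\<Sum>n\<in>I. vn n * (y n)\<^sup>2) / D\<^sup>2"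
    by (simp add: power_divide sum_divide_distrib)
  also have "\<dots> \<le> 2 * L / exp 1" using V D by (simp add: pos_divide_le_eq)
  finally have "ex (\<lambda>A. of_bool (2 * L < \<bar>centred_sum (\<lambda>n. y n / D) A\<bar> \<and> \<bar>real (card A) - \<mu>\<bar> \<le> r)) \<le> 2 * exp (- L) * window_prob r"
    by (intro restricted_tail L) (use y D in \<open>auto simp: abs_divide\<close>)
  then show ?thesis using D by (simp add: centred_sum abs_divide pos_less_divide_eq)
qed

end

lemma ber_ex_nondegenerate:
  assumes "finite I" "\<And>n. n \<in> I \<Longrightarrow> 0 \<le> p n \<and> p n \<le> 1"
  shows "ber_ex p I F = ber_ex p {n \<in> I. 0 < p n \<and> p n < 1} (\<lambda>A. F (A \<union> {n \<in> I. p n = 1}))"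
  using assms
proof (induction I arbitrary: F rule: finite_induct)
  case (insert n I)
  have IH: "ber_ex p I F = ber_ex p {n \<in> I. 0 < p n \<and> p n < 1} (\<lambda>A. F (A \<union> {n \<in> I. p n = 1}))" for F
    using insert by simp
  have p: "0 \<le> p n" "p n \<le> 1" using insert.prems by auto
  consider "p n = 0" | "p n = 1" | "0 < p n" "p n < 1" using p by linarith
  then show ?case
  proof cases
    case 1
    then have "{j \<in> insert n I. 0 < p j \<and> p j < 1} = {j \<in> I. 0 < p j \<and> p j < 1}" "{j \<in> insert n I. p j = 1} = {j \<in> I. p j = 1}"
      by auto
    then show ?thesis using 1 insert.hyps IH by (simp add: ber_ex_insert)
  next
    case 2
    then have "{j \<in> insert n I. 0 < p j \<and> p j < 1} = {j \<in> I. 0 < p j \<and> p j < 1}" "{j \<in> insert n I. p j = 1} = insert n {j \<in> I. p j = 1}"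
      by auto
    then show ?thesis using 2 insert.hyps IH[of "\<lambda>A. F (insert n A)"] by (simp add: ber_ex_insert)
  next
    case 3
    then have "{j \<in> insert n I. 0 < p j \<and> p j < 1} = insert n {j \<in> I. 0 < p j \<and> p j < 1}" "{j \<in> insert n I. p j = 1} = {j \<in> I. p j = 1}"
      by auto
    then show ?thesis using insert.hyps IH[of "\<lambda>A. F (insert n A)"] IH[of F] by (simp add: ber_ex_insert)
  qed
qed simp

text \<open>Sure successes shift the count and its mean alike, and deterministic trials add nothing
  to the centred sum or its variance, so the strict case suffices.\<close>

lemma ber_restricted_tail:
  assumes finI: "finite I" and p: "\<And>n. n \<in> I \<Longrightarrow> 0 \<le> p n \<and> p n \<le> 1"
    and D: "0 < D" and y: "\<And>n. n \<in> I \<Longrightarrow> \<bar>y n\<bar> \<le> D" and L: "ln 2 \<le> L"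
    and V: "(\<Sum>n\<in>I. p n * (1 - p n) * (y n)\<^sup>2) \<le> 2 * L / exp 1 * D\<^sup>2"
  shows "ber_ex p I (\<lambda>A. of_bool (2 * L * D < \<bar>\<Sum>n\<in>I. (ind A n - p n) * y n\<bar> \<and> \<bar>real (card A) - (\<Sum>n\<in>I. p n)\<bar> \<le> r))
     \<le> 2 * exp (- L) * ber_ex p I (\<lambda>A. of_bool (\<bar>real (card A) - (\<Sum>n\<in>I. p n)\<bar> \<le> r))"
proof -
  define I0 where "I0 = {n \<in> I. 0 < p n \<and> p n < 1}"
  define I1 where "I1 = {n \<in> I. p n = 1}"
  interpret bernoulli_family I0 p by unfold_locales (use finI in \<open>auto simp: I0_def\<close>)
  have sub: "I0 \<subseteq> I" "I1 \<subseteq> I" "I0 \<inter> I1 = {}" "finite I1" using finI by (auto simp: I0_def I1_def)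
  have deg: "p n = 0" if "n \<in> I - I0 - I1" for n using p[of n] that by (auto simp: I0_def I1_def)
  have S: "(\<Sum>n\<in>I. (ind (A \<union> I1) n - p n) * y n) = centred_sum y A" if A: "A \<subseteq> I0" for A
  proof -
    have "(\<Sum>n\<in>I. (ind (A \<union> I1) n - p n) * y n) = (\<Sum>n\<in>I0. (ind (A \<union> I1) n - p n) * y n)"
    proof (rule sum.mono_neutral_right[OF finI sub(1)], rule ballI)
      fix n assume n: "n \<in> I - I0"
      then have "n \<in> I1 \<or> p n = 0 \<and> n \<notin> I1" using deg by auto
      then show "(ind (A \<union> I1) n - p n) * y n = 0" using n A by (auto simp: ind_def I1_def)
    qed
    also have "\<dots> = centred_sum y A" unfolding centred_sum_def by (rule sum.cong) (use sub in \<open>auto simp: ind_def\<close>)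
    finally show ?thesis .
  qed
  have P: "(\<Sum>n\<in>I. p n) = \<mu> + real (card I1)"
  proof -
    have "(\<Sum>n\<in>I. p n) = (\<Sum>n\<in>I0 \<union> I1. p n)"
      by (rule sum.mono_neutral_right) (use finI sub deg in auto)
    also have "\<dots> = \<mu> + (\<Sum>n\<in>I1. p n)" unfolding bmu_def using sub finI finite_subset by (intro sum.union_disjoint) auto
    also have "(\<Sum>n\<in>I1. p n) = real (card I1)" by (simp add: I1_def)
    finally show ?thesis .
  qed
  have C: "\<bar>real (card (A \<union> I1)) - (\<Sum>n\<in>I. p n)\<bar> = \<bar>real (card A) - \<mu>\<bar>" if A: "A \<subseteq> I0" for A
  proof -
    have "card (A \<union> I1) = card A + card I1"
      using A sub finI finite_subset[of A I] by (intro card_Un_disjoint) auto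
    then show ?thesis using P by simp
  qed
  have "(\<Sum>n\<in>I0. p n * (1 - p n) * (y n)\<^sup>2) \<le> (\<Sum>n\<in>I. p n * (1 - p n) * (y n)\<^sup>2)"
    using p sub finI by (intro sum_mono2) auto
  then have V0: "(\<Sum>n\<in>I0. vn n * (y n)\<^sup>2) \<le> 2 * L / exp 1 * D\<^sup>2" using V by linarith
  have nd: "ber_ex p I F = ex (\<lambda>A. F (A \<union> I1))" for F
    unfolding I0_def I1_def by (rule ber_ex_nondegenerate[OF finI p])
  have "ber_ex p I (\<lambda>A. of_bool (2 * L * D < \<bar>\<Sum>n\<in>I. (ind A n - p n) * y n\<bar> \<and> \<bar>real (card A) - (\<Sum>n\<in>I. p n)\<bar> \<le> r))
    = ex (\<lambda>A. of_bool (2 * L * D < \<bar>centred_sum y A\<bar> \<and> \<bar>real (card A) - \<mu>\<bar> \<le> r))"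
    unfolding nd
    by (rule ber_ex_cong) (simp only: S C)
  moreover have "ber_ex p I (\<lambda>A. of_bool (\<bar>real (card A) - (\<Sum>n\<in>I. p n)\<bar> \<le> r)) = window_prob r"
    unfolding nd window_prob_def
    by (rule ber_ex_cong) (simp only: C)
  moreover have "ex (\<lambda>A. of_bool (2 * L * D < \<bar>centred_sum y A\<bar> \<and> \<bar>real (card A) - \<mu>\<bar> \<le> r)) \<le> 2 * exp (- L) * window_prob r"
    by (rule scaled_restricted_tail[OF D _ L V0]) (use y sub in auto)
  ultimately show ?thesis by simp
qed

text \<open>The event that the level set equals a given \<open>A\<close> is a box, to which the
  product formula applies.\<close>

lemma prob_Pi_pmf_level_set:
  assumes "finite I"
  shows "measure_pmf.prob (Pi_pmf I d Z) {c. Q {n \<in> I. c n = k}} = ber_ex (\<lambda>n. pmf (Z n) k) I (\<lambda>A. of_bool (Q A))"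
proof -
  define S where "S = (\<lambda>c. {n \<in> I. c n = k})"
  have wt: "measure_pmf.prob (Pi_pmf I d Z) {c. S c = A} = ber_wt (\<lambda>n. pmf (Z n) k) I A" if A: "A \<subseteq> I" for A
  proof -
    have "{c. S c = A} = Pi I (\<lambda>n. if n \<in> A then {k} else - {k})"
      using A by (auto simp: S_def Pi_def split: if_splits)
    then have "measure_pmf.prob (Pi_pmf I d Z) {c. S c = A} = (\<Prod>n\<in>I. measure_pmf.prob (Z n) (if n \<in> A then {k} else - {k}))"
      by (simp only: measure_Pi_pmf_Pi[OF assms])
    also have "\<dots> = (\<Prod>n\<in>I. if n \<in> A then pmf (Z n) k else 1 - pmf (Z n) k)"
    proof (rule prod.cong)
      fix n
      have "measure_pmf.prob (Z n) (- {k}) = 1 - pmf (Z n) k"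
        using measure_pmf.prob_compl[of "{k}" "Z n"] by (simp add: Compl_eq_Diff_UNIV measure_pmf_single)
      then show "measure_pmf.prob (Z n) (if n \<in> A then {k} else - {k}) = (if n \<in> A then pmf (Z n) k else 1 - pmf (Z n) k)"
        by (simp add: measure_pmf_single)
    qed simp
    also have "\<dots> = ber_wt (\<lambda>n. pmf (Z n) k) I A"
    proof -
      have "I \<inter> {n. n \<in> A} = A" "I \<inter> - {n. n \<in> A} = I - A" using A by auto
      then show ?thesis unfolding ber_wt_def using assms by (simp add: prod.If_cases)
    qed
    finally show ?thesis .
  qed
  have "{c. Q (S c)} = (\<Union>A\<in>{A \<in> Pow I. Q A}. {c. S c = A})" by (auto simp: S_def)
  then have "measure_pmf.prob (Pi_pmf I d Z) {c. Q (S c)} = (\<Sum>A\<in>{A \<in> Pow I. Q A}. measure_pmf.prob (Pi_pmf I d Z) {c. S c = A})"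
    using assms by (simp only:) (rule measure_pmf.finite_measure_finite_Union, auto simp: disjoint_family_on_def)
  also have "\<dots> = (\<Sum>A\<in>{A \<in> Pow I. Q A}. ber_wt (\<lambda>n. pmf (Z n) k) I A)"
    by (rule sum.cong) (auto simp: wt)
  also have "\<dots> = ber_ex (\<lambda>n. pmf (Z n) k) I (\<lambda>A. of_bool (Q A))"
    unfolding ber_ex_def using assms by (intro sum.mono_neutral_cong_left) auto
  finally show ?thesis by (simp add: S_def)
qed

text \<open>\<open>D\<close> is the larger of \<open>sp\<close> and
  \<open>t * sqrt (e / (2 L))\<close> with \<open>L = ln (2 / \<delta>)\<close>; the case
  distinction in \<open>lambda_mu\<close> decides which one it is. In the first branch the variance
  condition holds with equality, in the second \<open>D = sp\<close>.\<close>

lemma lambda_mu_scale: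
  fixes t sp \<delta> :: real
  assumes t: "0 < t" and sp: "0 < sp" and \<delta>: "0 < \<delta>" "\<delta> < 1"
  obtains D where "sp \<le> D" "t\<^sup>2 \<le> 2 * ln (2 / \<delta>) / exp 1 * D\<^sup>2" "2 * ln (2 / \<delta>) * D = lambda_mu t sp \<delta> * t"
proof -
  define L where "L = ln (2 / \<delta>)"
  have L: "0 < L" using \<delta> by (simp add: L_def)
  define w where "w = sqrt (2 * exp 1 * L)"
  have w: "0 < w" "w\<^sup>2 = 2 * exp 1 * L" using L by (simp_all add: w_def)
  show ?thesis
  proof (cases "(1 / exp 1) * w \<le> t / sp")
    case True
    have lam: "lambda_mu t sp \<delta> = w" using True by (simp add: lambda_mu_def w_def L_def)
    have "1 / exp 1 * w * sp \<le> t" using True sp by (simp add: pos_le_divide_eq)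
    then have "w * (1 / exp 1 * w * sp) \<le> w * t" using w by (intro mult_left_mono) auto
    moreover have "w * (1 / exp 1 * w * sp) = w\<^sup>2 / exp 1 * sp" by (simp add: power2_eq_square)
    ultimately have "2 * L * sp \<le> w * t" unfolding w(2) by simp
    then have 1: "sp \<le> w * t / (2 * L)" using L by (simp add: pos_le_divide_eq mult_ac)
    have "2 * L / exp 1 * (w * t / (2 * L))\<^sup>2 = w\<^sup>2 * t\<^sup>2 / (2 * exp 1 * L)"
      using L by (simp add: power2_eq_square field_simps)
    then have 2: "t\<^sup>2 \<le> 2 * L / exp 1 * (w * t / (2 * L))\<^sup>2" unfolding w(2) using L by simp
    show ?thesis by (rule that[folded L_def, OF 1 2]) (use L lam in simp)
  next
    case False
    then have lam: "lambda_mu t sp \<delta> = 2 * sp / t * L" by (simp add: lambda_mu_def w_def L_def)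
    have "t / sp < 1 / exp 1 * w" using False by simp
    then have "t < 1 / exp 1 * w * sp" by (simp only: pos_divide_less_eq[OF sp])
    then have "t\<^sup>2 \<le> (1 / exp 1 * w * sp)\<^sup>2" using t by (intro power_mono) auto
    also have "\<dots> = w\<^sup>2 * sp\<^sup>2 / (exp 1 * exp 1)" by (simp add: power2_eq_square)
    also have "\<dots> = 2 * L / exp 1 * sp\<^sup>2" unfolding w(2) by simp
    finally have 2: "t\<^sup>2 \<le> 2 * L / exp 1 * sp\<^sup>2" .
    show ?thesis by (rule that[folded L_def, OF _ 2]) (use t lam in simp_all)
  qed
qed

lemma lambda_mu_nonneg:
  assumes "0 \<le> t" "0 \<le> sp" "0 < \<delta>" "\<delta> < 1" shows "0 \<le> lambda_mu t sp \<delta>"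
  using assms by (auto simp: lambda_mu_def intro!: mult_nonneg_nonneg)

lemma cond_prob_ge:
  fixes M :: "'a pmf"
  assumes "0 < measure_pmf.prob M {c. Q c}"
    and "measure_pmf.prob M {c. \<not> P c \<and> Q c} \<le> d * measure_pmf.prob M {c. Q c}"
  shows "1 - d \<le> cond_prob (measure_pmf M) P Q"
proof -
  have "{c. Q c} = {c. P c \<and> Q c} \<union> {c. \<not> P c \<and> Q c}" by auto
  then have "measure_pmf.prob M {c. Q c} = measure_pmf.prob M {c. P c \<and> Q c} + measure_pmf.prob M {c. \<not> P c \<and> Q c}"
    by (simp only:) (rule measure_pmf.finite_measure_Union, auto)
  then have "(1 - d) * measure_pmf.prob M {c. Q c} \<le> measure_pmf.prob M {c. P c \<and> Q c}"
    using assms(2) by (simp add: left_diff_distrib)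
  then show ?thesis using assms(1) by (simp add: cond_prob_def pos_le_divide_eq)
qed

theorem theorem2:
  fixes N K :: nat and x :: "nat \<Rightarrow> real^'d" and p :: "nat \<Rightarrow> nat \<Rightarrow> real"
    and Z :: "nat \<Rightarrow> nat pmf" and k :: nat and i :: 'd
    and lam_w delta :: real
  assumes N_pos: "N \<ge> 1"
    and p_range: "\<forall>n\<in>{1..N}. \<forall>k'\<in>{1..K}. 0 \<le> p n k' \<and> p n k' \<le> 1"
    and p_sum: "\<forall>n\<in>{1..N}. (\<Sum>k'=1..K. p n k') = 1"
    and Z_dist: "\<forall>n\<in>{1..N}. \<forall>k'\<in>{1..K}. pmf (Z n) k' = p n k'"
    and k_range: "k \<in> {1..K}"
    and lw: "0 < lam_w" "lam_w < 1"
    and del: "0 < delta" "delta < 1"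
    and Ew_pos: "measure_pmf.prob (Pi_pmf {1..N} 0 Z)
                   {c. \<bar>w_SEM N c k - w_EM N p k\<bar> \<le> lam_w * w_EM N p k} > 0"
  shows "cond_prob (measure_pmf (Pi_pmf {1..N} 0 Z))
           (\<lambda>c. \<bar>(mu_SEM N x c k - mu_EM N x p k) $ i\<bar>
                  \<le> lambda_mu (tau N x p k i) (spread N x i) delta / (1 - lam_w)
                    * (tau N x p k i / r_k N p k))
           (\<lambda>c. \<bar>w_SEM N c k - w_EM N p k\<bar> \<le> lam_w * w_EM N p k)
         \<ge> 1 - delta"
proof -
  define I where "I = {1..N}"
  have fin: "finite I" and I: "I \<noteq> {}" using N_pos by (auto simp: I_def)
  define P where "P = (\<lambda>n. p n k)"
  define r where "r = r_k N p k"
  define m where "m = mu_EM N x p k $ i"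
  define y where "y = (\<lambda>n. x n $ i - m)"
  define t where "t = tau N x p k i"
  define sp where "sp = spread N x i"
  define lam where "lam = lambda_mu t sp delta"
  define W where "W = (\<lambda>c :: nat \<Rightarrow> nat. {n \<in> I. c n = k})"
  define S where "S = (\<lambda>A. \<Sum>n\<in>I. (ind A n - P n) * y n)"
  have P: "0 \<le> P n \<and> P n \<le> 1" if "n \<in> I" for n using p_range k_range that by (simp add: P_def I_def)
  have Zk: "pmf (Z n) k = P n" if "n \<in> I" for n using Z_dist k_range that by (simp add: P_def I_def)
  have r: "r = (\<Sum>n\<in>I. P n)" by (simp add: r_def r_k_def P_def I_def)
  have r0: "0 \<le> r" unfolding r using P by (intro sum_nonneg) auto
  have t2: "t\<^sup>2 = (\<Sum>n\<in>I. P n * (1 - P n) * (y n)\<^sup>2)" and t0: "0 \<le> t"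
  proof -
    have "0 \<le> (\<Sum>n\<in>I. P n * (1 - P n) * (y n)\<^sup>2)" using P by (intro sum_nonneg mult_nonneg_nonneg) auto
    moreover have "t = sqrt (\<Sum>n\<in>I. P n * (1 - P n) * (y n)\<^sup>2)" by (simp add: t_def tau_def P_def y_def m_def I_def)
    ultimately show "t\<^sup>2 = (\<Sum>n\<in>I. P n * (1 - P n) * (y n)\<^sup>2)" "0 \<le> t" by simp_all
  qed
  have zW: "zind c n k = ind (W c) n" if "n \<in> I" for c n using that by (simp add: zind_def ind_def W_def)
  have WI: "W c \<subseteq> I" for c by (auto simp: W_def)
  have zsum: "(\<Sum>n=1..N. zind c n k) = real (card (W c))" for c
  proof -
    have "(\<Sum>n=1..N. zind c n k) = (\<Sum>n\<in>I. ind (W c) n)" unfolding I_def[symmetric] by (rule sum.cong) (auto simp: zW)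
    also have "\<dots> = real (card (W c))" by (rule sum_ind[OF fin WI])
    finally show ?thesis .
  qed
  have N0: "0 < real N" using N_pos by simp
  have E: "\<bar>w_SEM N c k - w_EM N p k\<bar> \<le> lam_w * w_EM N p k \<longleftrightarrow> \<bar>real (card (W c)) - r\<bar> \<le> lam_w * r" for c
  proof -
    have "w_SEM N c k - w_EM N p k = (real (card (W c)) - r) / real N"
      unfolding w_SEM_def zsum w_EM_def r_def by (simp add: diff_divide_distrib)
    moreover have "lam_w * w_EM N p k = lam_w * r / real N" by (simp add: w_EM_def r_def)
    ultimately show ?thesis using N0 by (simp add: abs_divide divide_le_cancel)
  qed
  have spread: "\<bar>y n\<bar> \<le> sp" if n: "n \<in> I" and r1: "0 < r" for n
  proof -
    define X where "X = (\<lambda>n. x n $ i) ` I"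
    have X: "finite X" "X \<noteq> {}" using fin I by (auto simp: X_def)
    have mm: "m = (\<Sum>j\<in>I. P j * x j $ i) / r"
      by (simp add: m_def mu_EM_def P_def I_def r_def r_k_def divide_inverse mult.commute)
    have "(\<Sum>j\<in>I. P j * x j $ i) \<le> (\<Sum>j\<in>I. P j * Max X)" using P X by (intro sum_mono mult_left_mono Max_ge) (auto simp: X_def)
    also have "\<dots> = Max X * r" by (simp add: r sum_distrib_left mult.commute)
    finally have 1: "m \<le> Max X" using r1 by (simp add: mm pos_divide_le_eq)
    have "Min X * r = (\<Sum>j\<in>I. P j * Min X)" by (simp add: r sum_distrib_left mult.commute)
    also have "\<dots> \<le> (\<Sum>j\<in>I. P j * x j $ i)" using P X by (intro sum_mono mult_left_mono Min_le) (auto simp: X_def)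
    finally have 2: "Min X \<le> m" using r1 by (simp add: mm pos_le_divide_eq)
    have "Min X \<le> x n $ i" "x n $ i \<le> Max X" using n X by (auto simp: X_def)
    then show ?thesis using 1 2 by (simp add: y_def sp_def spread_def X_def I_def abs_le_iff)
  qed
  have sp0: "0 \<le> sp"
  proof -
    obtain n where n: "n \<in> I" using I by auto
    have "Min ((\<lambda>n. x n $ i) ` I) \<le> x n $ i" "x n $ i \<le> Max ((\<lambda>n. x n $ i) ` I)" using n fin by auto
    then show ?thesis by (simp add: sp_def spread_def I_def)
  qed
  have lam0: "0 \<le> lam" unfolding lam_def by (rule lambda_mu_nonneg[OF t0 sp0 del])
  have implies: "\<bar>(mu_SEM N x c k - mu_EM N x p k) $ i\<bar> \<le> lam / (1 - lam_w) * (t / r)"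
    if E: "\<bar>real (card (W c)) - r\<bar> \<le> lam_w * r" and S: "\<bar>S (W c)\<bar> \<le> lam * t" for c
  \<comment> \<open>If \<open>r = 0\<close>, the event leaves no point in component
    \<open>k\<close>; both means and the claimed bound are then 0 by the convention for division by
    0.\<close>
  proof (cases "r = 0")
    case True
    then have "real (card (W c)) = 0" using E by simp
    then have "mu_SEM N x c k = 0" unfolding mu_SEM_def zsum by simp
    moreover have "mu_EM N x p k = 0" using True by (simp add: mu_EM_def r_def r_k_def)
    ultimately show ?thesis using True by simp
  next
    case False
    then have r1: "0 < r" using r0 by simp
    define C where "C = real (card (W c))"
    have Cr: "(1 - lam_w) * r \<le> C" using E by (simp add: C_def abs_le_iff algebra_simps)
    have pos: "0 < (1 - lam_w) * r" using lw r1 by simp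
    have C0: "0 < C" using Cr pos by linarith
    have "mu_SEM N x c k $ i = (\<Sum>n\<in>I. ind (W c) n * x n $ i) / C"
    proof -
      have "(\<Sum>n=1..N. zind c n k * x n $ i) = (\<Sum>n\<in>I. ind (W c) n * x n $ i)"
        unfolding I_def[symmetric] by (rule sum.cong) (auto simp: zW)
      moreover have "mu_SEM N x c k $ i = (\<Sum>n=1..N. zind c n k * x n $ i) / (\<Sum>n=1..N. zind c n k)"
        by (simp add: mu_SEM_def divide_inverse mult.commute)
      ultimately show ?thesis unfolding C_def zsum by (simp only:)
    qed
    then have sem: "(\<Sum>n\<in>I. ind (W c) n * x n $ i) = mu_SEM N x c k $ i * C" using C0 by simp
    have em: "(\<Sum>n\<in>I. P n * x n $ i) = m * r"
      using r1 by (simp add: m_def mu_EM_def P_def I_def r_def r_k_def)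
    have "S (W c) = (\<Sum>n\<in>I. ind (W c) n * x n $ i) - m * (\<Sum>n\<in>I. ind (W c) n) - ((\<Sum>n\<in>I. P n * x n $ i) - m * (\<Sum>n\<in>I. P n))"
      by (simp add: S_def y_def algebra_simps sum.distrib sum_subtractf sum_distrib_left)
    also have "\<dots> = (mu_SEM N x c k $ i - m) * C"
      unfolding sem em r[symmetric] sum_ind[OF fin WI] C_def[symmetric] by (simp add: algebra_simps)
    finally have "\<bar>mu_SEM N x c k $ i - m\<bar> * C \<le> lam * t" using S C0 by (simp add: abs_mult)
    then have "\<bar>mu_SEM N x c k $ i - m\<bar> \<le> lam * t / C" using C0 by (simp add: pos_le_divide_eq)
    also have "\<dots> \<le> lam * t / ((1 - lam_w) * r)"
      using Cr pos lam0 t0 C0 by (intro divide_left_mono) auto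
    finally show ?thesis by (simp add: m_def)
  qed
  define F where "F = (\<lambda>A :: nat set. \<bar>real (card A) - r\<bar> \<le> lam_w * r)"
  have tail: "ber_ex P I (\<lambda>A. of_bool (lam * t < \<bar>S A\<bar> \<and> F A)) \<le> delta * ber_ex P I (\<lambda>A. of_bool (F A))"
  \<comment> \<open>If one of the three vanishes, \<open>lambda_mu_scale\<close> does not apply;
    instead no outcome of positive weight lies in the tail event.\<close>
  proof (cases "0 < r \<and> 0 < t \<and> 0 < sp")
    case True
    obtain D where D: "sp \<le> D" "t\<^sup>2 \<le> 2 * ln (2 / delta) / exp 1 * D\<^sup>2" "2 * ln (2 / delta) * D = lam * t"
      using lambda_mu_scale[of t sp delta] True del unfolding lam_def by metis
    have "ber_ex P I (\<lambda>A. of_bool (2 * ln (2 / delta) * D < \<bar>\<Sum>n\<in>I. (ind A n - P n) * y n\<bar> \<and> \<bar>real (card A) - (\<Sum>n\<in>I. P n)\<bar> \<le> lam_w * r))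
      \<le> 2 * exp (- ln (2 / delta)) * ber_ex P I (\<lambda>A. of_bool (\<bar>real (card A) - (\<Sum>n\<in>I. P n)\<bar> \<le> lam_w * r))"
    proof (rule ber_restricted_tail[OF fin P])
      show "0 < D" using D True by simp
      show "\<bar>y n\<bar> \<le> D" if "n \<in> I" for n using spread[OF that] D True by simp
      show "ln 2 \<le> ln (2 / delta)" using del by (simp add: field_simps)
      show "(\<Sum>n\<in>I. P n * (1 - P n) * (y n)\<^sup>2) \<le> 2 * ln (2 / delta) / exp 1 * D\<^sup>2" using D(2) by (simp add: t2)
    qed
    moreover have "2 * exp (- ln (2 / delta)) = delta" using del by (simp add: exp_minus)
    ultimately show ?thesis by (simp add: D(3) F_def S_def r)
  next
    case False
    have null: "ber_wt P I A * of_bool (lam * t < \<bar>S A\<bar> \<and> F A) = 0" if A: "A \<subseteq> I" for A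
    proof -
      have "\<not> lam * t < \<bar>S A\<bar>" if "S A = 0" using that lam0 t0 by (simp add: not_less)
      moreover consider "r = 0" | "0 < r" "sp = 0" | "0 < r" "0 < sp" "t = 0" using False r0 t0 sp0 by linarith
      then have "ber_wt P I A = 0 \<or> S A = 0 \<or> \<not> F A"
      proof cases
        case 1
        show ?thesis
        proof (cases "A = {}")
          case True
          have "P n = 0" if "n \<in> I" for n
            using 1 P that fin unfolding r by (subst (asm) sum_nonneg_eq_0_iff) auto
          then show ?thesis using True by (simp add: S_def ind_def)
        next
          case False
          then have "0 < card A" using A fin finite_subset by (auto simp: card_gt_0_iff)
          then show ?thesis using 1 by (simp add: F_def)
        qed
      next
        case 2
        then show ?thesis using spread by (simp add: S_def)
      next
        case 3
        \<comment> \<open>Variance zero forces \<open>S A = 0\<close> for every \<open>A\<close> of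
          positive weight; dividing by \<open>sp\<close> meets the bound 1 on coefficients in
          \<open>ber_ex_moments\<close>.\<close>
        have "ber_ex P I (\<lambda>A. (\<Sum>n\<in>I. (ind A n - P n) * (y n / sp))\<^sup>2) = (\<Sum>n\<in>I. P n * (1 - P n) * (y n / sp)\<^sup>2)"
          using ber_ex_moments[of I P "\<lambda>n. y n / sp"] fin P spread 3 by (simp add: abs_divide)
        also have "\<dots> = t\<^sup>2 / sp\<^sup>2" unfolding t2 by (simp add: power_divide sum_divide_distrib)
        finally have "(\<Sum>A\<in>Pow I. ber_wt P I A * (\<Sum>n\<in>I. (ind A n - P n) * (y n / sp))\<^sup>2) = 0"
          using 3 by (simp add: ber_ex_def)
        then have "ber_wt P I A * (\<Sum>n\<in>I. (ind A n - P n) * (y n / sp))\<^sup>2 = 0"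
          using A fin P by (subst (asm) sum_nonneg_eq_0_iff) (auto intro!: mult_nonneg_nonneg ber_wt_nonneg)
        moreover have "(\<Sum>n\<in>I. (ind A n - P n) * (y n / sp)) = S A / sp" by (simp add: S_def sum_divide_distrib)
        ultimately show ?thesis using 3 by auto
      qed
      ultimately show ?thesis by auto
    qed
    have "ber_ex P I (\<lambda>A. of_bool (lam * t < \<bar>S A\<bar> \<and> F A)) = 0"
      unfolding ber_ex_def by (rule sum.neutral) (use null in blast)
    moreover have "0 \<le> ber_ex P I (\<lambda>A. of_bool (F A))" by (rule ber_ex_nonneg) (use P in auto)
    ultimately show ?thesis using del by simp
  qed
  have law: "measure_pmf.prob (Pi_pmf {1..N} 0 Z) {c. Q (W c)} = ber_ex P I (\<lambda>A. of_bool (Q A))" for Q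
  proof -
    have "measure_pmf.prob (Pi_pmf I 0 Z) {c. Q {n \<in> I. c n = k}} = ber_ex (\<lambda>n. pmf (Z n) k) I (\<lambda>A. of_bool (Q A))"
      by (rule prob_Pi_pmf_level_set[OF fin])
    also have "\<dots> = ber_ex P I (\<lambda>A. of_bool (Q A))"
      unfolding ber_ex_def ber_wt_def
    proof (rule sum.cong)
      fix A assume "A \<in> Pow I"
      then have "(\<Prod>n\<in>A. pmf (Z n) k) = (\<Prod>n\<in>A. P n)" "(\<Prod>n\<in>I - A. 1 - pmf (Z n) k) = (\<Prod>n\<in>I - A. 1 - P n)"
        using Zk by (auto intro!: prod.cong)
      then show "(\<Prod>n\<in>A. pmf (Z n) k) * (\<Prod>n\<in>I - A. 1 - pmf (Z n) k) * of_bool (Q A)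
        = (\<Prod>n\<in>A. P n) * (\<Prod>n\<in>I - A. 1 - P n) * of_bool (Q A)" by simp
    qed simp
    finally show ?thesis by (simp add: W_def I_def)
  qed
  show ?thesis unfolding t_def[symmetric] sp_def[symmetric] lam_def[symmetric] r_def[symmetric]
  proof (rule cond_prob_ge[OF Ew_pos])
    have "measure_pmf.prob (Pi_pmf {1..N} 0 Z)
        {c. \<not> \<bar>(mu_SEM N x c k - mu_EM N x p k) $ i\<bar> \<le> lam / (1 - lam_w) * (t / r)
          \<and> \<bar>w_SEM N c k - w_EM N p k\<bar> \<le> lam_w * w_EM N p k}
      \<le> measure_pmf.prob (Pi_pmf {1..N} 0 Z) {c. lam * t < \<bar>S (W c)\<bar> \<and> F (W c)}"
    proof (rule measure_pmf.finite_measure_mono, rule subsetI)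
      fix c
      assume "c \<in> {c. \<not> \<bar>(mu_SEM N x c k - mu_EM N x p k) $ i\<bar> \<le> lam / (1 - lam_w) * (t / r)
          \<and> \<bar>w_SEM N c k - w_EM N p k\<bar> \<le> lam_w * w_EM N p k}"
      then have "\<not> \<bar>(mu_SEM N x c k - mu_EM N x p k) $ i\<bar> \<le> lam / (1 - lam_w) * (t / r)" "F (W c)"
        unfolding mem_Collect_eq E F_def by blast+
      then show "c \<in> {c. lam * t < \<bar>S (W c)\<bar> \<and> F (W c)}"
        using implies[of c] unfolding mem_Collect_eq F_def by (meson not_less)
    qed simp
    also have "\<dots> = ber_ex P I (\<lambda>A. of_bool (lam * t < \<bar>S A\<bar> \<and> F A))" by (rule law)
    also note tail
    also have "ber_ex P I (\<lambda>A. of_bool (F A)) = measure_pmf.prob (Pi_pmf {1..N} 0 Z) {c. F (W c)}" by (rule law[symmetric])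
    also have "{c. F (W c)} = {c. \<bar>w_SEM N c k - w_EM N p k\<bar> \<le> lam_w * w_EM N p k}" by (simp only: E F_def)
    finally show "measure_pmf.prob (Pi_pmf {1..N} 0 Z)
        {c. \<not> \<bar>(mu_SEM N x c k - mu_EM N x p k) $ i\<bar> \<le> lam / (1 - lam_w) * (t / r)
          \<and> \<bar>w_SEM N c k - w_EM N p k\<bar> \<le> lam_w * w_EM N p k}
      \<le> delta * measure_pmf.prob (Pi_pmf {1..N} 0 Z) {c. \<bar>w_SEM N c k - w_EM N p k\<bar> \<le> lam_w * w_EM N p k}" .
  qed
qed

end
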